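(* For every compact group $G$, the homomorphism of abelian groups $\alpha_G : C(G)\to\widehat{Z(G)}$, determined by $\alpha_G([X])=\chi_X$ for every $[X]\in\widehat{G}$, is an isomorphism. Here $C(G)$ is the chain group of $G$ and $\chi_X\in\widehat{Z(G)}$ is the character by which the center $Z(G)$ acts on the irreducible representation $X$.
   Context: Let $G$ be a compact (Hausdorff) group. Representations are finite-dimensional, continuous, unitary and complex; $\widehat{G}$ is the set of isomorphism classes of irreducible representations of $G$. For representations $Z,W$ write $Z\prec W$ if $Z$ is contained in $W$, i.e. $Z$ is isomorphic to a subrepresentation of $W$. The chain group $C(G)$ is the free abelian group (written multiplicatively) generated by the set $\widehat{G}$ modulo the relations $[Z]=[X]\cdot[Y]$ whenever $X,Y,Z$ are irreducible and $Z\prec X\otimes Y$. $Z(G)$ denotes the center of $G$, and $\widehat{Z(G)}$ is its dual group, i.e. the abelian group of continuous homomorphisms $Z(G)\to U(1)$ under pointwise multiplication. For an irreducible representation $X$ with homomorphism $\pi_X$, Schur's lemma gives $\pi_X(g)=\chi_X(g)\,\mathrm{id}_X$ for $g\in Z(G)$, with $\chi_X\in\widehat{Z(G)}$ depending only on $[X]$. The map $r_G:\widehat{G}\to\widehat{Z(G)}$, $[X]\mapsto\chi_X$, satisfies $\chi_Z=\chi_X\chi_Y$ whenever $Z\prec X\otimes Y$ (with $X,Y,Z$ irreducible), so there is a unique group homomorphism $\alpha_G:C(G)\to\widehat{Z(G)}$ sending the class of each generator $[X]$ to $\chi_X$. *)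

theory Defs
  imports
    "HOL-Analysis.T1_Spaces"
    "HOL-Algebra.Free_Abelian_Groups"
    "Jordan_Normal_Form.VS_Connect"
    "Jordan_Normal_Form.Schur_Decomposition"
begin

section \<open>Compact groups\<close>

locale compact_group = group G for G (structure) +
  fixes T :: "'a topology"
  assumes topspace_eq: "topspace T = carrier G"
    and compact: "compact_space T"
    and Hausdorff: "Hausdorff_space T"
    and continuous_mult: "continuous_map (prod_topology T T) T (\<lambda>(x, y). x \<otimes> y)"
    and continuous_inv: "continuous_map T T (\<lambda>x. inv x)"

definition center_group :: "('a, 'm) monoid_scheme \<Rightarrow> ('a, 'm) monoid_scheme" where
  "center_group G =
     G\<lparr>carrier := {z \<in> carrier G. \<forall>g\<in>carrier G. z \<otimes>\<^bsub>G\<^esub> g = g \<otimes>\<^bsub>G\<^esub> z}\<rparr>"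

definition U1 :: "complex monoid" where
  "U1 = \<lparr>carrier = {z. cmod z = 1}, monoid.mult = (*), one = 1\<rparr>"

text \<open>Characters are extensional, so that distinct elements of the carrier are distinct as
  functions on the group.\<close>

definition dual_group :: "('a, 'm) monoid_scheme \<Rightarrow> 'a topology \<Rightarrow> ('a \<Rightarrow> complex) monoid" where
  "dual_group H T =
     \<lparr>carrier = {\<chi> \<in> hom H U1 \<inter> extensional (carrier H). continuous_map T euclidean \<chi>},
      monoid.mult = (\<lambda>\<chi> \<psi>. \<lambda>z\<in>carrier H. \<chi> z * \<psi> z),
      one = (\<lambda>z\<in>carrier H. 1)\<rparr>"

definition center_dual :: "('a, 'm) monoid_scheme \<Rightarrow> 'a topology \<Rightarrow> ('a \<Rightarrow> complex) monoid" where
  "center_dual G T =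
     dual_group (center_group G) (subtopology T (carrier (center_group G)))"

section \<open>Representations\<close>

text \<open>A finite-dimensional representation is given in an orthonormal basis, as an action by
  matrices on \<open>\<complex>\<^sup>n\<close> with its standard inner product; every finite-dimensional unitary
  representation is isomorphic to one of this form. The values of the matrix function outside the
  carrier of the group are irrelevant: they are ignored by the isomorphism relation below.\<close>

datatype 'a rep = Rep (rdim: nat) (rmat: "'a \<Rightarrow> complex mat")

definition unitary_rep :: "('a, 'm) monoid_scheme \<Rightarrow> 'a topology \<Rightarrow> 'a rep \<Rightarrow> bool" where
  "unitary_rep G T X \<longleftrightarrow>
     (\<forall>g\<in>carrier G. rmat X g \<in> carrier_mat (rdim X) (rdim X)) \<and>
     (\<forall>g\<in>carrier G. mat_adjoint (rmat X g) * rmat X g = 1\<^sub>m (rdim X)) \<and>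
     (\<forall>g\<in>carrier G. \<forall>h\<in>carrier G. rmat X (g \<otimes>\<^bsub>G\<^esub> h) = rmat X g * rmat X h) \<and>
     (\<forall>i<rdim X. \<forall>j<rdim X. continuous_map T euclidean (\<lambda>g. rmat X g $$ (i, j)))"

definition invariant_subspace ::
    "('a, 'm) monoid_scheme \<Rightarrow> 'a rep \<Rightarrow> complex vec set \<Rightarrow> bool" where
  "invariant_subspace G X S \<longleftrightarrow>
     subspace class_ring S (module_vec TYPE(complex) (rdim X)) \<and>
     (\<forall>g\<in>carrier G. \<forall>v\<in>S. rmat X g *\<^sub>v v \<in> S)"

definition irreps :: "('a, 'm) monoid_scheme \<Rightarrow> 'a topology \<Rightarrow> 'a rep set" where
  "irreps G T = {X. unitary_rep G T X \<and> rdim X > 0 \<and>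
     (\<forall>S. invariant_subspace G X S \<longrightarrow> S = {0\<^sub>v (rdim X)} \<or> S = carrier_vec (rdim X))}"

definition rep_iso :: "('a, 'm) monoid_scheme \<Rightarrow> 'a rep \<Rightarrow> 'a rep \<Rightarrow> bool" where
  "rep_iso G X Y \<longleftrightarrow>
     (\<exists>A\<in>carrier_mat (rdim Y) (rdim X). invertible_mat A \<and>
        (\<forall>g\<in>carrier G. A * rmat X g = rmat Y g * A))"

text \<open>\<open>contained G Z W\<close>: some linear bijection of \<open>Z\<close> onto an invariant subspace of \<open>W\<close>
  intertwines the two actions.\<close>

definition contained :: "('a, 'm) monoid_scheme \<Rightarrow> 'a rep \<Rightarrow> 'a rep \<Rightarrow> bool" where
  "contained G Z W \<longleftrightarrow>
     (\<exists>S. invariant_subspace G W S \<and>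
        (\<exists>A\<in>carrier_mat (rdim W) (rdim Z).
           bij_betw (\<lambda>v. A *\<^sub>v v) (carrier_vec (rdim Z)) S \<and>
           (\<forall>g\<in>carrier G. A * rmat Z g = rmat W g * A)))"

text \<open>The basis vector \<open>e\<^sub>k \<otimes> e\<^sub>l\<close> of the tensor product has index \<open>k * dim Y + l\<close>.\<close>

definition kronecker :: "complex mat \<Rightarrow> complex mat \<Rightarrow> complex mat" where
  "kronecker A B = mat (dim_row A * dim_row B) (dim_col A * dim_col B)
     (\<lambda>(i, j). A $$ (i div dim_row B, j div dim_col B) * B $$ (i mod dim_row B, j mod dim_col B))"

definition tensor_rep :: "'a rep \<Rightarrow> 'a rep \<Rightarrow> 'a rep" where
  "tensor_rep X Y = Rep (rdim X * rdim Y) (\<lambda>g. kronecker (rmat X g) (rmat Y g))"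

definition irrep_rel :: "('a, 'm) monoid_scheme \<Rightarrow> 'a topology \<Rightarrow> 'a rep rel" where
  "irrep_rel G T = {(X, Y). X \<in> irreps G T \<and> Y \<in> irreps G T \<and> rep_iso G X Y}"

definition irrep_class :: "('a, 'm) monoid_scheme \<Rightarrow> 'a topology \<Rightarrow> 'a rep \<Rightarrow> 'a rep set" where
  "irrep_class G T X = irrep_rel G T `` {X}"

definition irrep_classes :: "('a, 'm) monoid_scheme \<Rightarrow> 'a topology \<Rightarrow> 'a rep set set" where
  "irrep_classes G T = irreps G T // irrep_rel G T"

section \<open>The chain group\<close>

abbreviation chain_free ::
    "('a, 'm) monoid_scheme \<Rightarrow> 'a topology \<Rightarrow> ('a rep set \<Rightarrow>\<^sub>0 int) monoid" where
  "chain_free G T \<equiv> free_Abelian_group (irrep_classes G T)"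

definition chain_relators ::
    "('a, 'm) monoid_scheme \<Rightarrow> 'a topology \<Rightarrow> ('a rep set \<Rightarrow>\<^sub>0 int) set" where
  "chain_relators G T =
     {frag_of (irrep_class G T Z) \<otimes>\<^bsub>chain_free G T\<^esub>
        inv\<^bsub>chain_free G T\<^esub> (frag_of (irrep_class G T X) \<otimes>\<^bsub>chain_free G T\<^esub>
          frag_of (irrep_class G T Y)) | X Y Z.
      X \<in> irreps G T \<and> Y \<in> irreps G T \<and> Z \<in> irreps G T \<and> contained G Z (tensor_rep X Y)}"

definition chain_group ::
    "('a, 'm) monoid_scheme \<Rightarrow> 'a topology \<Rightarrow> ('a rep set \<Rightarrow>\<^sub>0 int) set monoid" where
  "chain_group G T = chain_free G T Mod generate (chain_free G T) (chain_relators G T)"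

definition chain_class ::
    "('a, 'm) monoid_scheme \<Rightarrow> 'a topology \<Rightarrow> 'a rep \<Rightarrow> ('a rep set \<Rightarrow>\<^sub>0 int) set" where
  "chain_class G T X =
     generate (chain_free G T) (chain_relators G T) #>\<^bsub>chain_free G T\<^esub>
       frag_of (irrep_class G T X)"

section \<open>The comparison homomorphism\<close>

definition central_char :: "('a, 'm) monoid_scheme \<Rightarrow> 'a rep \<Rightarrow> 'a \<Rightarrow> complex" where
  "central_char G X =
     (\<lambda>z\<in>carrier (center_group G). THE c. rmat X z = c \<cdot>\<^sub>m 1\<^sub>m (rdim X))"

text \<open>Extensionality makes the homomorphism unique as a HOL function.\<close>

definition alpha ::
    "('a, 'm) monoid_scheme \<Rightarrow> 'a topology \<Rightarrow> ('a rep set \<Rightarrow>\<^sub>0 int) set \<Rightarrow> 'a \<Rightarrow> complex" where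
  "alpha G T = (THE f.
     f \<in> hom (chain_group G T) (center_dual G T) \<inter> extensional (carrier (chain_group G T)) \<and>
     (\<forall>X\<in>irreps G T. f (chain_class G T X) = central_char G X))"

end

theory Submission
  imports Defs
    "HOL-Analysis.Abstract_Limits"
    "HOL-Analysis.Urysohn"
    "HOL-Analysis.Weierstrass_Theorems"
    "HOL-Analysis.Function_Topology"
    "Jordan_Normal_Form.Spectral_Radius"
begin

text \<open>Every element of the chain group is the class of a single irreducible representation: products
  are classes of constituents of tensor products, inverses are classes of dual representations.

  Injectivity. Let \<open>P\<close> be the set of irreducible representations of trivial class and let \<open>A\<close> be the
  span of their matrix coefficients, a unital algebra closed under conjugation. All constituents of
  \<open>Y \<otimes> dual Y\<close> lie in \<open>P\<close>. So if all functions in \<open>A\<close> agree at \<open>g\<close> and \<open>h\<close>, then \<open>g\<inverse>h\<close> acts by a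
  scalar in every irreducible representation and is central by Peter--Weyl. If \<open>X\<close> has trivial central
  character, its coefficients therefore factor through \<open>A\<close> and are uniform limits of functions in \<open>A\<close>
  (Stone--Weierstrass), whereas they would be orthogonal to \<open>A\<close> if \<open>X\<close> were not in \<open>P\<close>.

  Surjectivity. The central characters separate the points of the center, so their span is uniformly
  dense there, and a character of the center outside this set would be orthogonal to it.

  No Haar measure is used. The invariant mean of a continuous function is the constant that is
  approximated by averages of its translates (von Neumann). Peter--Weyl is obtained from a kernel
  \<open>k = a * a\<^sup>*\<close>: its even convolution powers, rescaled by the norm of the operator, decrease as positive
  definite functions and so converge uniformly to an idempotent, whose range is finite-dimensional.\<close>

hide_const (open) Finite_Cartesian_Product.mat Finite_Cartesian_Product.row
  Finite_Cartesian_Product.rows Finite_Cartesian_Product.columns Finite_Cartesian_Product.vec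
hide_type (open) Finite_Cartesian_Product.vec
no_notation Finite_Cartesian_Product.vec_nth (infixl "$" 90)

section \<open>Continuous functions on products of compact spaces\<close>

text \<open>Without a measure there is no Hilbert space of square-integrable functions and no
  spectral theorem for compact operators: every limit has to be taken uniformly, among continuous
  functions. This is the reason for positive definite functions. They are bounded by their value at
  the identity, so monotone convergence at that one point controls convergence everywhere, and a
  lower bound there keeps the limit from vanishing.

  The kernel is built from \<open>a = translate n h - h\<close>, which is orthogonal to all
  functions fixed by translation by \<open>n\<close>. The orthogonality passes to the idempotent,
  which is therefore not fixed by \<open>n\<close>; so \<open>n\<close> acts nontrivially on the
  range. Real-valued functions suffice there, since real orthogonal matrices are unitary.

  A constituent of \<open>tensor_rep Y (dual_rep Y)\<close> has the class of \<open>Y\<close> times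
  its inverse as its class, hence the trivial one. Both final contradictions are numerical: a unit
  column, or a character of modulus one, has mean square one, while approximation by functions
  orthogonal to it allows at most one half.\<close>

lemma continuous_map_slice:
  assumes "continuous_map (prod_topology X Y) Z (\<lambda>(x, y). F x y)"
  shows "x \<in> topspace X \<Longrightarrow> continuous_map Y Z (F x)"
    and "y \<in> topspace Y \<Longrightarrow> continuous_map X Z (\<lambda>x. F x y)"
proof -
  assume "x \<in> topspace X"
  then have "continuous_map Y (prod_topology X Y) (\<lambda>y. (x, y))"
    by (intro continuous_map_pairedI) auto
  from continuous_map_compose[OF this assms] show "continuous_map Y Z (F x)"
    by (simp add: o_def)
next
  assume "y \<in> topspace Y"
  then have "continuous_map X (prod_topology X Y) (\<lambda>x. (x, y))"
    by (intro continuous_map_pairedI) auto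
  from continuous_map_compose[OF this assms] show "continuous_map X Z (\<lambda>x. F x y)"
    by (simp add: o_def)
qed

lemma continuous_map_swap:
  assumes "continuous_map (prod_topology X Y) Z (\<lambda>(x, y). F x y)"
  shows "continuous_map (prod_topology Y X) Z (\<lambda>(y, x). F x y)"
proof -
  have "continuous_map (prod_topology Y X) (prod_topology X Y) (\<lambda>p. (snd p, fst p))"
    by (intro continuous_map_pairedI continuous_map_fst continuous_map_snd)
  from continuous_map_compose[OF this assms] show ?thesis
    by (simp add: o_def case_prod_unfold)
qed

text \<open>The tube lemma gives the uniformity in \<open>y\<close>: the open set of points where
  \<open>F\<close> is within \<open>e\<close> of its values over \<open>x0\<close> contains the
  slice over \<open>x0\<close>, hence a whole tube around it.\<close>

lemma compact_uniform_neighbourhood: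
  fixes F :: "'a \<Rightarrow> 'b \<Rightarrow> real"
  assumes F: "continuous_map (prod_topology X Y) euclidean (\<lambda>(x, y). F x y)"
    and Y: "compact_space Y" and x0: "x0 \<in> topspace X" and e: "e > 0"
  obtains U where "openin X U" "x0 \<in> U"
    "\<And>x y. x \<in> U \<Longrightarrow> y \<in> topspace Y \<Longrightarrow> \<bar>F x y - F x0 y\<bar> < e"
proof -
  let ?W = "{p \<in> topspace (prod_topology X Y). (case_prod F p - F x0 (snd p)) \<in> {-e<..<e}}"
  have "continuous_map (prod_topology X Y) euclidean (\<lambda>p. F x0 (snd p))"
    using continuous_map_of_snd[of X Y euclidean "F x0"] continuous_map_slice(1)[OF F x0]
    by (simp add: o_def)
  then have "continuous_map (prod_topology X Y) euclidean (\<lambda>p. case_prod F p - F x0 (snd p))"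
    by (intro continuous_map_diff F)
  then have W: "openin (prod_topology X Y) ?W"
    by (rule openin_continuous_map_preimage) (simp flip: open_openin)
  have "{x0} \<times> topspace Y \<subseteq> ?W" using x0 e by auto
  from tube_lemma_right[OF W _ x0 this] Y obtain U V where
    "openin X U" "x0 \<in> U" "topspace Y \<subseteq> V" "U \<times> V \<subseteq> ?W"
    by (auto simp: compact_space_def)
  then have "(x, y) \<in> ?W" if "x \<in> U" "y \<in> topspace Y" for x y using that by blast
  then show ?thesis using \<open>openin X U\<close> \<open>x0 \<in> U\<close> by (intro that[of U]) (force simp: abs_less_iff)+
qed

text \<open>Compactness in the first variable leaves finitely many slices that approximate all
  others uniformly. Applied to \<open>f (x \<otimes> y)\<close> this takes the place of uniform
  continuity of \<open>f\<close> on the group.\<close>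

lemma compact_uniform_net:
  fixes F :: "'a \<Rightarrow> 'b \<Rightarrow> real"
  assumes F: "continuous_map (prod_topology X Y) euclidean (\<lambda>(x, y). F x y)"
    and X: "compact_space X" and Y: "compact_space Y" and e: "e > 0"
  obtains D where "finite D" "D \<subseteq> topspace X"
    "\<And>x. x \<in> topspace X \<Longrightarrow> \<exists>d\<in>D. \<forall>y\<in>topspace Y. \<bar>F x y - F d y\<bar> < e"
proof -
  have "\<forall>x0\<in>topspace X. \<exists>U. openin X U \<and> x0 \<in> U \<and> (\<forall>x\<in>U. \<forall>y\<in>topspace Y. \<bar>F x y - F x0 y\<bar> < e)"
    using compact_uniform_neighbourhood[OF F Y _ e] by metis
  from bchoice[OF this] obtain U where U: "\<forall>x0\<in>topspace X. openin X (U x0) \<and> x0 \<in> U x0 \<and>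
      (\<forall>x\<in>U x0. \<forall>y\<in>topspace Y. \<bar>F x y - F x0 y\<bar> < e)" ..
  have "Ball (U ` topspace X) (openin X) \<and> topspace X \<subseteq> \<Union>(U ` topspace X)" using U by blast
  then have "\<exists>\<F>. finite \<F> \<and> \<F> \<subseteq> U ` topspace X \<and> topspace X \<subseteq> \<Union>\<F>"
    using X unfolding compact_space_alt by meson
  then obtain D where "finite D" "D \<subseteq> topspace X" "topspace X \<subseteq> \<Union>(U ` D)"
    by (metis finite_subset_image)
  then show ?thesis using U by (intro that[of D]) blast+
qed

lemma compact_space_bounded:
  fixes f :: "'a \<Rightarrow> real"
  assumes "compact_space X" "continuous_map X euclidean f"
  obtains B where "B > 0" "\<And>x. x \<in> topspace X \<Longrightarrow> \<bar>f x\<bar> \<le> B"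
proof -
  have "compact (f ` topspace X)"
    using image_compactin[of X "topspace X" euclidean f] assms by (simp add: compact_space_def)
  then have "bounded (f ` topspace X)" by (rule compact_imp_bounded)
  then show ?thesis using that unfolding bounded_pos by auto
qed

lemma compact_space_attains_inf:
  fixes f :: "'a \<Rightarrow> real"
  assumes "compact_space X" "continuous_map X euclidean f" "topspace X \<noteq> {}"
  obtains x where "x \<in> topspace X" "\<And>y. y \<in> topspace X \<Longrightarrow> f x \<le> f y"
proof -
  have "compact (f ` topspace X)"
    using image_compactin[of X "topspace X" euclidean f] assms by (simp add: compact_space_def)
  from compact_attains_inf[OF this] show ?thesis using assms(3) that by auto
qed

lemma continuous_map_realI:
  fixes f :: "'a \<Rightarrow> real"
  assumes "\<And>x e. x \<in> topspace X \<Longrightarrow> e > 0 \<Longrightarrow> \<exists>U. openin X U \<and> x \<in> U \<and> (\<forall>y\<in>U. \<bar>f y - f x\<bar> < e)"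
  shows "continuous_map X euclidean f"
proof -
  have "continuous_map X Met_TC.mtopology f"
    unfolding Met_TC.continuous_map_to_metric
  proof (intro ballI allI impI)
    fix x and e :: real assume "x \<in> topspace X" "e > 0"
    then obtain U where "openin X U" "x \<in> U" "\<forall>y\<in>U. \<bar>f y - f x\<bar> < e" using assms by metis
    then show "\<exists>U. openin X U \<and> x \<in> U \<and> (\<forall>y\<in>U. f y \<in> Met_TC.mball (f x) e)"
      by (intro exI[of _ U]) (auto simp: dist_real_def abs_minus_commute)
  qed
  then show ?thesis by simp
qed

lemma continuous_map_real_limit:
  fixes f :: "'a \<Rightarrow> real"
  assumes "\<And>e. e > 0 \<Longrightarrow> \<exists>g. continuous_map X euclidean g \<and> (\<forall>x\<in>topspace X. \<bar>f x - g x\<bar> < e)"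
  shows "continuous_map X euclidean f"
proof (rule continuous_map_realI)
  fix x and e :: real assume x: "x \<in> topspace X" and e: "e > 0"
  show "\<exists>U. openin X U \<and> x \<in> U \<and> (\<forall>y\<in>U. \<bar>f y - f x\<bar> < e)"
  proof -
    obtain g where g: "continuous_map X euclidean g" "\<forall>x\<in>topspace X. \<bar>f x - g x\<bar> < e/3"
      using assms[of "e/3"] e by auto
    let ?U = "{y \<in> topspace X. g y \<in> ball (g x) (e/3)}"
    have "openin X ?U"
      by (rule openin_continuous_map_preimage[OF g(1)]) (simp flip: open_openin)
    moreover have "x \<in> ?U" using x e by auto
    moreover have "\<bar>f y - f x\<bar> < e" if "y \<in> ?U" for y
    proof -
      have "\<bar>f x - g x\<bar> < e/3" "\<bar>f y - g y\<bar> < e/3" "\<bar>g x - g y\<bar> < e/3"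
        using that g(2) x by (auto simp: dist_real_def)
      then show ?thesis by linarith
    qed
    ultimately show ?thesis by blast
  qed
qed

section \<open>The invariant mean\<close>

text \<open>The nodes form a list, so that repeated points count with multiplicity and a composition
  of two averages is again an average without new weights.\<close>

definition (in group) ravg :: "'a list \<Rightarrow> ('a \<Rightarrow> real) \<Rightarrow> 'a \<Rightarrow> real" where
  "ravg xs f x = (\<Sum>s\<leftarrow>xs. f (x \<otimes> s)) / length xs"

definition (in group) lavg :: "'a list \<Rightarrow> ('a \<Rightarrow> real) \<Rightarrow> 'a \<Rightarrow> real" where
  "lavg xs f x = (\<Sum>s\<leftarrow>xs. f (s \<otimes> x)) / length xs"

definition (in group) nodes :: "'a list \<Rightarrow> bool" where
  "nodes xs \<longleftrightarrow> xs \<noteq> [] \<and> set xs \<subseteq> carrier G"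

definition (in group) rapprox :: "('a \<Rightarrow> real) \<Rightarrow> real \<Rightarrow> bool" where
  "rapprox f c \<longleftrightarrow> (\<forall>e>0. \<exists>xs. nodes xs \<and> (\<forall>x\<in>carrier G. \<bar>ravg xs f x - c\<bar> \<le> e))"

definition (in group) lapprox :: "('a \<Rightarrow> real) \<Rightarrow> real \<Rightarrow> bool" where
  "lapprox f c \<longleftrightarrow> (\<forall>e>0. \<exists>xs. nodes xs \<and> (\<forall>x\<in>carrier G. \<bar>lavg xs f x - c\<bar> \<le> e))"

text \<open>For continuous functions the description is justified: a right constant exists, and
  comparison with averages on the other side makes it unique.\<close>

definition (in group) mean :: "('a \<Rightarrow> real) \<Rightarrow> real" where
  "mean f = (THE c. rapprox f c)"

definition (in group) list_prod :: "'a list \<Rightarrow> 'a list \<Rightarrow> 'a list" where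
  "list_prod xs ys = concat (map (\<lambda>s. map (\<lambda>t. s \<otimes> t) ys) xs)"

lemma average_mono:
  fixes h :: "'a \<Rightarrow> real"
  assumes "xs \<noteq> []" "\<And>s. s \<in> set xs \<Longrightarrow> h s \<le> k s"
  shows "(\<Sum>s\<leftarrow>xs. h s) / length xs \<le> (\<Sum>s\<leftarrow>xs. k s) / length xs"
  using assms by (intro divide_right_mono sum_list_mono) auto

lemma average_const: "xs \<noteq> [] \<Longrightarrow> (\<Sum>s\<leftarrow>xs. c) / length xs = (c::real)"
  by (simp add: sum_list_triv)

lemma average_diff_le:
  fixes h :: "'a \<Rightarrow> real"
  assumes "xs \<noteq> []" "\<And>s. s \<in> set xs \<Longrightarrow> \<bar>h s - k s\<bar> \<le> e"
  shows "\<bar>(\<Sum>s\<leftarrow>xs. h s) / length xs - (\<Sum>s\<leftarrow>xs. k s) / length xs\<bar> \<le> e"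
proof -
  have "(\<Sum>s\<leftarrow>xs. h s) / length xs - (\<Sum>s\<leftarrow>xs. k s) / length xs
      = (\<Sum>s\<leftarrow>xs. h s - k s) / length xs"
    by (simp add: sum_list_subtractf diff_divide_distrib)
  moreover have "(\<Sum>s\<leftarrow>xs. h s - k s) / length xs \<le> e"
    using average_mono[of xs "\<lambda>s. h s - k s" "\<lambda>_. e"] assms average_const[of xs e] by force
  moreover have "- e \<le> (\<Sum>s\<leftarrow>xs. h s - k s) / length xs"
    using average_mono[of xs "\<lambda>_. - e" "\<lambda>s. h s - k s"] assms average_const[of xs "-e"] by force
  ultimately show ?thesis by linarith
qed

lemma average_near:
  fixes h :: "'a \<Rightarrow> real"
  assumes "xs \<noteq> []" "\<And>s. s \<in> set xs \<Longrightarrow> \<bar>h s - c\<bar> \<le> e"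
  shows "\<bar>(\<Sum>s\<leftarrow>xs. h s) / length xs - c\<bar> \<le> e"
  using average_diff_le[of xs h "\<lambda>_. c" e] assms average_const[of xs c] by simp

lemma sum_list_divide: "(\<Sum>s\<leftarrow>xs. f s / c) = (\<Sum>s\<leftarrow>xs. f s) / (c::real)"
  by (induction xs) (simp_all add: add_divide_distrib)

lemma sum_list_swap:
  "(\<Sum>s\<leftarrow>xs. \<Sum>t\<leftarrow>ys. f s t) = (\<Sum>t\<leftarrow>ys. \<Sum>s\<leftarrow>xs. (f s t :: 'a::comm_monoid_add))"
  by (induction xs) (simp_all add: sum_list_addf)

context group
begin

lemma nodes_list_prod: "nodes xs \<Longrightarrow> nodes ys \<Longrightarrow> nodes (list_prod xs ys)"
  by (auto simp: nodes_def list_prod_def)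

lemma ravg_list_prod:
  assumes "nodes xs" "nodes ys" "x \<in> carrier G"
  shows "ravg (list_prod xs ys) f x = ravg xs (ravg ys f) x"
proof -
  have len: "length (list_prod xs ys) = length xs * length ys"
    unfolding list_prod_def by (induction xs) auto
  have "set zs \<subseteq> carrier G \<Longrightarrow> (\<Sum>u\<leftarrow>list_prod zs ys. f (x \<otimes> u)) = (\<Sum>s\<leftarrow>zs. \<Sum>t\<leftarrow>ys. f (x \<otimes> s \<otimes> t))" for zs
    unfolding list_prod_def using assms(2,3)
    by (induction zs) (auto simp: nodes_def m_assoc o_def subset_iff cong: map_cong)
  then show ?thesis using assms
    by (simp add: ravg_def len nodes_def sum_list_divide)
qed

text \<open>Translations on opposite sides commute by associativity, hence so do finite averages.
  The comparison of left and right approximations rests on this.\<close>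

lemma lavg_ravg:
  assumes "nodes xs" "nodes ys" "x \<in> carrier G"
  shows "lavg ys (ravg xs f) x = ravg xs (lavg ys f) x"
proof -
  have "(\<Sum>t\<leftarrow>ys. (\<Sum>s\<leftarrow>xs. f (t \<otimes> x \<otimes> s)) / length xs) / length ys
      = (\<Sum>t\<leftarrow>ys. \<Sum>s\<leftarrow>xs. f (t \<otimes> x \<otimes> s)) / length xs / length ys"
    by (simp add: sum_list_divide)
  also have "\<dots> = (\<Sum>s\<leftarrow>xs. \<Sum>t\<leftarrow>ys. f (t \<otimes> x \<otimes> s)) / length xs / length ys"
    by (subst sum_list_swap) simp
  also have "\<dots> = (\<Sum>s\<leftarrow>xs. (\<Sum>t\<leftarrow>ys. f (t \<otimes> x \<otimes> s)) / length ys) / length xs"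
    by (simp add: sum_list_divide)
  also have "\<dots> = (\<Sum>s\<leftarrow>xs. (\<Sum>t\<leftarrow>ys. f (t \<otimes> (x \<otimes> s))) / length ys) / length xs"
    using assms by (intro arg_cong[of _ _ "\<lambda>l. sum_list l / _"] map_cong refl
        arg_cong[of _ _ "\<lambda>l. sum_list l / _"] arg_cong[of _ _ f] m_assoc) (auto simp: nodes_def)
  finally show ?thesis by (simp add: lavg_def ravg_def)
qed

lemma ravg_near:
  assumes "nodes xs" "x \<in> carrier G" "\<And>y. y \<in> carrier G \<Longrightarrow> \<bar>f y - c\<bar> \<le> e"
  shows "\<bar>ravg xs f x - c\<bar> \<le> e"
  unfolding ravg_def using assms by (intro average_near) (auto simp: nodes_def)

lemma lavg_near:
  assumes "nodes xs" "x \<in> carrier G" "\<And>y. y \<in> carrier G \<Longrightarrow> \<bar>f y - c\<bar> \<le> e"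
  shows "\<bar>lavg xs f x - c\<bar> \<le> e"
  unfolding lavg_def using assms by (intro average_near) (auto simp: nodes_def)

text \<open>Averaging on both sides at once yields a number within \<open>e\<close> of
  \<open>c\<close> and within \<open>e\<close> of \<open>d\<close>. Two right constants are never
  compared directly, only through a left one.\<close>

lemma rapprox_lapprox_unique:
  assumes "rapprox f c" "lapprox f d"
  shows "c = d"
proof -
  have "\<bar>c - d\<bar> \<le> 2 * e" if e: "e > 0" for e
  proof -
    obtain xs where xs: "nodes xs" "\<And>x. x \<in> carrier G \<Longrightarrow> \<bar>ravg xs f x - c\<bar> \<le> e"
      using assms(1) e unfolding rapprox_def by blast
    obtain ys where ys: "nodes ys" "\<And>x. x \<in> carrier G \<Longrightarrow> \<bar>lavg ys f x - d\<bar> \<le> e"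
      using assms(2) e unfolding lapprox_def by blast
    have "\<bar>lavg ys (ravg xs f) \<one> - c\<bar> \<le> e" using xs ys by (intro lavg_near) auto
    moreover have "\<bar>ravg xs (lavg ys f) \<one> - d\<bar> \<le> e" using xs ys by (intro ravg_near) auto
    ultimately show ?thesis using lavg_ravg[OF xs(1) ys(1), of \<one> f] by simp
  qed
  from this[of "\<bar>c - d\<bar> / 4"] show ?thesis by (cases "c = d") auto
qed

lemma lavg_inv:
  assumes "nodes xs" "x \<in> carrier G"
  shows "lavg (map (\<lambda>s. inv s) xs) f x = ravg xs (\<lambda>y. f (inv y)) (inv x)"
proof -
  have "(\<Sum>s\<leftarrow>xs. f (inv s \<otimes> x)) = (\<Sum>s\<leftarrow>xs. f (inv (inv x \<otimes> s)))"
    using assms by (intro arg_cong[of _ _ sum_list] map_cong refl) (auto simp: nodes_def inv_mult_group)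
  then show ?thesis unfolding lavg_def ravg_def by (simp add: o_def)
qed

text \<open>Inversion exchanges the two sides, so left constants of \<open>f\<close> come from right
  constants of \<open>f (inv y)\<close>.\<close>

lemma lapprox_inv:
  assumes "rapprox (\<lambda>y. f (inv y)) c"
  shows "lapprox f c"
  unfolding lapprox_def
proof (intro allI impI)
  fix e :: real assume "e > 0"
  then obtain xs where xs: "nodes xs" "\<And>x. x \<in> carrier G \<Longrightarrow> \<bar>ravg xs (\<lambda>y. f (inv y)) x - c\<bar> \<le> e"
    using assms unfolding rapprox_def by blast
  have "nodes (map (\<lambda>s. inv s) xs)" using xs(1) by (auto simp: nodes_def)
  moreover have "\<forall>x\<in>carrier G. \<bar>lavg (map (\<lambda>s. inv s) xs) f x - c\<bar> \<le> e"
    using xs by (simp add: lavg_inv)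
  ultimately show "\<exists>xs. nodes xs \<and> (\<forall>x\<in>carrier G. \<bar>lavg xs f x - c\<bar> \<le> e)" by blast
qed

end

section \<open>Existence of the invariant mean\<close>

context compact_group
begin

abbreviation cont :: "('a \<Rightarrow> real) \<Rightarrow> bool" where
  "cont f \<equiv> continuous_map T euclidean f"

abbreviation cont2 :: "('a \<Rightarrow> 'a \<Rightarrow> real) \<Rightarrow> bool" where
  "cont2 F \<equiv> continuous_map (prod_topology T T) euclidean (\<lambda>(x, y). F x y)"

lemma continuous_map_mult:
  assumes "continuous_map X T f" "continuous_map X T g"
  shows "continuous_map X T (\<lambda>x. f x \<otimes> g x)"
proof -
  have "continuous_map X (prod_topology T T) (\<lambda>x. (f x, g x))"
    using assms by (intro continuous_map_pairedI)
  from continuous_map_compose[OF this continuous_mult] show ?thesis by (simp add: o_def)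
qed

lemma continuous_map_inv:
  "continuous_map X T f \<Longrightarrow> continuous_map X T (\<lambda>x. inv (f x))"
  using continuous_map_compose[OF _ continuous_inv] by (simp add: o_def)

lemma continuous_map_const_T: "c \<in> carrier G \<Longrightarrow> continuous_map X T (\<lambda>_. c)"
  by (simp add: topspace_eq)

lemma cont_compose: "continuous_map T euclidean f \<Longrightarrow> continuous_map X T g \<Longrightarrow> continuous_map X euclidean (\<lambda>x. f (g x))"
  using continuous_map_compose[of X T g euclidean f] by (simp add: o_def)

lemma continuous_map_id': "continuous_map T T (\<lambda>x. x)"
  using continuous_map_id[of T] by (simp add: id_def)

lemmas cont_intros = continuous_map_mult continuous_map_inv continuous_map_const_T
  continuous_map_id' continuous_map_fst continuous_map_snd continuous_map_fst_of[unfolded o_def]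
  continuous_map_snd_of[unfolded o_def]

lemma cont_ravg: "cont f \<Longrightarrow> nodes xs \<Longrightarrow> cont (ravg xs f)"
proof -
  assume f: "cont f" and xs: "nodes xs"
  have "set ys \<subseteq> carrier G \<Longrightarrow> cont (\<lambda>x. \<Sum>s\<leftarrow>ys. f (x \<otimes> s))" for ys
    by (induction ys) (auto intro!: continuous_map_add cont_compose[OF f] cont_intros)
  then have "cont (\<lambda>x. (1 / length xs) * (\<Sum>s\<leftarrow>xs. f (x \<otimes> s)))"
    using xs by (intro continuous_map_real_mult_left) (auto simp: nodes_def)
  then show ?thesis by (simp add: ravg_def[abs_def])
qed

lemma cont2_mult: assumes f: "cont f" shows "cont2 (\<lambda>x y. f (x \<otimes> y))"
  unfolding case_prod_unfold by (intro cont_compose[OF f] cont_intros)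

text \<open>Averaging a right average \<open>g\<close> of \<open>f\<close> over the right translations that move the points of a
  net to a minimum point of \<open>g\<close> lowers the maximum of \<open>g\<close> by an amount that depends only on the net.\<close>

lemma oscillation_step:
  assumes f: "cont f" and e: "e > 0"
    and D: "finite D" "D \<subseteq> carrier G" 
      "\<And>x. x \<in> carrier G \<Longrightarrow> \<exists>d\<in>D. \<forall>y\<in>carrier G. \<bar>f (x \<otimes> y) - f (d \<otimes> y)\<bar> < e/2"
    and xs: "nodes xs" and osc: "\<And>x y. x \<in> carrier G \<Longrightarrow> y \<in> carrier G \<Longrightarrow> ravg xs f x - ravg xs f y \<le> w"
    and w: "e \<le> w"
  obtains zs where "nodes zs"
    "\<And>x y. x \<in> carrier G \<Longrightarrow> y \<in> carrier G \<Longrightarrow> ravg zs f x - ravg zs f y \<le> w - e / (2 * card D)"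
proof -
  let ?g = "ravg xs f"
  have D0: "D \<noteq> {}" using D(3)[of \<one>] by auto
  then have m: "card D > 0" using D(1) by (simp add: card_gt_0_iff)
  obtain x0 where x0: "x0 \<in> carrier G" "\<And>y. y \<in> carrier G \<Longrightarrow> ?g x0 \<le> ?g y"
    using compact_space_attains_inf[OF compact cont_ravg[OF f xs]] topspace_eq by auto
  obtain ds where ds: "set ds = D" "distinct ds" using finite_distinct_list[OF D(1)] by blast
  let ?ss = "map (\<lambda>d. inv d \<otimes> x0) ds"
  have ss: "nodes ?ss" using D0 D(2) ds x0 by (auto simp: nodes_def)
  have avg: "ravg (list_prod ?ss xs) f x = (\<Sum>d\<in>D. ?g (x \<otimes> (inv d \<otimes> x0))) / card D" if "x \<in> carrier G" for x
    using ravg_list_prod[OF ss xs that, of f] ds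
    by (simp add: ravg_def[of ?ss] o_def sum_list_distinct_conv_sum_set distinct_card[of ds, symmetric])
  have lower: "?g x0 \<le> ravg (list_prod ?ss xs) f x" if x: "x \<in> carrier G" for x
  proof -
    have "card D * ?g x0 \<le> (\<Sum>d\<in>D. ?g (x \<otimes> (inv d \<otimes> x0)))"
      using x x0 D(2) by (intro sum_bounded_below) auto
    then show ?thesis using avg[OF x] m by (simp add: pos_le_divide_eq mult.commute)
  qed
  \<comment> \<open>The net point \<open>d\<close> close to \<open>x\<close> brings its translate to
    within \<open>e/2\<close> of the minimum; the other \<open>card D - 1\<close> terms exceed the
    minimum by at most \<open>w\<close>. The average therefore gains
    \<open>(w - e/2) / card D\<close>, which is at least \<open>e / (2 * card D)\<close> because
    \<open>e \<le> w\<close>.\<close>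
  have upper: "ravg (list_prod ?ss xs) f x \<le> ?g x0 + w - e / (2 * card D)" if x: "x \<in> carrier G" for x
  proof -
    obtain d where d: "d \<in> D" "\<forall>y\<in>carrier G. \<bar>f (x \<otimes> y) - f (d \<otimes> y)\<bar> < e/2" using D(3)[OF x] by blast
    have dG: "d \<in> carrier G" using d D by auto
    have "\<bar>?g (x \<otimes> (inv d \<otimes> x0)) - ?g (d \<otimes> (inv d \<otimes> x0))\<bar> \<le> e/2"
      unfolding ravg_def
    proof (rule average_diff_le)
      fix s assume "s \<in> set xs"
      then have s: "s \<in> carrier G" using xs by (auto simp: nodes_def)
      show "\<bar>f (x \<otimes> (inv d \<otimes> x0) \<otimes> s) - f (d \<otimes> (inv d \<otimes> x0) \<otimes> s)\<bar> \<le> e / 2"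
        using d(2)[rule_format, of "inv d \<otimes> x0 \<otimes> s"] x dG x0 s by (simp add: m_assoc)
    qed (use xs in \<open>auto simp: nodes_def\<close>)
    moreover have "d \<otimes> (inv d \<otimes> x0) = x0" using dG x0 by (simp flip: m_assoc)
    ultimately have 1: "?g (x \<otimes> (inv d \<otimes> x0)) \<le> ?g x0 + e/2"
      using abs_le_D1 by fastforce
    have "(\<Sum>c\<in>D-{d}. ?g (x \<otimes> (inv c \<otimes> x0))) \<le> card (D-{d}) * (?g x0 + w)"
    proof (rule sum_bounded_above)
      fix c assume "c \<in> D - {d}"
      then have "c \<in> carrier G" using D by auto
      then show "?g (x \<otimes> (inv c \<otimes> x0)) \<le> ?g x0 + w"
        using osc[of "x \<otimes> (inv c \<otimes> x0)" x0] x x0 by auto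
    qed
    moreover have "(\<Sum>c\<in>D. ?g (x \<otimes> (inv c \<otimes> x0))) 
        = ?g (x \<otimes> (inv d \<otimes> x0)) + (\<Sum>c\<in>D-{d}. ?g (x \<otimes> (inv c \<otimes> x0)))"
      using D(1) d(1) by (rule sum.remove)
    moreover have "real (card (D-{d})) = real (card D) - 1" using d(1) D(1) m by (simp add: of_nat_diff)
    ultimately have "(\<Sum>c\<in>D. ?g (x \<otimes> (inv c \<otimes> x0))) \<le> ?g x0 + e/2 + (real (card D) - 1) * (?g x0 + w)"
      using 1 by simp
    also have "\<dots> \<le> card D * (?g x0 + w) - e/2" using w by (simp add: algebra_simps)
    finally have "(\<Sum>c\<in>D. ?g (x \<otimes> (inv c \<otimes> x0))) / card D \<le> (card D * (?g x0 + w) - e/2) / card D"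
      by (rule divide_right_mono) simp
    also have "\<dots> = ?g x0 + w - e / (2 * card D)" using m by (simp add: field_simps)
    finally show ?thesis using avg[OF x] by simp
  qed
  show ?thesis
  proof (rule that[of "list_prod ?ss xs"])
    fix x y assume "x \<in> carrier G" "y \<in> carrier G"
    then show "ravg (list_prod ?ss xs) f x - ravg (list_prod ?ss xs) f y \<le> w - e / (2 * card D)"
      using upper[of x] lower[of y] by linarith
  qed (rule nodes_list_prod[OF ss xs])
qed

text \<open>The net belongs to \<open>f\<close> and not to the current average, so each step lowers
  the oscillation bound by the same \<open>\<delta>\<close>, starting from \<open>2 * B\<close>,
  until it drops to \<open>e\<close>.\<close>

lemma small_oscillation:
  assumes f: "cont f" and e: "e > 0"
  obtains xs where "nodes xs" "\<And>x y. x \<in> carrier G \<Longrightarrow> y \<in> carrier G \<Longrightarrow> ravg xs f x - ravg xs f y \<le> e"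
proof -
  obtain D where D: "finite D" "D \<subseteq> carrier G"
      "\<And>x. x \<in> carrier G \<Longrightarrow> \<exists>d\<in>D. \<forall>y\<in>carrier G. \<bar>f (x \<otimes> y) - f (d \<otimes> y)\<bar> < e/2"
    using compact_uniform_net[OF cont2_mult[OF f] compact compact, of "e/2"] e topspace_eq by auto
  have m: "card D > 0" using D(3)[of \<one>] D(1) by (auto simp: card_gt_0_iff)
  obtain B where B: "B > 0" "\<And>x. x \<in> carrier G \<Longrightarrow> \<bar>f x\<bar> \<le> B"
    using compact_space_bounded[OF compact f] topspace_eq by auto
  define \<delta> where "\<delta> = e / (2 * card D)"
  have "\<delta> > 0" using e m by (simp add: \<delta>_def)
  have "\<exists>xs. nodes xs \<and> (\<forall>x\<in>carrier G. \<forall>y\<in>carrier G. ravg xs f x - ravg xs f y \<le> max e (2 * B - n * \<delta>))" for n :: nat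
  proof (induction n)
    case 0
    have "ravg [\<one>] f x - ravg [\<one>] f y \<le> 2 * B" if "x \<in> carrier G" "y \<in> carrier G" for x y
      using B(2)[of x] B(2)[of y] that by (simp add: ravg_def)
    then show ?case by (intro exI[of _ "[\<one>]"]) (force simp: nodes_def)
  next
    case (Suc n)
    then obtain xs where xs: "nodes xs"
      "\<And>x y. x \<in> carrier G \<Longrightarrow> y \<in> carrier G \<Longrightarrow> ravg xs f x - ravg xs f y \<le> max e (2 * B - n * \<delta>)"
      by blast
    show ?case
    proof (cases "2 * B - n * \<delta> \<le> e")
      case True
      then have "ravg xs f x - ravg xs f y \<le> max e (2 * B - Suc n * \<delta>)" if "x \<in> carrier G" "y \<in> carrier G" for x y
        using xs(2)[OF that] by linarith
      then show ?thesis using xs(1) by blast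
    next
      case False
      then have "max e (2 * B - n * \<delta>) = 2 * B - n * \<delta>" "e \<le> 2 * B - n * \<delta>" by auto
      from oscillation_step[OF f e D xs[unfolded this(1)] this(2)] obtain zs where zs: "nodes zs"
        "\<And>x y. x \<in> carrier G \<Longrightarrow> y \<in> carrier G \<Longrightarrow> ravg zs f x - ravg zs f y \<le> 2 * B - n * \<delta> - \<delta>"
        unfolding \<delta>_def by blast
      have "2 * B - n * \<delta> - \<delta> = 2 * B - Suc n * \<delta>" by (simp add: algebra_simps)
      then have "ravg zs f x - ravg zs f y \<le> max e (2 * B - Suc n * \<delta>)" if "x \<in> carrier G" "y \<in> carrier G" for x y
        using zs(2)[OF that] by linarith
      then show ?thesis using zs(1) by blast
    qed
  qed
  note ex = this
  obtain n :: nat where "2 * B / \<delta> < n" using reals_Archimedean2 by blast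
  then have "2 * B - n * \<delta> \<le> e" using \<open>\<delta> > 0\<close> e by (simp add: field_simps)
  then have "max e (2 * B - n * \<delta>) = e" by simp
  from ex[of n, unfolded this] obtain xs where
    "nodes xs" "\<forall>x\<in>carrier G. \<forall>y\<in>carrier G. ravg xs f x - ravg xs f y \<le> e" by blast
  then show ?thesis by (intro that[of xs]) simp_all
qed

lemma ex_rapprox:
  assumes f: "cont f" obtains c where "rapprox f c"
proof -
  have small: "\<exists>xs c. nodes xs \<and> (\<forall>x\<in>carrier G. \<bar>ravg xs h x - c\<bar> \<le> e)" if h: "cont h" and e: "e > 0" for h e
  proof -
    obtain xs where xs: "nodes xs" "\<And>x y. x \<in> carrier G \<Longrightarrow> y \<in> carrier G \<Longrightarrow> ravg xs h x - ravg xs h y \<le> e"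
      using small_oscillation[OF h e] by blast
    have "\<bar>ravg xs h x - ravg xs h \<one>\<bar> \<le> e" if "x \<in> carrier G" for x
      using xs(2)[OF that, of \<one>] xs(2)[of \<one>, OF _ that] by simp
    then show ?thesis using xs(1) by blast
  qed
  have lsmall: "\<exists>xs c. nodes xs \<and> (\<forall>x\<in>carrier G. \<bar>lavg xs f x - c\<bar> \<le> e)" if e: "e > 0" for e
  proof -
    have "cont (\<lambda>y. f (inv y))" by (intro cont_compose[OF f] cont_intros)
    from small[OF this e] obtain xs c where xs: "nodes xs" 
      "\<forall>x\<in>carrier G. \<bar>ravg xs (\<lambda>y. f (inv y)) x - c\<bar> \<le> e" by blast
    have "nodes (map (\<lambda>s. inv s) xs)" using xs(1) by (auto simp: nodes_def)
    moreover have "\<forall>x\<in>carrier G. \<bar>lavg (map (\<lambda>s. inv s) xs) f x - c\<bar> \<le> e"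
      using xs by (simp add: lavg_inv)
    ultimately show ?thesis by blast
  qed
  \<comment> \<open>For each tolerance there is some nearly constant right average, but its constant
    may depend on the tolerance. The uniform lower bounds of right averages single out one value:
    any left average bounds them from above, and their supremum is squeezed between the two kinds of
    constants.\<close>
  define L where "L = {a. \<exists>xs. nodes xs \<and> (\<forall>x\<in>carrier G. a \<le> ravg xs f x)}"
  have L_le: "a \<le> c + e" if "a \<in> L" "nodes ys" "\<forall>x\<in>carrier G. \<bar>lavg ys f x - c\<bar> \<le> e" for a c e ys
  proof -
    obtain xs where xs: "nodes xs" "\<forall>x\<in>carrier G. a \<le> ravg xs f x" using \<open>a \<in> L\<close> unfolding L_def by blast
    have "a = (\<Sum>s\<leftarrow>ys. a) / length ys" using that(2) by (simp add: nodes_def average_const)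
    also have "\<dots> \<le> lavg ys (ravg xs f) \<one>"
      unfolding lavg_def using that(2) xs(2) by (intro average_mono) (auto simp: nodes_def)
    also have "\<dots> = ravg xs (lavg ys f) \<one>" using xs that by (intro lavg_ravg) auto
    also have "\<bar>\<dots> - c\<bar> \<le> e" using xs that by (intro ravg_near) auto
    ultimately show ?thesis by linarith
  qed
  obtain ys0 c0 where "nodes ys0" "\<forall>x\<in>carrier G. \<bar>lavg ys0 f x - c0\<bar> \<le> 1" using lsmall[of 1] by auto
  then have bdd: "bdd_above L" using L_le by (meson bdd_aboveI)
  have "rapprox f (Sup L)"
    unfolding rapprox_def
  proof (intro allI impI)
    fix e :: real assume e: "e > 0"
    obtain xs c where xs: "nodes xs" "\<forall>x\<in>carrier G. \<bar>ravg xs f x - c\<bar> \<le> e/4" using small[OF f, of "e/4"] e by auto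
    obtain ys d where ys: "nodes ys" "\<forall>x\<in>carrier G. \<bar>lavg ys f x - d\<bar> \<le> e/4" using lsmall[of "e/4"] e by auto
    have "\<bar>lavg ys (ravg xs f) \<one> - c\<bar> \<le> e/4" using xs ys by (intro lavg_near) auto
    moreover have "\<bar>ravg xs (lavg ys f) \<one> - d\<bar> \<le> e/4" using xs ys by (intro ravg_near) auto
    ultimately have cd: "\<bar>c - d\<bar> \<le> e/2" using lavg_ravg[OF xs(1) ys(1) one_closed, of f] by linarith
    have "c - e/4 \<le> ravg xs f x" if "x \<in> carrier G" for x
      using xs(2)[rule_format, OF that] by linarith
    then have inL: "c - e/4 \<in> L" unfolding L_def using xs(1) by blast
    have 1: "c - e/4 \<le> Sup L" by (rule cSup_upper[OF inL bdd])
    have 2: "Sup L \<le> d + e/4" using L_le[OF _ ys] inL by (intro cSup_least) auto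
    have "\<bar>ravg xs f x - Sup L\<bar> \<le> e" if "x \<in> carrier G" for x
      using 1 2 cd xs(2)[rule_format, OF that] by linarith
    then show "\<exists>xs. nodes xs \<and> (\<forall>x\<in>carrier G. \<bar>ravg xs f x - Sup L\<bar> \<le> e)" using xs(1) by blast
  qed
  then show ?thesis by (rule that)
qed

lemma mean_approx:
  assumes f: "cont f" shows "rapprox f (mean f)" "lapprox f (mean f)"
proof -
  obtain c where c: "rapprox f c" using ex_rapprox[OF f] .
  have "cont (\<lambda>y. f (inv y))" by (intro cont_compose[OF f] cont_intros)
  from ex_rapprox[OF this] obtain d where "rapprox (\<lambda>y. f (inv y)) d" .
  then have d: "lapprox f d" by (rule lapprox_inv)
  have cd: "c = d" by (rule rapprox_lapprox_unique[OF c d])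
  have "mean f = c" unfolding mean_def
  proof (rule the_equality[where P = "rapprox f", OF c])
    show "x = c" if "rapprox f x" for x
      using rapprox_lapprox_unique[OF that d] cd by simp
  qed
  with c d cd show "rapprox f (mean f)" "lapprox f (mean f)" by simp_all
qed

lemma mean_eqI: "cont f \<Longrightarrow> rapprox f c \<Longrightarrow> mean f = c"
  by (rule rapprox_lapprox_unique[symmetric, OF _ mean_approx(2)])

lemma mean_eqI_left: "cont f \<Longrightarrow> lapprox f c \<Longrightarrow> mean f = c"
  by (rule rapprox_lapprox_unique[OF mean_approx(1)])

section \<open>Invariance, linearity and positivity of the mean\<close>

lemma mean_cong: "(\<And>x. x \<in> carrier G \<Longrightarrow> f x = g x) \<Longrightarrow> mean f = mean g"
proof -
  assume eq: "\<And>x. x \<in> carrier G \<Longrightarrow> f x = g x"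
  have "ravg xs f x = ravg xs g x" if "nodes xs" "x \<in> carrier G" for xs x
  proof -
    have "(\<Sum>s\<leftarrow>xs. f (x \<otimes> s)) = (\<Sum>s\<leftarrow>xs. g (x \<otimes> s))"
      using that by (intro arg_cong[of _ _ sum_list] map_cong refl eq) (auto simp: nodes_def)
    then show ?thesis by (simp add: ravg_def)
  qed
  then have "(nodes xs \<and> (\<forall>x\<in>carrier G. \<bar>ravg xs f x - c\<bar> \<le> e)) \<longleftrightarrow>
      (nodes xs \<and> (\<forall>x\<in>carrier G. \<bar>ravg xs g x - c\<bar> \<le> e))" for xs c e
    by auto
  then have "rapprox f c = rapprox g c" for c unfolding rapprox_def by presburger
  then show ?thesis by (simp add: mean_def)
qed

text \<open>Right averages commute with left translation, so nodes that work for \<open>f\<close>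
  work for its translate.\<close>

lemma mean_left:
  assumes f: "cont f" and s: "s \<in> carrier G" shows "mean (\<lambda>x. f (s \<otimes> x)) = mean f"
proof (rule mean_eqI)
  show "cont (\<lambda>x. f (s \<otimes> x))" using s by (intro cont_compose[OF f] cont_intros) 
  show "rapprox (\<lambda>x. f (s \<otimes> x)) (mean f)"
    unfolding rapprox_def
  proof (intro allI impI)
    fix e :: real assume "e > 0"
    then obtain xs where xs: "nodes xs" "\<forall>x\<in>carrier G. \<bar>ravg xs f x - mean f\<bar> \<le> e"
      using mean_approx(1)[OF f] unfolding rapprox_def by blast
    have "ravg xs (\<lambda>x. f (s \<otimes> x)) x = ravg xs f (s \<otimes> x)" if "x \<in> carrier G" for x
    proof -
      have "(\<Sum>t\<leftarrow>xs. f (s \<otimes> (x \<otimes> t))) = (\<Sum>t\<leftarrow>xs. f (s \<otimes> x \<otimes> t))"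
        using that s xs(1) by (intro arg_cong[of _ _ sum_list] map_cong refl arg_cong[of _ _ f] m_assoc[symmetric]) (auto simp: nodes_def)
      then show ?thesis by (simp add: ravg_def)
    qed
    then have *: "\<forall>x\<in>carrier G. \<bar>ravg xs (\<lambda>x. f (s \<otimes> x)) x - mean f\<bar> \<le> e" using xs(2) s by simp
    show "\<exists>xs. nodes xs \<and> (\<forall>x\<in>carrier G. \<bar>ravg xs (\<lambda>x. f (s \<otimes> x)) x - mean f\<bar> \<le> e)"
      by (intro exI[of _ xs] conjI xs(1) *)
  qed
qed

text \<open>A right approximation of \<open>f\<close> becomes a left approximation of
  \<open>f (inv x)\<close> once its nodes are inverted, and both sides compute the same constant.
  Right invariance then follows from left invariance.\<close>

lemma mean_inv:
  assumes f: "cont f" shows "mean (\<lambda>x. f (inv x)) = mean f"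
proof (rule mean_eqI_left)
  show g: "cont (\<lambda>x. f (inv x))" by (intro cont_compose[OF f] cont_intros)
  have eq: "mean (\<lambda>x. f (inv (inv x))) = mean f" by (rule mean_cong) simp
  have "rapprox (\<lambda>y. f (inv (inv y))) (mean (\<lambda>x. f (inv (inv x))))"
    by (intro mean_approx(1) cont_compose[OF f] cont_intros)
  then have "lapprox (\<lambda>x. f (inv x)) (mean (\<lambda>x. f (inv (inv x))))"
    by (rule lapprox_inv[where f = "\<lambda>x. f (inv x)"])
  then show "lapprox (\<lambda>x. f (inv x)) (mean f)" unfolding eq .
qed

lemma mean_right:
  assumes f: "cont f" and s: "s \<in> carrier G" shows "mean (\<lambda>x. f (x \<otimes> s)) = mean f"
proof -
  have g: "cont (\<lambda>x. f (inv x))" by (intro cont_compose[OF f] cont_intros)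
  have h: "cont (\<lambda>x. f (x \<otimes> s))" using s by (intro cont_compose[OF f] cont_intros)
  have "mean (\<lambda>x. f (x \<otimes> s)) = mean (\<lambda>x. f (inv x \<otimes> s))" using mean_inv[OF h] by simp
  also have "\<dots> = mean (\<lambda>x. f (inv (inv s \<otimes> x)))" using s by (intro mean_cong) (simp add: inv_mult_group)
  also have "\<dots> = mean (\<lambda>x. f (inv x))" using mean_left[OF g, of "inv s"] s by simp
  finally show ?thesis using mean_inv[OF f] by simp
qed

text \<open>Nodes are refined one function at a time. A further average does not spoil what is
  already nearly constant, and averaging the new function with the old nodes does not change its
  mean.\<close>

lemma common_nodes:
  assumes "finite F" "\<And>f. f \<in> F \<Longrightarrow> cont f" "e > 0"
  shows "\<exists>xs. nodes xs \<and> (\<forall>f\<in>F. \<forall>x\<in>carrier G. \<bar>ravg xs f x - mean f\<bar> \<le> e)"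
  using assms(1,2)
proof (induction F rule: finite_induct)
  case empty
  then show ?case by (auto simp: nodes_def intro: exI[of _ "[\<one>]"])
next
  case (insert f F)
  then obtain xs where xs: "nodes xs" "\<forall>f\<in>F. \<forall>x\<in>carrier G. \<bar>ravg xs f x - mean f\<bar> \<le> e" by auto
  have f: "cont f" using insert by simp
  have rf: "cont (ravg xs f)" by (rule cont_ravg[OF f xs(1)])
  have "rapprox f (mean (ravg xs f))"
    unfolding rapprox_def
  proof (intro allI impI)
    fix e :: real assume "e > 0"
    then obtain ys where "nodes ys" "\<forall>x\<in>carrier G. \<bar>ravg ys (ravg xs f) x - mean (ravg xs f)\<bar> \<le> e"
      using mean_approx(1)[OF rf] unfolding rapprox_def by blast
    then show "\<exists>xsa. nodes xsa \<and> (\<forall>x\<in>carrier G. \<bar>ravg xsa f x - mean (ravg xs f)\<bar> \<le> e)"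
      using xs(1) by (intro exI[of _ "list_prod ys xs"]) (simp add: ravg_list_prod nodes_list_prod)
  qed
  then have eq: "mean (ravg xs f) = mean f" using mean_eqI[OF f] by simp
  obtain ys where ys: "nodes ys" "\<forall>x\<in>carrier G. \<bar>ravg ys (ravg xs f) x - mean f\<bar> \<le> e"
    using mean_approx(1)[OF rf] \<open>e > 0\<close> unfolding eq rapprox_def by blast
  have "\<bar>ravg ys (ravg xs h) x - mean h\<bar> \<le> e" if "h \<in> insert f F" "x \<in> carrier G" for h x
    using that ys xs(2) by (cases "h = f") (auto intro: ravg_near)
  then show ?case using ys(1) xs(1)
    by (intro exI[of _ "list_prod ys xs"]) (simp add: ravg_list_prod nodes_list_prod del: insert_iff)
qed

lemma mean_near:
  assumes f: "cont f" and "\<And>x. x \<in> carrier G \<Longrightarrow> \<bar>f x - c\<bar> \<le> e"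
  shows "\<bar>mean f - c\<bar> \<le> e"
proof (rule field_le_epsilon)
  fix d :: real assume "d > 0"
  then obtain xs where xs: "nodes xs" "\<forall>x\<in>carrier G. \<bar>ravg xs f x - mean f\<bar> \<le> d"
    using mean_approx(1)[OF f] unfolding rapprox_def by blast
  have "\<bar>ravg xs f \<one> - c\<bar> \<le> e" using assms xs by (intro ravg_near) auto
  then show "\<bar>mean f - c\<bar> \<le> e + d" using xs(2)[rule_format, of \<one>] by simp
qed

lemma mean_const [simp]: "mean (\<lambda>_. c) = c"
  using mean_near[of "\<lambda>_. c" c 0] by simp

lemma mean_add:
  assumes f: "cont f" and g: "cont g" shows "mean (\<lambda>x. f x + g x) = mean f + mean g"
proof (rule mean_eqI)
  show "cont (\<lambda>x. f x + g x)" by (intro continuous_map_add f g)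
  show "rapprox (\<lambda>x. f x + g x) (mean f + mean g)"
    unfolding rapprox_def
  proof (intro allI impI)
    fix e :: real assume "e > 0"
    then obtain xs where xs: "nodes xs" "\<forall>h\<in>{f, g}. \<forall>x\<in>carrier G. \<bar>ravg xs h x - mean h\<bar> \<le> e/2"
      using common_nodes[of "{f, g}" "e/2"] f g by auto
    have "ravg xs (\<lambda>x. f x + g x) x = ravg xs f x + ravg xs g x" for x
      by (simp add: ravg_def sum_list_addf add_divide_distrib)
    then have "\<bar>ravg xs (\<lambda>x. f x + g x) x - (mean f + mean g)\<bar> \<le> e" if "x \<in> carrier G" for x
      using xs(2) that by (simp add: abs_le_iff) (smt (verit) field_sum_of_halves)
    then show "\<exists>xs. nodes xs \<and> (\<forall>x\<in>carrier G. \<bar>ravg xs (\<lambda>x. f x + g x) x - (mean f + mean g)\<bar> \<le> e)"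
      using xs(1) by blast
  qed
qed

lemma mean_scale:
  assumes f: "cont f" shows "mean (\<lambda>x. c * f x) = c * mean f"
proof (rule mean_eqI)
  show "cont (\<lambda>x. c * f x)" by (intro continuous_map_real_mult_left f)
  show "rapprox (\<lambda>x. c * f x) (c * mean f)"
    unfolding rapprox_def
  proof (intro allI impI)
    fix e :: real assume e: "e > 0"
    then have "e / (\<bar>c\<bar> + 1) > 0" by (simp add: add_nonneg_pos)
    then obtain xs where xs: "nodes xs" "\<forall>x\<in>carrier G. \<bar>ravg xs f x - mean f\<bar> \<le> e / (\<bar>c\<bar> + 1)"
      using mean_approx(1)[OF f] unfolding rapprox_def by blast
    have "\<bar>ravg xs (\<lambda>x. c * f x) x - c * mean f\<bar> \<le> e" if "x \<in> carrier G" for x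
    proof -
      have "ravg xs (\<lambda>x. c * f x) x = c * ravg xs f x" by (simp add: ravg_def sum_list_const_mult)
      then have "\<bar>ravg xs (\<lambda>x. c * f x) x - c * mean f\<bar> = \<bar>c\<bar> * \<bar>ravg xs f x - mean f\<bar>"
        by (simp flip: abs_mult right_diff_distrib)
      also have "\<dots> \<le> \<bar>c\<bar> * (e / (\<bar>c\<bar> + 1))" using xs(2) that by (intro mult_left_mono) auto
      also have "\<dots> \<le> e" using e by (simp add: field_simps)
      finally show ?thesis .
    qed
    then show "\<exists>xs. nodes xs \<and> (\<forall>x\<in>carrier G. \<bar>ravg xs (\<lambda>x. c * f x) x - c * mean f\<bar> \<le> e)"
      using xs(1) by blast
  qed
qed

lemma mean_diff:
  assumes "cont f" "cont g" shows "mean (\<lambda>x. f x - g x) = mean f - mean g"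
  using mean_add[OF assms(1) continuous_map_real_mult_left[OF assms(2), of "-1"]] mean_scale[OF assms(2), of "-1"]
  by simp

lemma mean_sum:
  assumes "\<And>i. i \<in> I \<Longrightarrow> cont (f i)" shows "mean (\<lambda>x. \<Sum>i\<in>I. f i x) = (\<Sum>i\<in>I. mean (f i))"
  using assms
proof (induction I rule: infinite_finite_induct)
  case (insert i I)
  then have "mean (\<lambda>x. f i x + (\<Sum>i\<in>I. f i x)) = mean (f i) + mean (\<lambda>x. \<Sum>i\<in>I. f i x)"
    by (intro mean_add continuous_map_sum) auto
  with insert show ?case by simp
qed simp_all

text \<open>Values between 0 and \<open>B\<close> lie within \<open>B/2\<close> of
  \<open>B/2\<close>, and so does the mean.\<close>

lemma mean_nonneg:
  assumes f: "cont f" and "\<And>x. x \<in> carrier G \<Longrightarrow> f x \<ge> 0" shows "mean f \<ge> 0"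
proof -
  obtain B where B: "B > 0" "\<And>x. x \<in> carrier G \<Longrightarrow> \<bar>f x\<bar> \<le> B"
    using compact_space_bounded[OF compact f] topspace_eq by auto
  have "\<bar>mean f - B/2\<bar> \<le> B/2"
  proof (rule mean_near[OF f])
    fix x assume "x \<in> carrier G"
    then show "\<bar>f x - B/2\<bar> \<le> B/2" using B(2)[of x] assms(2)[of x] by (auto simp: abs_le_iff field_simps)
  qed
  then show ?thesis by linarith
qed

lemma mean_mono:
  assumes "cont f" "cont g" "\<And>x. x \<in> carrier G \<Longrightarrow> f x \<le> g x" shows "mean f \<le> mean g"
  using mean_nonneg[of "\<lambda>x. g x - f x"] mean_diff[of g f] assms continuous_map_diff[of T g f] by simp

text \<open>Finitely many right translates of \<open>f\<close> add up to at least
  \<open>f x0 / 2\<close> everywhere: for \<open>x\<close> near the net point \<open>d\<close>, the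
  translate by \<open>inv d \<otimes> x0\<close> sees nearly the value at \<open>x0\<close>. All
  translates have the same mean.\<close>

lemma mean_pos:
  assumes f: "cont f" and nn: "\<And>x. x \<in> carrier G \<Longrightarrow> f x \<ge> 0" and x0: "x0 \<in> carrier G" "f x0 > 0"
  shows "mean f > 0"
proof -
  obtain D where D: "finite D" "D \<subseteq> carrier G"
      "\<And>x. x \<in> carrier G \<Longrightarrow> \<exists>d\<in>D. \<forall>y\<in>carrier G. \<bar>f (x \<otimes> y) - f (d \<otimes> y)\<bar> < f x0 / 2"
    using compact_uniform_net[OF cont2_mult[OF f] compact compact, of "f x0 / 2"] x0 topspace_eq by auto
  have c: "cont (\<lambda>x. f (x \<otimes> (inv d \<otimes> x0)))" if "d \<in> D" for d
    using that D(2) x0 by (intro cont_compose[OF f] cont_intros) auto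
  have "f x0 / 2 \<le> (\<Sum>d\<in>D. f (x \<otimes> (inv d \<otimes> x0)))" if x: "x \<in> carrier G" for x
  proof -
    obtain d where d: "d \<in> D" "\<forall>y\<in>carrier G. \<bar>f (x \<otimes> y) - f (d \<otimes> y)\<bar> < f x0 / 2" using D(3)[OF x] by blast
    have dG: "d \<in> carrier G" using d D by auto
    have "\<bar>f (x \<otimes> (inv d \<otimes> x0)) - f (d \<otimes> (inv d \<otimes> x0))\<bar> < f x0 / 2" using d(2) dG x0 by simp
    moreover have "d \<otimes> (inv d \<otimes> x0) = x0" using dG x0 by (simp flip: m_assoc)
    ultimately have "f x0 / 2 \<le> f (x \<otimes> (inv d \<otimes> x0))" by (auto simp: abs_if split: if_splits)
    also have "\<dots> \<le> (\<Sum>d\<in>D. f (x \<otimes> (inv d \<otimes> x0)))"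
      using D x x0 d by (intro member_le_sum nn) auto
    finally show ?thesis .
  qed
  then have "mean (\<lambda>_. f x0 / 2) \<le> mean (\<lambda>x. \<Sum>d\<in>D. f (x \<otimes> (inv d \<otimes> x0)))"
    by (intro mean_mono continuous_map_sum c D) auto
  also have "\<dots> = (\<Sum>d\<in>D. mean (\<lambda>x. f (x \<otimes> (inv d \<otimes> x0))))" by (intro mean_sum c)
  also have "\<dots> = card D * mean f"
    using D x0 by (subst sum.cong[OF refl mean_right[OF f]]) auto
  finally have "card D * mean f > 0" using x0 by simp
  then show ?thesis by (simp add: zero_less_mult_iff)
qed

section \<open>Means depending on a parameter\<close>

lemma cont_mean:
  assumes F: "continuous_map (prod_topology X T) euclidean (\<lambda>(x, y). F x y :: real)"
  shows "continuous_map X euclidean (\<lambda>x. mean (F x))"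
proof (rule continuous_map_realI)
  fix x and e :: real assume x: "x \<in> topspace X" and e: "e > 0"
  show "\<exists>U. openin X U \<and> x \<in> U \<and> (\<forall>y\<in>U. \<bar>mean (F y) - mean (F x)\<bar> < e)"
  proof -
    obtain U where U: "openin X U" "x \<in> U"
      "\<And>y z. y \<in> U \<Longrightarrow> z \<in> topspace T \<Longrightarrow> \<bar>F y z - F x z\<bar> < e/2"
      using compact_uniform_neighbourhood[OF F compact x, of "e/2"] e by auto
    have "\<bar>mean (F y) - mean (F x)\<bar> < e" if y: "y \<in> U" for y
    proof -
      have yX: "y \<in> topspace X" using U(1) y openin_subset by blast
      note c = continuous_map_slice(1)[OF F yX] continuous_map_slice(1)[OF F x]
      have "\<bar>mean (\<lambda>z. F y z - F x z) - 0\<bar> \<le> e/2"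
        using U(3)[OF y] topspace_eq by (intro mean_near continuous_map_diff c) (simp add: less_imp_le)
      then have "\<bar>mean (F y) - mean (F x)\<bar> \<le> e/2" using mean_diff[OF c] by simp
      then show ?thesis using e by linarith
    qed
    then show ?thesis using U by blast
  qed
qed

text \<open>Up to \<open>e/3\<close> only finitely many slices occur, so one list of nodes
  approximates the inner means for all \<open>y\<close> simultaneously. A finite average may be
  exchanged with a mean by additivity.\<close>

lemma mean_swap:
  assumes F: "cont2 F"
  shows "mean (\<lambda>x. mean (\<lambda>y. F x y)) = mean (\<lambda>y. mean (\<lambda>x. F x y))"
proof (rule mean_eqI)
  let ?h = "\<lambda>y. mean (\<lambda>x. F x y)"
  note F' = continuous_map_swap[OF F]
  show "cont (\<lambda>x. mean (\<lambda>y. F x y))" by (rule cont_mean[OF F])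
  have h: "cont ?h" by (rule cont_mean[OF F'])
  have c1: "cont (\<lambda>y. F x y)" if "x \<in> carrier G" for x using continuous_map_slice(1)[OF F] that topspace_eq by simp
  have c2: "cont (\<lambda>x. F x y)" if "y \<in> carrier G" for y using continuous_map_slice(2)[OF F] that topspace_eq by simp
  show "rapprox (\<lambda>x. mean (\<lambda>y. F x y)) (mean ?h)"
    unfolding rapprox_def
  proof (intro allI impI)
    fix e :: real assume e: "e > 0"
    obtain D where D: "finite D" "D \<subseteq> carrier G"
        "\<And>y. y \<in> carrier G \<Longrightarrow> \<exists>d\<in>D. \<forall>x\<in>carrier G. \<bar>F x y - F x d\<bar> < e/3"
      using compact_uniform_net[OF F' compact compact, of "e/3"] e topspace_eq by auto
    have "\<And>f. f \<in> (\<lambda>d x. F x d) ` D \<Longrightarrow> cont f" using D(2) c2 by blast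
    from common_nodes[where F = "(\<lambda>d x. F x d) ` D", OF finite_imageI[OF D(1)] this, where e = "e/3"] e obtain xs where xs: "nodes xs" 
        "\<forall>f\<in>(\<lambda>d x. F x d) ` D. \<forall>x\<in>carrier G. \<bar>ravg xs f x - mean f\<bar> \<le> e/3"
      by auto
    have near: "\<bar>ravg xs (\<lambda>x. F x y) x - ?h y\<bar> \<le> e" if y: "y \<in> carrier G" and x: "x \<in> carrier G" for x y
    proof -
      obtain d where d: "d \<in> D" "\<forall>x\<in>carrier G. \<bar>F x y - F x d\<bar> < e/3" using D(3)[OF y] by blast
      have dG: "d \<in> carrier G" using d D by auto
      have "\<bar>mean (\<lambda>x. F x y - F x d) - 0\<bar> \<le> e/3"
        using d(2) by (intro mean_near continuous_map_diff c2 y dG) (simp add: less_imp_le)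
      then have "\<bar>?h y - ?h d\<bar> \<le> e/3" using mean_diff[OF c2[OF y] c2[OF dG]] by simp
      moreover have "\<bar>ravg xs (\<lambda>x. F x y) x - ravg xs (\<lambda>x. F x d) x\<bar> \<le> e/3"
        unfolding ravg_def using xs(1) d(2) x by (intro average_diff_le) (auto simp: nodes_def less_imp_le)
      moreover have "\<bar>ravg xs (\<lambda>x. F x d) x - ?h d\<bar> \<le> e/3" using xs(2) d(1) x by auto
      ultimately show ?thesis by linarith
    qed
    have "\<bar>ravg xs (\<lambda>x. mean (\<lambda>y. F x y)) x - mean ?h\<bar> \<le> e" if x: "x \<in> carrier G" for x
    proof -
      have sum: "set ys \<subseteq> carrier G \<Longrightarrow> cont (\<lambda>y. \<Sum>s\<leftarrow>ys. F (x \<otimes> s) y) \<and>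
           mean (\<lambda>y. \<Sum>s\<leftarrow>ys. F (x \<otimes> s) y) = (\<Sum>s\<leftarrow>ys. mean (F (x \<otimes> s)))" for ys
      proof (induction ys)
        case (Cons s ys)
        then have "cont (F (x \<otimes> s))" using x by (intro c1) auto
        with Cons show ?case
          using mean_add[of "F (x \<otimes> s)" "\<lambda>y. \<Sum>s\<leftarrow>ys. F (x \<otimes> s) y"] by (auto intro: continuous_map_add)
      qed auto
      from sum[of xs] have c: "cont (\<lambda>y. \<Sum>s\<leftarrow>xs. F (x \<otimes> s) y)" and 
        m: "mean (\<lambda>y. \<Sum>s\<leftarrow>xs. F (x \<otimes> s) y) = (\<Sum>s\<leftarrow>xs. mean (F (x \<otimes> s)))"
        using xs(1) by (auto simp: nodes_def)
      have c': "cont (\<lambda>y. ravg xs (\<lambda>x. F x y) x)"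
        using continuous_map_real_mult_left[OF c, of "1 / length xs"] by (simp add: ravg_def)
      have "ravg xs (\<lambda>x. mean (\<lambda>y. F x y)) x = mean (\<lambda>y. ravg xs (\<lambda>x. F x y) x)"
        using mean_scale[OF c, of "1 / length xs"] m by (simp add: ravg_def)
      moreover have "\<bar>mean (\<lambda>y. ravg xs (\<lambda>x. F x y) x - ?h y) - 0\<bar> \<le> e"
        using near x by (intro mean_near continuous_map_diff c' h) auto
      ultimately show ?thesis using mean_diff[OF c' h] by simp
    qed
    then show "\<exists>xs. nodes xs \<and> (\<forall>x\<in>carrier G. \<bar>ravg xs (\<lambda>x. mean (F x)) x - mean ?h\<bar> \<le> e)"
      using xs(1) by blast
  qed
qed

end

section \<open>Convolution operators\<close>

lemma index_mat_adjoint: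
  "mat_adjoint A = mat (dim_col A) (dim_row A) (\<lambda>(i, j). conjugate (A $$ (j, i)))"
  by (rule eq_matI) (auto simp: mat_adjoint_def mat_of_rows_def)

context compact_group
begin

section \<open>The real inner product and left translations\<close>

definition translate :: "'a \<Rightarrow> ('a \<Rightarrow> real) \<Rightarrow> 'a \<Rightarrow> real" where
  "translate s f x = f (inv s \<otimes> x)"

definition ip :: "('a \<Rightarrow> real) \<Rightarrow> ('a \<Rightarrow> real) \<Rightarrow> real" where
  "ip f g = mean (\<lambda>x. f x * g x)"

lemma cont_translate [simp]: "cont f \<Longrightarrow> s \<in> carrier G \<Longrightarrow> cont (translate s f)"
  unfolding translate_def[abs_def] by (rule cont_compose) (auto intro!: cont_intros)

lemma translate_translate:
  "s \<in> carrier G \<Longrightarrow> t \<in> carrier G \<Longrightarrow> x \<in> carrier G \<Longrightarrow>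
    translate s (translate t f) x = translate (s \<otimes> t) f x"
  by (simp add: translate_def inv_mult_group m_assoc)

lemma translate_one [simp]: "x \<in> carrier G \<Longrightarrow> translate \<one> f x = f x"
  by (simp add: translate_def)

lemma ip_cong:
  "(\<And>x. x \<in> carrier G \<Longrightarrow> f x = f' x) \<Longrightarrow> (\<And>x. x \<in> carrier G \<Longrightarrow> g x = g' x) \<Longrightarrow> ip f g = ip f' g'"
  unfolding ip_def by (rule mean_cong) simp

lemma ip_commute: "ip f g = ip g f"
  by (simp add: ip_def mult.commute)

lemma ip_translate:
  assumes "cont f" "cont g" "s \<in> carrier G"
  shows "ip (translate s f) (translate s g) = ip f g"
  unfolding ip_def translate_def
  by (rule mean_left[where f = "\<lambda>x. f x * g x"]) (use assms in \<open>auto intro: continuous_map_real_mult\<close>)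

lemma ip_translate_left:
  assumes "cont f" "cont g" "s \<in> carrier G"
  shows "ip (translate s f) g = ip f (translate (inv s) g)"
proof -
  have "ip (translate s f) g = ip (translate s f) (translate s (translate (inv s) g))"
    using assms by (intro ip_cong) (simp_all add: translate_translate)
  also have "\<dots> = ip f (translate (inv s) g)" using assms by (intro ip_translate) simp_all
  finally show ?thesis .
qed

lemma ip_add_left: "cont f \<Longrightarrow> cont g \<Longrightarrow> cont h \<Longrightarrow> ip (\<lambda>x. f x + g x) h = ip f h + ip g h"
  using mean_add[of "\<lambda>x. f x * h x" "\<lambda>x. g x * h x"]
  by (simp add: ip_def ring_distribs continuous_map_real_mult)

lemma ip_diff_left: "cont f \<Longrightarrow> cont g \<Longrightarrow> cont h \<Longrightarrow> ip (\<lambda>x. f x - g x) h = ip f h - ip g h"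
  using mean_diff[of "\<lambda>x. f x * h x" "\<lambda>x. g x * h x"]
  by (simp add: ip_def ring_distribs continuous_map_real_mult)

lemma ip_scale_left: "cont f \<Longrightarrow> cont h \<Longrightarrow> ip (\<lambda>x. c * f x) h = c * ip f h"
  using mean_scale[of "\<lambda>x. f x * h x" c] by (simp add: ip_def mult.assoc continuous_map_real_mult)

lemma ip_sum_left:
  assumes "\<And>i. i \<in> I \<Longrightarrow> cont (f i)" "cont h"
  shows "ip (\<lambda>x. \<Sum>i\<in>I. f i x) h = (\<Sum>i\<in>I. ip (f i) h)"
  unfolding ip_def sum_distrib_right
  by (rule mean_sum) (use assms in \<open>auto intro: continuous_map_real_mult\<close>)

lemma ip_diff_right: "cont f \<Longrightarrow> cont g \<Longrightarrow> cont h \<Longrightarrow> ip h (\<lambda>x. f x - g x) = ip h f - ip h g"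
  using ip_diff_left[of f g h] by (simp add: ip_commute)

lemma ip_scale_right: "cont f \<Longrightarrow> cont h \<Longrightarrow> ip h (\<lambda>x. c * f x) = c * ip h f"
  using ip_scale_left[of f h c] by (simp add: ip_commute)

lemma ip_nonneg: "cont f \<Longrightarrow> ip f f \<ge> 0"
  unfolding ip_def by (rule mean_nonneg) (auto intro: continuous_map_real_mult)

lemma ip_pos: "cont f \<Longrightarrow> x \<in> carrier G \<Longrightarrow> f x \<noteq> 0 \<Longrightarrow> ip f f > 0"
  unfolding ip_def by (rule mean_pos[of _ x]) (auto intro: continuous_map_real_mult simp: zero_less_mult_iff)

text \<open>The form is definite on continuous functions, so in the degenerate case \<open>g\<close>
  vanishes on the group. Otherwise the residual of \<open>f\<close> after projection to
  \<open>g\<close> has a nonnegative square.\<close>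

lemma Cauchy_Schwarz_ip:
  assumes f: "cont f" and g: "cont g" shows "(ip f g)\<^sup>2 \<le> ip f f * ip g g"
proof (cases "ip g g = 0")
  case True
  then have "g x = 0" if "x \<in> carrier G" for x using ip_pos[OF g that] by force
  then have "ip f g = ip (\<lambda>x. 0 * f x) f" using ip_commute by (metis ip_cong mult_zero_left)
  also have "\<dots> = 0" using ip_scale_left[OF f f, of 0] by simp
  finally show ?thesis using True by simp
next
  case False
  then have pos: "ip g g > 0" using ip_nonneg[OF g] by simp
  define t where "t = ip f g / ip g g"
  have tg: "cont (\<lambda>x. t * g x)" by (rule continuous_map_real_mult_left[OF g])
  have d: "cont (\<lambda>x. f x - t * g x)" by (intro continuous_map_diff f tg)
  have "0 \<le> ip (\<lambda>x. f x - t * g x) (\<lambda>x. f x - t * g x)" by (rule ip_nonneg[OF d])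
  also have "\<dots> = ip f f - t * ip f g - t * (ip f g - t * ip g g)"
    using f g tg d
    by (simp add: ip_diff_left ip_diff_right ip_scale_left ip_scale_right ip_commute[of g f] right_diff_distrib)
  also have "\<dots> = ip f f - (ip f g)\<^sup>2 / ip g g"
    using pos by (simp add: t_def power2_eq_square)
  finally show ?thesis using pos by (simp add: field_simps)
qed

text \<open>This is the integral operator with kernel \<open>k (inv x \<otimes> y)\<close>, that is,
  convolution on the right by the reflection of \<open>k\<close>. Since the kernel depends only on
  \<open>inv x \<otimes> y\<close>, the operator commutes with left translations.\<close>

definition conv_op :: "('a \<Rightarrow> real) \<Rightarrow> ('a \<Rightarrow> real) \<Rightarrow> 'a \<Rightarrow> real" where
  "conv_op k f x = ip f (translate x k)"

lemma cont2_translate: "cont k \<Longrightarrow> cont2 (\<lambda>x y. translate x k y)"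
  unfolding case_prod_unfold translate_def by (rule cont_compose) (auto intro!: cont_intros)

lemma cont2_fst: "cont f \<Longrightarrow> cont2 (\<lambda>x y. f x)"
  unfolding case_prod_unfold by (rule cont_compose) (auto intro!: cont_intros)

lemma cont2_snd: "cont f \<Longrightarrow> cont2 (\<lambda>x y. f y)"
  unfolding case_prod_unfold by (rule cont_compose) (auto intro!: cont_intros)

lemma cont2_prod: "cont2 F \<Longrightarrow> cont2 H \<Longrightarrow> cont2 (\<lambda>x y. F x y * H x y)"
  unfolding case_prod_unfold by (rule continuous_map_real_mult)

lemma cont_conv_op [simp]: "cont k \<Longrightarrow> cont f \<Longrightarrow> cont (conv_op k f)"
  unfolding conv_op_def[abs_def] ip_def
  by (rule cont_mean) (intro cont2_prod cont2_snd cont2_translate)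

lemma conv_op_translate:
  assumes "cont k" "cont f" "s \<in> carrier G" "x \<in> carrier G"
  shows "conv_op k (translate s f) x = translate s (conv_op k f) x"
proof -
  have "conv_op k (translate s f) x = ip f (translate (inv s) (translate x k))"
    unfolding conv_op_def using assms by (intro ip_translate_left) auto
  also have "\<dots> = ip f (translate (inv s \<otimes> x) k)"
    using assms by (intro ip_cong) (simp_all add: translate_translate)
  finally show ?thesis by (simp add: translate_def[of s] conv_op_def)
qed

lemma conv_op_cong: "(\<And>x. x \<in> carrier G \<Longrightarrow> f x = g x) \<Longrightarrow> conv_op k f x = conv_op k g x"
  unfolding conv_op_def by (rule ip_cong) auto

text \<open>Interchanging the means transposes the kernel \<open>k (inv x \<otimes> y)\<close>, and
  \<open>sym\<close> makes that kernel symmetric.\<close>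

lemma conv_op_selfadjoint:
  assumes k: "cont k" and sym: "\<And>x. x \<in> carrier G \<Longrightarrow> k (inv x) = k x"
    and f: "cont f" and g: "cont g"
  shows "ip (conv_op k f) g = ip f (conv_op k g)"
proof -
  have c: "cont2 (\<lambda>x y. f y * translate x k y * g x)"
    by (intro cont2_prod cont2_fst cont2_snd cont2_translate f g k)
  have "ip (conv_op k f) g = mean (\<lambda>x. mean (\<lambda>y. f y * translate x k y * g x))"
    unfolding ip_def conv_op_def
  proof (rule mean_cong)
    fix x assume "x \<in> carrier G"
    then have "cont (\<lambda>y. f y * translate x k y)" using f k by (auto intro: continuous_map_real_mult)
    from mean_scale[OF this, of "g x"]
    show "mean (\<lambda>y. f y * translate x k y) * g x = mean (\<lambda>y. f y * translate x k y * g x)"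
      by (simp add: mult.commute)
  qed
  also have "\<dots> = mean (\<lambda>y. mean (\<lambda>x. f y * translate x k y * g x))"
    using mean_swap[OF c] .
  also have "\<dots> = mean (\<lambda>y. f y * mean (\<lambda>x. g x * translate y k x))"
  proof (rule mean_cong)
    fix y assume y: "y \<in> carrier G"
    then have c: "cont (\<lambda>x. g x * translate y k x)" using g k by (auto intro: continuous_map_real_mult)
    have "mean (\<lambda>x. f y * translate x k y * g x) = mean (\<lambda>x. f y * (g x * translate y k x))"
    proof (rule mean_cong)
      fix x assume "x \<in> carrier G"
      then have "k (inv x \<otimes> y) = k (inv y \<otimes> x)"
        using sym[of "inv y \<otimes> x"] y by (simp add: inv_mult_group)
      then show "f y * translate x k y * g x = f y * (g x * translate y k x)" by (simp add: translate_def)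
    qed
    then show "mean (\<lambda>x. f y * translate x k y * g x) = f y * mean (\<lambda>x. g x * translate y k x)"
      using mean_scale[OF c, of "f y"] by simp
  qed
  finally show ?thesis by (simp add: ip_def conv_op_def)
qed

text \<open>Only one element is involved: \<open>n\<close> is the point at which a representation is
  required to act nontrivially.\<close>

definition left_invariant :: "'a \<Rightarrow> ('a \<Rightarrow> real) \<Rightarrow> bool" where
  "left_invariant n q \<longleftrightarrow> cont q \<and> (\<forall>x\<in>carrier G. translate n q x = q x)"

lemma left_invariant_conv_op:
  assumes "cont k" "left_invariant n q" "n \<in> carrier G"
  shows "left_invariant n (conv_op k q)"
proof -
  have q: "cont q" using assms by (simp add: left_invariant_def)
  have "translate n (conv_op k q) x = conv_op k q x" if "x \<in> carrier G" for x
  proof -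
    have "translate n (conv_op k q) x = conv_op k (translate n q) x"
      using conv_op_translate[OF assms(1) q assms(3) that] by simp
    also have "\<dots> = conv_op k q x" using assms(2) by (intro conv_op_cong) (simp add: left_invariant_def)
    finally show ?thesis .
  qed
  then show ?thesis using assms q by (simp add: left_invariant_def)
qed

end

section \<open>The Peter--Weyl theorem\<close>

text \<open>Off by one: \<open>kp n\<close> is the convolution power of \<open>k\<close> with exponent \<open>n + 1\<close>. The number \<open>\<rho>\<close> is the
  square of the norm of \<open>conv_op k\<close> with respect to \<open>ip\<close>.\<close>

locale positive_kernel = compact_group +
  fixes a :: "'a \<Rightarrow> real"
  assumes a: "cont a" and a_nonzero: "\<exists>x\<in>carrier G. a x \<noteq> 0"
begin

section \<open>Convolution powers of the kernel\<close>

definition k :: "'a \<Rightarrow> real" where "k x = ip a (translate x a)"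

definition kp :: "nat \<Rightarrow> 'a \<Rightarrow> real" where "kp n = (conv_op k ^^ n) k"

lemma cont_k [simp]: "cont k"
  unfolding k_def[abs_def] ip_def by (rule cont_mean) (intro cont2_prod cont2_snd cont2_translate a)

lemma k_inv: "x \<in> carrier G \<Longrightarrow> k (inv x) = k x"
  unfolding k_def using ip_translate_left[OF a a, of x] by (simp add: ip_commute)

lemma cont_iter [simp]: "cont f \<Longrightarrow> cont ((conv_op k ^^ n) f)"
  by (induction n) auto

lemma cont_kp [simp]: "cont (kp n)"
  by (simp add: kp_def)

lemma selfadjoint: "cont f \<Longrightarrow> cont g \<Longrightarrow> ip (conv_op k f) g = ip f (conv_op k g)"
  by (rule conv_op_selfadjoint[OF cont_k k_inv])

lemma selfadjoint_iter: "cont f \<Longrightarrow> cont g \<Longrightarrow> ip ((conv_op k ^^ n) f) g = ip f ((conv_op k ^^ n) g)"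
proof (induction n arbitrary: g)
  case (Suc n)
  have "ip ((conv_op k ^^ Suc n) f) g = ip ((conv_op k ^^ n) f) (conv_op k g)"
    using Suc by (simp add: selfadjoint)
  also have "\<dots> = ip f ((conv_op k ^^ n) (conv_op k g))" using Suc by simp
  finally show ?case by (simp add: funpow_swap1)
qed simp

lemma iter_translate:
  assumes "cont f" "s \<in> carrier G"
  shows "x \<in> carrier G \<Longrightarrow> (conv_op k ^^ n) (translate s f) x = translate s ((conv_op k ^^ n) f) x"
proof (induction n arbitrary: x)
  case (Suc n)
  have "(conv_op k ^^ Suc n) (translate s f) x = conv_op k (translate s ((conv_op k ^^ n) f)) x"
    using Suc by (auto intro: conv_op_cong)
  then show ?case using conv_op_translate[of k "(conv_op k ^^ n) f" s x] assms Suc by simp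
qed simp

text \<open>Self-adjointness moves the inner iterations onto the kernel. A power of the operator is
  thus itself convolution with a power of \<open>k\<close>, and its values are inner products to
  which Cauchy--Schwarz applies pointwise.\<close>

lemma iter_Suc_eq_ip:
  assumes "cont f" "x \<in> carrier G"
  shows "(conv_op k ^^ Suc n) f x = ip f (translate x (kp n))"
proof -
  have "(conv_op k ^^ Suc n) f x = ip ((conv_op k ^^ n) f) (translate x k)" by (simp add: conv_op_def)
  also have "\<dots> = ip f ((conv_op k ^^ n) (translate x k))" using assms by (intro selfadjoint_iter) auto
  also have "\<dots> = ip f (translate x (kp n))"
    unfolding kp_def using assms by (intro ip_cong iter_translate) auto
  finally show ?thesis .
qed

text \<open>The exponents \<open>m + 1\<close> and \<open>n + 1\<close> add up to
  \<open>m + n + 2\<close>, which has index \<open>m + n + 1\<close>. With \<open>m = n\<close>,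
  values at the identity become squared norms.\<close>

lemma ip_kp_translate:
  assumes "x \<in> carrier G" shows "ip (kp m) (translate x (kp n)) = kp (m + n + 1) x"
proof -
  have "m + n + 1 = Suc n + m" by simp
  then have "kp (m + n + 1) = (conv_op k ^^ Suc n) (kp m)"
    unfolding kp_def by (simp only: funpow_add o_apply)
  then show ?thesis using iter_Suc_eq_ip[OF cont_kp assms, of n m] by (simp only:)
qed

lemma ip_kp: "ip (kp m) (kp n) = kp (m + n + 1) \<one>"
proof -
  have "ip (kp m) (kp n) = ip (kp m) (translate \<one> (kp n))" by (intro ip_cong) auto
  then show ?thesis using ip_kp_translate[of \<one> m n] by simp
qed

text \<open>This is the Hilbert--Schmidt bound: the rows of the integral kernel are the translates
  of \<open>kp n\<close>, and all have the norm of \<open>kp n\<close>.\<close>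

lemma iter_norm_le:
  assumes f: "cont f"
  shows "ip ((conv_op k ^^ Suc n) f) ((conv_op k ^^ Suc n) f) \<le> ip f f * ip (kp n) (kp n)"
proof -
  have "mean (\<lambda>x. (conv_op k ^^ Suc n) f x * (conv_op k ^^ Suc n) f x) \<le> mean (\<lambda>x. ip f f * ip (kp n) (kp n))"
  proof (rule mean_mono)
    show "cont (\<lambda>x. (conv_op k ^^ Suc n) f x * (conv_op k ^^ Suc n) f x)"
      using cont_iter[OF f, of "Suc n"] by (intro continuous_map_real_mult)
    fix x assume x: "x \<in> carrier G"
    have "((conv_op k ^^ Suc n) f x)\<^sup>2 \<le> ip f f * ip (translate x (kp n)) (translate x (kp n))"
      unfolding iter_Suc_eq_ip[OF f x] using x by (intro Cauchy_Schwarz_ip f) auto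
    then show "(conv_op k ^^ Suc n) f x * (conv_op k ^^ Suc n) f x \<le> ip f f * ip (kp n) (kp n)"
      using x by (simp add: ip_translate power2_eq_square del: funpow.simps)
  qed simp
  then show ?thesis by (simp add: ip_def)
qed

section \<open>The norm of the convolution operator\<close>

definition \<rho> :: real where
  "\<rho> = Sup {ip (conv_op k f) (conv_op k f) | f. cont f \<and> ip f f \<le> 1}"

lemma bdd_above_rho: "bdd_above {ip (conv_op k f) (conv_op k f) | f. cont f \<and> ip f f \<le> 1}"
proof (rule bdd_aboveI)
  fix y assume "y \<in> {ip (conv_op k f) (conv_op k f) | f. cont f \<and> ip f f \<le> 1}"
  then obtain f where f: "cont f" "ip f f \<le> 1" "y = ip (conv_op k f) (conv_op k f)" by blast
  have "y \<le> ip f f * ip (kp 0) (kp 0)" using iter_norm_le[OF f(1), of 0] f(3) by simp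
  also have "\<dots> \<le> 1 * ip (kp 0) (kp 0)" using f(2) ip_nonneg[OF cont_kp, of 0] by (intro mult_right_mono)
  finally show "y \<le> ip (kp 0) (kp 0)" by simp
qed

text \<open>Homogeneity reduces the claim to the unit ball of the supremum. A function of norm zero
  cannot be normalized; its image vanishes by the Hilbert--Schmidt bound.\<close>

lemma norm_le_rho:
  assumes f: "cont f" shows "ip (conv_op k f) (conv_op k f) \<le> \<rho> * ip f f"
proof (cases "ip f f = 0")
  case True
  then show ?thesis using iter_norm_le[OF f, of 0] by simp
next
  case False
  then have pos: "ip f f > 0" using ip_nonneg[OF f] by simp
  define c where "c = 1 / sqrt (ip f f)"
  have cc: "c * c = 1 / ip f f" using pos by (simp add: c_def)
  have cf: "cont (\<lambda>x. c * f x)" by (rule continuous_map_real_mult_left[OF f])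
  have "ip (\<lambda>x. c * f x) (\<lambda>x. c * f x) = c * c * ip f f"
    using f cf by (simp add: ip_scale_left ip_scale_right)
  then have 1: "ip (\<lambda>x. c * f x) (\<lambda>x. c * f x) \<le> 1" using pos cc by simp
  have "ip (conv_op k (\<lambda>x. c * f x)) (conv_op k (\<lambda>x. c * f x)) = ip (\<lambda>x. c * conv_op k f x) (\<lambda>x. c * conv_op k f x)"
    using f by (intro ip_cong) (simp_all add: conv_op_def ip_scale_left)
  also have "\<dots> = c * c * ip (conv_op k f) (conv_op k f)"
    using f by (simp add: ip_scale_left ip_scale_right continuous_map_real_mult_left)
  finally have "ip (conv_op k f) (conv_op k f) / ip f f
      = ip (conv_op k (\<lambda>x. c * f x)) (conv_op k (\<lambda>x. c * f x))" by (simp add: cc)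
  also have "\<dots> \<le> \<rho>" unfolding \<rho>_def using 1 cf by (intro cSup_upper bdd_above_rho) blast
  finally show ?thesis using pos by (simp add: field_simps)
qed

lemma kp_0_one_pos: "kp 0 \<one> > 0"
proof -
  have "kp 0 \<one> = ip a a" unfolding kp_def k_def using ip_cong[of a a "translate \<one> a" a] by simp
  then show ?thesis using a a_nonzero ip_pos by auto
qed

text \<open>The squared norm of a power is the value of a later power at the identity, so positivity
  spreads from \<open>kp 0\<close> to its image \<open>kp 1\<close>.\<close>

lemma rho_pos: "\<rho> > 0"
proof -
  have k: "ip (kp 0) (kp 0) > 0" using kp_0_one_pos by (intro ip_pos[of _ \<one>]) auto
  then have "kp 1 \<one> > 0" using ip_kp[of 0 0] by simp
  then have "ip (kp 1) (kp 1) > 0" by (intro ip_pos[of _ \<one>]) auto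
  then have "0 < \<rho> * ip (kp 0) (kp 0)" using norm_le_rho[of "kp 0"] by (simp add: kp_def)
  then show ?thesis using k by (simp add: zero_less_mult_iff)
qed

text \<open>The right-hand side is the squared Hilbert--Schmidt norm of the power
  \<open>n + 1\<close> of a self-adjoint operator and dominates its squared operator norm
  \<open>\<rho> ^ Suc n\<close>. No eigenvector is at hand to show this; instead a nearly maximizing
  \<open>f\<close> is iterated. The squared norms \<open>u j\<close> of the iterates are log-convex,
  so the first ratio bounds all later ones from below.\<close>

lemma ip_kp_ge: "\<rho> ^ Suc n \<le> ip (kp n) (kp n)"
proof (rule ccontr)
  assume "\<not> ?thesis"
  then have less: "ip (kp n) (kp n) < \<rho> ^ Suc n" by simp
  define X where "X = ip (kp n) (kp n)"
  have X0: "X \<ge> 0" by (simp add: X_def ip_nonneg)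
  define r0 where "r0 = root (Suc n) X"
  have r0: "r0 \<ge> 0" "r0 ^ Suc n = X" using X0 using real_root_pow_pos2[of "Suc n" X] by (simp_all add: r0_def del: power_Suc)
  have "r0 ^ Suc n < \<rho> ^ Suc n" using less r0(2) by (simp only: X_def)
  then have "r0 < \<rho>" by (rule power_less_imp_less_base) (use rho_pos in simp)
  \<comment> \<open>Below the supremum \<open>\<rho>\<close>, so that some \<open>f\<close> in the
    unit ball exceeds \<open>r\<close>; above the root of \<open>X\<close>, so that the resulting
    \<open>r ^ Suc n \<le> X\<close> is absurd.\<close>
  then obtain r where r: "r0 < r" "r < \<rho>" using dense by blast
  obtain f where f: "cont f" "ip f f \<le> 1" "r < ip (conv_op k f) (conv_op k f)"
  proof -
    have "\<exists>y\<in>{ip (conv_op k f) (conv_op k f) | f. cont f \<and> ip f f \<le> 1}. r < y"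
    proof (rule less_cSupD)
      show "{ip (conv_op k f) (conv_op k f) | f. cont f \<and> ip f f \<le> 1} \<noteq> {}"
      proof -
        have "cont (\<lambda>_. 0)" "ip (\<lambda>_. 0) (\<lambda>_. 0) \<le> 1" by (simp_all add: ip_def)
        then show ?thesis by blast
      qed
    qed (use r(2) in \<open>simp add: \<rho>_def\<close>)
    then show ?thesis using that by blast
  qed
  define u where "u j = ip ((conv_op k ^^ j) f) ((conv_op k ^^ j) f)" for j
  have u0: "u j \<ge> 0" for j unfolding u_def using f by (intro ip_nonneg) auto
  have "u 1 > 0" using f(3) r r0 by (simp add: u_def)
  then have u_pos: "u 0 > 0" using u0[of 0] norm_le_rho[OF f(1)] by (cases "u 0 = 0") (simp_all add: u_def)
  \<comment> \<open>One factor of the operator is moved to the other side before Cauchy--Schwarz is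
    applied.\<close>
  have convex: "(u (Suc j))\<^sup>2 \<le> u j * u (Suc (Suc j))" for j
  proof -
    have "u (Suc j) = ip ((conv_op k ^^ j) f) ((conv_op k ^^ Suc (Suc j)) f)"
      unfolding u_def using f(1) selfadjoint[of "(conv_op k ^^ j) f" "(conv_op k ^^ Suc j) f"] by simp
    with Cauchy_Schwarz_ip[OF cont_iter[OF f(1)] cont_iter[OF f(1)], of j "Suc (Suc j)"] show ?thesis
      by (simp only: u_def)
  qed
  have step: "r * u j \<le> u (Suc j)" for j
  proof (induction j)
    case 0
    have "r * u 0 \<le> r * 1" using f(2) r r0 by (intro mult_left_mono) (auto simp: u_def)
    then show ?case using f(3) by (simp add: u_def)
  next
    case (Suc j)
    show ?case
    proof (cases "u (Suc j) = 0")
      case False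
      then have pos: "u (Suc j) > 0" using u0[of "Suc j"] by simp
      have "r * u (Suc j) * u j \<le> u (Suc j) * u (Suc j)" using Suc pos by (simp add: mult.commute mult.left_commute)
      also have "\<dots> \<le> u (Suc (Suc j)) * u j" using convex[of j] by (simp add: power2_eq_square mult.commute)
      finally show ?thesis using pos u0[of j] convex[of j]
        by (cases "u j = 0") auto
    qed (use u0 in simp)
  qed
  have "r ^ j * u 0 \<le> u j" for j
  proof (induction j)
    case (Suc j)
    have "r ^ Suc j * u 0 \<le> r * u j" using Suc r r0 by (simp add: mult.assoc)
    then show ?case using step[of j] by simp
  qed simp
  from this[of "Suc n"] have "r ^ Suc n * u 0 \<le> X * u 0"
    using iter_norm_le[OF f(1), of n] by (simp add: u_def X_def mult.commute)
  then have "r ^ Suc n \<le> X" using u_pos by simp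
  moreover have "r0 ^ Suc n < r ^ Suc n" using r r0 by (intro power_strict_mono) auto
  ultimately show False using r0 by simp
qed

text \<open>The index \<open>2 * n + 1\<close> stands for the exponent \<open>2 * n + 2\<close>, and
  \<open>\<rho> ^ Suc n\<close> is the operator norm to that same power. Consecutive terms differ by
  the square of the operator, which is at most \<open>\<rho>\<close> as a form; this gives the
  monotonicity.\<close>

definition s :: "nat \<Rightarrow> 'a \<Rightarrow> real" where "s n x = kp (2 * n + 1) x / \<rho> ^ Suc n"

lemma cont_s [simp]: "cont (s n)"
  using continuous_map_real_mult_left[OF cont_kp, of "1 / \<rho> ^ Suc n" "2 * n + 1"]
  by (simp add: s_def[abs_def])

lemma s_one_ge: "s n \<one> \<ge> 1"
  using ip_kp_ge[of n] ip_kp[of n n] rho_pos by (simp add: s_def mult_2 del: power_Suc)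

text \<open>The increment is a value of the positive form
  \<open>\<rho> * ip f g - ip (conv_op k f) (conv_op k g)\<close> at \<open>kp n\<close> and a translate, so it is largest at the identity.\<close>

lemma s_step:
  assumes x: "x \<in> carrier G" shows "\<bar>s n x - s (Suc n) x\<bar> \<le> s n \<one> - s (Suc n) \<one>"
proof -
  define B where "B f g = \<rho> * ip f g - ip (conv_op k f) (conv_op k g)" for f g
  have B_nonneg: "B f f \<ge> 0" if "cont f" for f using norm_le_rho[OF that] by (simp add: B_def)
  have B_add: "B (\<lambda>x. f x + c * g x) (\<lambda>x. f x + c * g x) = B f f + 2 * c * B f g + c * c * B g g"
    if f: "cont f" and g: "cont g" for f g c
  proof -
    have *: "ip (\<lambda>x. f x + c * g x) (\<lambda>x. f x + c * g x) = ip f f + 2 * c * ip f g + c * c * ip g g"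
      if f: "cont f" and g: "cont g" for f g
    proof -
      have cg: "cont (\<lambda>x. c * g x)" by (rule continuous_map_real_mult_left[OF g])
      have "cont (\<lambda>x. f x + c * g x)" by (intro continuous_map_add f cg)
      note F = this
      have l: "ip (\<lambda>x. f x + c * g x) h = ip f h + c * ip g h" if "cont h" for h
        using ip_add_left[OF f cg that] ip_scale_left[OF g that] by simp
      have "ip (\<lambda>x. f x + c * g x) (\<lambda>x. f x + c * g x)
          = ip (\<lambda>x. f x + c * g x) f + c * ip (\<lambda>x. f x + c * g x) g"
        unfolding l[OF F] by (simp only: ip_commute[of _ "\<lambda>x. f x + c * g x"])
      also have "\<dots> = ip f f + c * ip f g + c * (ip f g + c * ip g g)"
        unfolding l[OF f] l[OF g] ip_commute[of g f] ..
      finally show ?thesis by (simp add: algebra_simps)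
    qed
    have "conv_op k (\<lambda>x. f x + c * g x) x = conv_op k f x + c * conv_op k g x" if "x \<in> carrier G" for x
      using f g that by (simp add: conv_op_def ip_add_left ip_scale_left continuous_map_real_mult_left)
    then have "ip (conv_op k (\<lambda>x. f x + c * g x)) (conv_op k (\<lambda>x. f x + c * g x))
      = ip (\<lambda>x. conv_op k f x + c * conv_op k g x) (\<lambda>x. conv_op k f x + c * conv_op k g x)"
      by (intro ip_cong) auto
    also have "\<dots> = ip (conv_op k f) (conv_op k f) + 2 * c * ip (conv_op k f) (conv_op k g)
         + c * c * ip (conv_op k g) (conv_op k g)"
      using f g by (intro *) auto
    finally show ?thesis using *[OF f g] by (simp add: B_def algebra_simps)
  qed
  \<comment> \<open>Positivity at \<open>f + g\<close> and \<open>f - g\<close> yields the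
    arithmetic mean. This is as good as Cauchy--Schwarz here, because \<open>B\<close> is
    translation invariant and takes the same value at \<open>kp n\<close> and at its
    translate.\<close>
  have B_le: "\<bar>B f g\<bar> \<le> (B f f + B g g) / 2" if f: "cont f" and g: "cont g" for f g
    using B_nonneg[of "\<lambda>x. f x + 1 * g x"] B_nonneg[of "\<lambda>x. f x + (-1) * g x"]
      B_add[OF f g, of 1] B_add[OF f g, of "-1"] f g
    by (simp add: continuous_map_add continuous_map_diff)
  have val: "B (kp n) (translate y (kp n)) = \<rho> ^ Suc (Suc n) * (s n y - s (Suc n) y)" if y: "y \<in> carrier G" for y
  proof -
    have kpS: "conv_op k (kp n) = kp (Suc n)" by (simp add: kp_def)
    have "ip (conv_op k (kp n)) (conv_op k (translate y (kp n))) = ip (kp (Suc n)) (translate y (kp (Suc n)))"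
      unfolding kpS[symmetric] using y by (intro ip_cong conv_op_translate) auto
    also have "\<dots> = kp (2 * Suc n + 1) y" using ip_kp_translate[OF y, of "Suc n" "Suc n"] by (simp add: mult_2)
    finally have "B (kp n) (translate y (kp n)) = \<rho> * kp (2 * n + 1) y - kp (2 * Suc n + 1) y"
      using ip_kp_translate[OF y, of n n] by (simp add: B_def mult_2)
    moreover have "\<rho> ^ Suc (Suc n) * s n y = \<rho> * kp (2 * n + 1) y"
      "\<rho> ^ Suc (Suc n) * s (Suc n) y = kp (2 * Suc n + 1) y"
      using rho_pos by (simp_all add: s_def)
    ultimately show ?thesis unfolding right_diff_distrib by (simp only:)
  qed
  have one: "B (kp n) (kp n) = \<rho> ^ Suc (Suc n) * (s n \<one> - s (Suc n) \<one>)"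
  proof -
    have "B (kp n) (kp n) = B (kp n) (translate \<one> (kp n))"
      unfolding B_def by (intro arg_cong2[of _ _ _ _ "\<lambda>u v. \<rho> * u - v"] ip_cong conv_op_cong) auto
    then show ?thesis using val[of \<one>] by simp
  qed
  have "B (translate x (kp n)) (translate x (kp n)) = B (kp n) (kp n)"
  proof -
    have "ip (conv_op k (translate x (kp n))) (conv_op k (translate x (kp n)))
       = ip (translate x (conv_op k (kp n))) (translate x (conv_op k (kp n)))"
      using x by (intro ip_cong conv_op_translate) auto
    then show ?thesis using x by (simp add: B_def ip_translate)
  qed
  with B_le[of "kp n" "translate x (kp n)"] x val[OF x] one
  have "\<rho> ^ Suc (Suc n) * \<bar>s n x - s (Suc n) x\<bar> \<le> \<rho> ^ Suc (Suc n) * (s n \<one> - s (Suc n) \<one>)"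
    using rho_pos by (simp add: abs_mult del: power_Suc)
  then show ?thesis using rho_pos by (simp del: power_Suc)
qed

lemma s_diff:
  assumes x: "x \<in> carrier G" and "n \<le> m" shows "\<bar>s n x - s m x\<bar> \<le> s n \<one> - s m \<one>"
  using \<open>n \<le> m\<close>
proof (induction m rule: dec_induct)
  case (step m)
  then show ?case using s_step[OF x, of m] by linarith
qed simp

section \<open>The limit idempotent\<close>

definition p :: "'a \<Rightarrow> real" where "p x = lim (\<lambda>n. s n x)"

lemma s_one_convergent: "convergent (\<lambda>n. s n \<one>)"
proof -
  have "decseq (\<lambda>n. s n \<one>)"
    unfolding decseq_Suc_iff using s_step[OF one_closed] by (metis abs_ge_zero diff_ge_0_iff_ge order_trans)
  then show ?thesis using s_one_ge decseq_convergent by (metis convergent_def)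
qed

lemma s_limit: assumes x: "x \<in> carrier G" shows "(\<lambda>n. s n x) \<longlonglongrightarrow> p x"
proof -
  have "Cauchy (\<lambda>n. s n x)"
  proof (rule metric_CauchyI)
    fix e :: real assume "e > 0"
    moreover have "Cauchy (\<lambda>n. s n \<one>)" using s_one_convergent by (rule convergent_Cauchy)
    ultimately obtain N where N: "\<And>m n. m \<ge> N \<Longrightarrow> n \<ge> N \<Longrightarrow> dist (s m \<one>) (s n \<one>) < e"
      unfolding Cauchy_def by blast
    have "dist (s m x) (s n x) < e" if "m \<ge> N" "n \<ge> N" for m n
    proof (cases "m \<le> n")
      case True
      then show ?thesis using s_diff[OF x True] N[OF that] by (simp add: dist_real_def)
    next
      case False
      then show ?thesis using s_diff[OF x, of n m] N[OF that] by (simp add: dist_real_def)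
    qed
    then show "\<exists>M. \<forall>m\<ge>M. \<forall>n\<ge>M. dist (s m x) (s n x) < e" by blast
  qed
  then show ?thesis unfolding p_def using Cauchy_convergent convergent_LIMSEQ_iff by blast
qed

text \<open>The rate of convergence at the identity serves every point, since all increments are
  dominated by those at the identity.\<close>

lemma p_near:
  assumes "e > 0" shows "\<exists>N. \<forall>n\<ge>N. \<forall>x\<in>carrier G. \<bar>p x - s n x\<bar> < e"
proof -
  obtain N where N: "\<And>n. n \<ge> N \<Longrightarrow> \<bar>s n \<one> - p \<one>\<bar> < e"
    using LIMSEQ_D[OF s_limit[OF one_closed] assms] by auto
  have "\<bar>p x - s n x\<bar> < e" if n: "n \<ge> N" and x: "x \<in> carrier G" for n x
  proof -
    have "\<bar>s n x - p x\<bar> \<le> s n \<one> - p \<one>"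
    proof (rule LIMSEQ_le)
      show "(\<lambda>m. \<bar>s n x - s m x\<bar>) \<longlonglongrightarrow> \<bar>s n x - p x\<bar>" by (intro tendsto_intros s_limit x)
      show "(\<lambda>m. s n \<one> - s m \<one>) \<longlonglongrightarrow> s n \<one> - p \<one>" by (intro tendsto_intros s_limit one_closed)
      show "\<exists>N. \<forall>m\<ge>N. \<bar>s n x - s m x\<bar> \<le> s n \<one> - s m \<one>" using s_diff[OF x] by blast
    qed
    then show ?thesis using N[OF n] by linarith
  qed
  then show ?thesis by blast
qed

lemma cont_p [simp]: "cont p"
proof (rule continuous_map_real_limit)
  fix e :: real assume "e > 0"
  from p_near[OF this] obtain N where "\<forall>x\<in>carrier G. \<bar>p x - s N x\<bar> < e" by blast
  then show "\<exists>g. cont g \<and> (\<forall>x\<in>topspace T. \<bar>p x - g x\<bar> < e)"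
    by (intro exI[of _ "s N"] conjI cont_s) (simp add: topspace_eq)
qed

lemma p_one_ge: "p \<one> \<ge> 1"
  using s_limit[OF one_closed] s_one_ge by (intro LIMSEQ_le_const) auto

lemma ip_uniform_limit:
  assumes fn: "\<And>n. cont (fn n)" and f: "cont f" and gn: "\<And>n. cont (gn n)" and g: "cont g"
    and lim_f: "\<And>e. e > 0 \<Longrightarrow> \<exists>N. \<forall>n\<ge>N. \<forall>x\<in>carrier G. \<bar>f x - fn n x\<bar> < e"
    and lim_g: "\<And>e. e > 0 \<Longrightarrow> \<exists>N. \<forall>n\<ge>N. \<forall>x\<in>carrier G. \<bar>g x - gn n x\<bar> < e"
  shows "(\<lambda>n. ip (fn n) (gn n)) \<longlonglongrightarrow> ip f g"
proof (rule LIMSEQ_I)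
  fix e :: real assume e: "e > 0"
  obtain A where A: "A > 0" "\<And>x. x \<in> carrier G \<Longrightarrow> \<bar>f x\<bar> \<le> A"
    using compact_space_bounded[OF compact f] topspace_eq by auto
  obtain B where B: "B > 0" "\<And>x. x \<in> carrier G \<Longrightarrow> \<bar>g x\<bar> \<le> B"
    using compact_space_bounded[OF compact g] topspace_eq by auto
  \<comment> \<open>Chosen so that \<open>d * (B + 1) + A * d \<le> e/2\<close>; the cap 1 keeps the
    approximants of \<open>g\<close> below \<open>B + 1\<close>.\<close>
  define d where "d = min 1 (e / (2 * (A + B + 1)))"
  have d: "d > 0" "d \<le> 1" "d * (A + B + 1) \<le> e/2"
  proof -
    show "d > 0" "d \<le> 1" using e A B by (auto simp: d_def)
    have "d * (A + B + 1) \<le> (e / (2 * (A + B + 1))) * (A + B + 1)"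
      using A B by (intro mult_right_mono) (auto simp: d_def)
    also have "\<dots> = e/2" using A B by (simp add: field_simps)
    finally show "d * (A + B + 1) \<le> e/2" .
  qed
  obtain N where N: "\<And>n x. n \<ge> N \<Longrightarrow> x \<in> carrier G \<Longrightarrow> \<bar>f x - fn n x\<bar> < d" using lim_f[OF d(1)] by blast
  obtain M where M: "\<And>n x. n \<ge> M \<Longrightarrow> x \<in> carrier G \<Longrightarrow> \<bar>g x - gn n x\<bar> < d" using lim_g[OF d(1)] by blast
  have "norm (ip (fn n) (gn n) - ip f g) < e" if n: "n \<ge> max N M" for n
  proof -
    note c = continuous_map_real_mult[OF fn gn, of n n] continuous_map_real_mult[OF f g]
    have "\<bar>mean (\<lambda>x. fn n x * gn n x - f x * g x) - 0\<bar> \<le> e/2"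
    proof (rule mean_near)
      show "cont (\<lambda>x. fn n x * gn n x - f x * g x)" by (intro continuous_map_diff c)
      fix x assume x: "x \<in> carrier G"
      have 1: "\<bar>f x - fn n x\<bar> \<le> d" "\<bar>g x - gn n x\<bar> \<le> d" using N[OF _ x, of n] M[OF _ x, of n] n by auto
      have 2: "\<bar>gn n x\<bar> \<le> B + 1" using 1(2) d(2) B(2)[OF x] by linarith
      have "fn n x * gn n x - f x * g x = (fn n x - f x) * gn n x + f x * (gn n x - g x)"
        by (simp add: algebra_simps)
      also have "\<bar>\<dots>\<bar> \<le> \<bar>fn n x - f x\<bar> * \<bar>gn n x\<bar> + \<bar>f x\<bar> * \<bar>gn n x - g x\<bar>"
        by (metis abs_mult abs_triangle_ineq)
      also have "\<dots> \<le> d * (B + 1) + A * d"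
        using 1 2 A(2)[OF x] A(1) B(1) d(1) by (intro add_mono mult_mono) (auto simp: abs_minus_commute)
      also have "\<dots> \<le> e/2" using d(3) by (simp add: algebra_simps)
      finally show "\<bar>fn n x * gn n x - f x * g x - 0\<bar> \<le> e/2" by simp
    qed
    then show ?thesis using mean_diff[OF c] e by (simp add: ip_def)
  qed
  then show "\<exists>no. \<forall>n\<ge>no. norm (ip (fn n) (gn n) - ip f g) < e" by blast
qed

text \<open>Convolving \<open>s n\<close> with itself doubles the exponent and squares the
  normalization, which yields \<open>s (2 * n + 1)\<close>, a later member of the same sequence. In
  the limit \<open>p\<close> reproduces itself.\<close>

lemma conv_op_p:
  assumes x: "x \<in> carrier G" shows "conv_op p p x = p x"
proof -
  have "(\<lambda>n. ip (s n) (translate x (s n))) \<longlonglongrightarrow> ip p (translate x p)"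
  proof (rule ip_uniform_limit)
    fix e :: real assume "e > 0"
    from p_near[OF this] show "\<exists>N. \<forall>n\<ge>N. \<forall>y\<in>carrier G. \<bar>translate x p y - translate x (s n) y\<bar> < e"
      unfolding translate_def using x by (meson inv_closed m_closed)
  qed (use p_near x in auto)
  moreover have "ip (s n) (translate x (s n)) = s (2 * n + 1) x" for n
  proof -
    let ?c = "1 / \<rho> ^ Suc n"
    have "s n = (\<lambda>x. ?c * kp (2 * n + 1) x)" by (simp add: s_def[abs_def])
    moreover have "translate x (\<lambda>x. ?c * kp (2 * n + 1) x) = (\<lambda>y. ?c * translate x (kp (2 * n + 1)) y)"
      by (simp add: translate_def[abs_def])
    ultimately have "ip (s n) (translate x (s n))
        = ip (\<lambda>x. ?c * kp (2 * n + 1) x) (\<lambda>y. ?c * translate x (kp (2 * n + 1)) y)"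
      by (simp only:)
    also have "\<dots> = ?c * ip (kp (2 * n + 1)) (\<lambda>y. ?c * translate x (kp (2 * n + 1)) y)"
      using x by (intro ip_scale_left continuous_map_real_mult_left cont_translate cont_kp)
    also have "\<dots> = ?c * (?c * ip (kp (2 * n + 1)) (translate x (kp (2 * n + 1))))"
      by (subst ip_scale_right) (use x in auto)
    also have "\<dots> = kp (2 * (2 * n + 1) + 1) x / (\<rho> ^ Suc n * \<rho> ^ Suc n)"
      using ip_kp_translate[OF x, of "2 * n + 1" "2 * n + 1"] by (simp add: mult_2 del: power_Suc)
    also have "\<rho> ^ Suc n * \<rho> ^ Suc n = \<rho> ^ Suc (2 * n + 1)" by (simp flip: power_add add: mult_2)
    finally show ?thesis unfolding s_def[of "2 * n + 1" x] .
  qed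
  moreover have "(\<lambda>n. s (2 * n + 1) x) \<longlonglongrightarrow> p x"
    using LIMSEQ_subseq_LIMSEQ[OF s_limit[OF x], of "\<lambda>n. 2 * n + 1"] by (simp add: strict_mono_def o_def)
  ultimately show ?thesis using LIMSEQ_unique by (simp add: conv_op_def) blast
qed

lemma ip_p_p: "ip p p \<ge> 1"
proof -
  have "ip p p = conv_op p p \<one>" unfolding conv_op_def by (rule ip_cong) auto
  then show ?thesis using conv_op_p[of \<one>] p_one_ge by simp
qed

text \<open>Orthogonality to the functions fixed by \<open>n\<close> passes from \<open>a\<close> to
  \<open>k\<close>, from there to all powers because the operator preserves invariance, and finally
  to the uniform limit.\<close>

lemma ip_p_eq_0:
  assumes n: "n \<in> carrier G" and orth: "\<And>q. left_invariant n q \<Longrightarrow> ip a q = 0" and q: "left_invariant n q"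
  shows "ip p q = 0"
proof -
  have k: "ip k q = 0" if q: "left_invariant n q" for q
  proof -
    have cq: "cont q" using q by (simp add: left_invariant_def)
    \<comment> \<open>Interchanging the means rewrites \<open>ip k q\<close> as
      \<open>ip a Q\<close>, where \<open>Q\<close> is the convolution of \<open>q\<close> with
      \<open>a\<close> and inherits the invariance of \<open>q\<close>.\<close>
    define Q where "Q y = mean (\<lambda>x. q x * translate x a y)" for y
    have c2: "cont2 (\<lambda>x y. q x * translate x a y)" by (intro cont2_prod cont2_fst cont2_translate a cq)
    have cQ: "cont Q" unfolding Q_def[abs_def] by (rule cont_mean[OF continuous_map_swap[OF c2]])
    have "ip k q = mean (\<lambda>x. mean (\<lambda>y. a y * (q x * translate x a y)))"
      unfolding ip_def k_def
    proof (rule mean_cong)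
      fix x assume "x \<in> carrier G"
      then have "cont (\<lambda>y. a y * translate x a y)" using a by (auto intro: continuous_map_real_mult)
      from mean_scale[OF this, of "q x"]
      show "mean (\<lambda>y. a y * translate x a y) * q x = mean (\<lambda>y. a y * (q x * translate x a y))"
        by (simp add: mult.commute mult.left_commute)
    qed
    also have "\<dots> = mean (\<lambda>y. mean (\<lambda>x. a y * (q x * translate x a y)))"
      by (rule mean_swap) (intro cont2_prod cont2_fst cont2_snd cont2_translate a cq)
    also have "\<dots> = ip a Q"
      unfolding ip_def Q_def
    proof (rule mean_cong)
      fix y assume "y \<in> carrier G"
      then have "cont (\<lambda>x. q x * translate x a y)" using continuous_map_slice(2)[OF c2] topspace_eq by simp
      from mean_scale[OF this, of "a y"]
      show "mean (\<lambda>x. a y * (q x * translate x a y)) = a y * mean (\<lambda>x. q x * translate x a y)" .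
    qed
    also have "left_invariant n Q"
    proof -
      have "translate n Q y = Q y" if y: "y \<in> carrier G" for y
      proof -
        have c: "cont (\<lambda>x. q x * translate x a (y))" using continuous_map_slice(2)[OF c2] topspace_eq y by simp
        have "Q y = mean (\<lambda>x. q (n \<otimes> x) * translate (n \<otimes> x) a y)"
          using mean_left[OF c n] by (simp add: Q_def)
        also have "\<dots> = mean (\<lambda>x. q x * translate x a (inv n \<otimes> y))"
        proof (rule mean_cong)
          fix x assume x: "x \<in> carrier G"
          have "q (n \<otimes> x) = translate n q (n \<otimes> x)" using q n x by (simp add: left_invariant_def)
          also have "\<dots> = q x" using n x by (simp add: translate_def flip: m_assoc)
          finally show "q (n \<otimes> x) * translate (n \<otimes> x) a y = q x * translate x a (inv n \<otimes> y)"
            using n x y by (simp add: translate_def inv_mult_group m_assoc)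
        qed
        finally show ?thesis by (simp add: translate_def[of n] Q_def)
      qed
      then show ?thesis using cQ by (simp add: left_invariant_def)
    qed
    then have "ip a Q = 0" by (rule orth)
    finally show ?thesis .
  qed
  have kp: "ip (kp j) q = 0" if "left_invariant n q" for j q
    using that
  proof (induction j arbitrary: q)
    case (Suc j)
    have "ip (kp (Suc j)) q = ip (kp j) (conv_op k q)"
      using selfadjoint[of "kp j" q] Suc by (simp add: kp_def left_invariant_def)
    then show ?case using Suc left_invariant_conv_op[OF cont_k _ n] by simp
  qed (simp add: k kp_def)
  have cq: "cont q" using q by (simp add: left_invariant_def)
  have "(\<lambda>j. ip (s j) q) \<longlonglongrightarrow> ip p q"
    by (rule ip_uniform_limit) (use p_near cq in auto)
  moreover have "ip (s j) q = 0" for j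
    using ip_scale_left[OF cont_kp cq, of "1 / \<rho> ^ Suc j" "2 * j + 1"] kp[OF q, of "2 * j + 1"]
    by (simp add: s_def[abs_def])
  ultimately show ?thesis using LIMSEQ_unique[of "\<lambda>_. 0" "ip p q" 0] by simp
qed

section \<open>Finite dimension of the range of the idempotent\<close>

definition range_p :: "('a \<Rightarrow> real) set" where
  "range_p = {f. cont f \<and> (\<forall>x\<in>carrier G. conv_op p f x = f x)}"

text \<open>The translates of \<open>p\<close> are reproducing kernels: evaluation at a point is an
  inner product.\<close>

lemma range_p_D: "f \<in> range_p \<Longrightarrow> cont f" "f \<in> range_p \<Longrightarrow> x \<in> carrier G \<Longrightarrow> ip f (translate x p) = f x"
  by (auto simp: range_p_def conv_op_def)

lemma translate_range_p: "f \<in> range_p \<Longrightarrow> t \<in> carrier G \<Longrightarrow> translate t f \<in> range_p"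
  unfolding range_p_def by (auto simp: conv_op_translate) (simp add: translate_def)

lemma lincomb_range_p:
  assumes "\<And>i. i \<in> I \<Longrightarrow> f i \<in> range_p" shows "(\<lambda>x. \<Sum>i\<in>I. c i * f i x) \<in> range_p"
proof -
  have c: "cont (f i)" "cont (\<lambda>x. c i * f i x)" if "i \<in> I" for i
    using range_p_D(1)[OF assms[OF that]] by (auto intro: continuous_map_real_mult_left)
  have "ip (\<lambda>x. \<Sum>i\<in>I. c i * f i x) (translate x p) = (\<Sum>i\<in>I. c i * f i x)" if x: "x \<in> carrier G" for x
  proof -
    have "ip (\<lambda>x. \<Sum>i\<in>I. c i * f i x) (translate x p) = (\<Sum>i\<in>I. ip (\<lambda>x. c i * f i x) (translate x p))"
      using c x by (intro ip_sum_left) auto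
    also have "\<dots> = (\<Sum>i\<in>I. c i * f i x)"
      using c x range_p_D(2)[OF assms] by (intro sum.cong refl) (simp add: ip_scale_left)
    finally show ?thesis .
  qed
  moreover have "cont (\<lambda>x. \<Sum>i\<in>I. c i * f i x)"
    by (cases "finite I") (use c in \<open>auto intro: continuous_map_sum\<close>)
  ultimately show ?thesis by (simp add: range_p_def conv_op_def)
qed

definition orthonormal :: "nat \<Rightarrow> (nat \<Rightarrow> 'a \<Rightarrow> real) \<Rightarrow> bool" where
  "orthonormal d f \<longleftrightarrow> (\<forall>i<d. f i \<in> range_p) \<and> (\<forall>i<d. \<forall>j<d. ip (f i) (f j) = (if i = j then 1 else 0))"

lemma residual_norm:
  assumes f: "orthonormal d f" and g: "cont g"
  defines "r \<equiv> \<lambda>x. g x - (\<Sum>i<d. ip g (f i) * f i x)"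
  shows "ip r r = ip g g - (\<Sum>i<d. (ip g (f i))\<^sup>2)" and "\<And>j. j < d \<Longrightarrow> ip r (f j) = 0" and "cont r"
proof -
  have cf: "cont (f i)" if "i < d" for i using f that range_p_D(1) by (auto simp: orthonormal_def)
  have cs: "cont (\<lambda>x. \<Sum>i<d. ip g (f i) * f i x)"
    using cf by (intro continuous_map_sum continuous_map_real_mult_left) auto
  have ips: "ip (\<lambda>x. \<Sum>i<d. ip g (f i) * f i x) h = (\<Sum>i<d. ip g (f i) * ip (f i) h)" if "cont h" for h
  proof -
    have "ip (\<lambda>x. \<Sum>i<d. ip g (f i) * f i x) h = (\<Sum>i<d. ip (\<lambda>x. ip g (f i) * f i x) h)"
      using cf that by (intro ip_sum_left continuous_map_real_mult_left) auto
    then show ?thesis using cf that by (simp add: ip_scale_left)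
  qed
  show cr: "cont r" unfolding r_def by (intro continuous_map_diff g cs)
  show orth: "ip r (f j) = 0" if j: "j < d" for j
  proof -
    have "ip r (f j) = ip g (f j) - (\<Sum>i<d. ip g (f i) * ip (f i) (f j))"
      unfolding r_def using ips[OF cf[OF j]] ip_diff_left[OF g cs cf[OF j]] by simp
    also have "(\<Sum>i<d. ip g (f i) * ip (f i) (f j)) = (\<Sum>i<d. if i = j then ip g (f i) else 0)"
      using f j by (intro sum.cong) (auto simp: orthonormal_def)
    finally show ?thesis using j by simp
  qed
  have "ip r r = ip r g - ip r (\<lambda>x. \<Sum>i<d. ip g (f i) * f i x)"
    using ip_diff_right[OF g cs cr] by (simp add: r_def)
  also have "ip r (\<lambda>x. \<Sum>i<d. ip g (f i) * f i x) = 0"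
  proof -
    have "ip (f i) r = 0" if "i < d" for i using orth[OF that] ip_commute[of r "f i"] by simp
    then have "ip (\<lambda>x. \<Sum>i<d. ip g (f i) * f i x) r = 0" unfolding ips[OF cr] by simp
    then show ?thesis by (simp only: ip_commute[of r])
  qed
  also have "ip r g = ip g g - (\<Sum>i<d. (ip g (f i))\<^sup>2)"
  proof -
    have "(\<Sum>i<d. ip g (f i) * ip (f i) g) = (\<Sum>i<d. (ip g (f i))\<^sup>2)"
      by (intro sum.cong refl) (simp only: power2_eq_square ip_commute)
    then show ?thesis unfolding r_def ip_diff_left[OF g cs g] ips[OF g] by simp
  qed
  finally show "ip r r = ip g g - (\<Sum>i<d. (ip g (f i))\<^sup>2)" by simp
qed

text \<open>The reproducing property turns Bessel's inequality for \<open>translate x p\<close> into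
  a bound by \<open>ip p p\<close> for the sum of all \<open>f i x * f i x\<close> at each point.
  Taking the mean over \<open>x\<close> counts the functions, as the trace of a projection
  would.\<close>

lemma orthonormal_bound: assumes f: "orthonormal d f" shows "real d \<le> ip p p"
proof -
  have cf: "cont (f i)" if "i < d" for i using f that range_p_D(1) by (auto simp: orthonormal_def)
  have "mean (\<lambda>x. \<Sum>i<d. f i x * f i x) \<le> mean (\<lambda>x. ip p p)"
  proof (rule mean_mono)
    show "cont (\<lambda>x. \<Sum>i<d. f i x * f i x)" using cf by (intro continuous_map_sum continuous_map_real_mult) auto
    fix x assume x: "x \<in> carrier G"
    have "cont (translate x p)" using x by simp
    note r = residual_norm(1,3)[OF f this]
    have "0 \<le> ip (translate x p) (translate x p) - (\<Sum>i<d. (ip (translate x p) (f i))\<^sup>2)"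
      unfolding r(1)[symmetric] by (rule ip_nonneg[OF r(2)])
    moreover have "ip (translate x p) (f i) = f i x" if "i < d" for i
      using range_p_D(2)[of "f i" x] f that x by (simp add: orthonormal_def ip_commute[of _ "f i"])
    ultimately show "(\<Sum>i<d. f i x * f i x) \<le> ip p p"
      using x by (simp add: ip_translate power2_eq_square)
  qed simp
  also have "mean (\<lambda>x. \<Sum>i<d. f i x * f i x) = (\<Sum>i<d. ip (f i) (f i))"
    unfolding ip_def using cf by (intro mean_sum continuous_map_real_mult) auto
  also have "\<dots> = d" using f by (simp add: orthonormal_def)
  finally show ?thesis by simp
qed

text \<open>The bound on the length yields a longest orthonormal family. It spans, since a nonzero
  residual of an element of the range could be normalized and added.\<close>

lemma ex_orthonormal_basis:
  "\<exists>d f. orthonormal d f \<and> (\<forall>g\<in>range_p. \<forall>x\<in>carrier G. g x = (\<Sum>i<d. ip g (f i) * f i x))"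
proof -
  have 0: "\<exists>f. orthonormal 0 f" by (simp add: orthonormal_def)
  have bound: "\<forall>d. (\<exists>f. orthonormal d f) \<longrightarrow> d < Suc (nat \<lceil>ip p p\<rceil>)"
  proof (intro allI impI, elim exE)
    fix d f assume "orthonormal d f"
    then have "real d \<le> real (nat \<lceil>ip p p\<rceil>)"
      by (rule order_trans[OF orthonormal_bound real_nat_ceiling_ge])
    then show "d < Suc (nat \<lceil>ip p p\<rceil>)" by simp
  qed
  obtain d where d: "\<exists>f. orthonormal d f" and max: "\<forall>d'. (\<exists>f. orthonormal d' f) \<longrightarrow> d' \<le> d"
    using ex_has_greatest_nat[of "\<lambda>d. \<exists>f. orthonormal d f" 0 "\<lambda>d. d", OF 0 bound] by blast
  from d obtain f where f: "orthonormal d f" by blast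
  have "g x = (\<Sum>i<d. ip g (f i) * f i x)" if g: "g \<in> range_p" and x: "x \<in> carrier G" for g x
  proof (rule ccontr)
    define r where "r = (\<lambda>x. g x - (\<Sum>i<d. ip g (f i) * f i x))"
    note r = residual_norm[OF f range_p_D(1)[OF g], folded r_def]
    assume "g x \<noteq> (\<Sum>i<d. ip g (f i) * f i x)"
    then have "r x \<noteq> 0" by (simp add: r_def)
    then have pos: "ip r r > 0" using r(3) x by (intro ip_pos) auto
    have sum: "(\<lambda>x. \<Sum>i<d. ip g (f i) * f i x) \<in> range_p"
      by (rule lincomb_range_p) (use f in \<open>auto simp: orthonormal_def\<close>)
    have rE: "r \<in> range_p"
    proof -
      have "ip r (translate y p) = r y" if y: "y \<in> carrier G" for y
        unfolding r_def using y range_p_D[OF g] range_p_D[OF sum] by (subst ip_diff_left) auto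
      then show ?thesis using r(3) by (simp add: range_p_def conv_op_def)
    qed
    define c where "c = 1 / sqrt (ip r r)"
    have cc: "c * c * ip r r = 1" using pos by (simp add: c_def)
    define f' where "f' i = (if i < d then f i else (\<lambda>x. c * r x))" for i
    have cr: "cont (\<lambda>x. c * r x)" by (rule continuous_map_real_mult_left[OF r(3)])
    have cf: "cont (f i)" if "i < d" for i using f that range_p_D(1) by (auto simp: orthonormal_def)
    have E: "f' i \<in> range_p" for i
    proof (cases "i < d")
      case False
      have "ip (\<lambda>x. c * r x) (translate y p) = c * r y" if y: "y \<in> carrier G" for y
        using y range_p_D[OF rE] by (simp add: ip_scale_left)
      then show ?thesis using False cr by (simp add: f'_def range_p_def conv_op_def)
    qed (use f in \<open>auto simp: f'_def orthonormal_def\<close>)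
    have "ip (\<lambda>x. c * r x) (\<lambda>x. c * r x) = 1"
      using cc r(3) cr by (simp add: ip_scale_left ip_scale_right)
    moreover have "ip (\<lambda>x. c * r x) (f j) = 0" "ip (f j) (\<lambda>x. c * r x) = 0" if "j < d" for j
      using r(2)[OF that] r(3) cf[OF that] by (simp_all add: ip_scale_left ip_scale_right ip_commute[of "f j"])
    ultimately have "orthonormal (Suc d) f'"
      using f E by (auto simp: orthonormal_def f'_def less_Suc_eq)
    then show False using max by (metis Suc_n_not_le_n)
  qed
  with f show ?thesis by blast
qed

section \<open>The representation on the range\<close>

lemma ex_rep:
  assumes n: "n \<in> carrier G" and orth: "\<And>q. left_invariant n q \<Longrightarrow> ip a q = 0"
  shows "\<exists>X. unitary_rep G T X \<and> rmat X n \<noteq> 1\<^sub>m (rdim X)"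
proof -
  obtain d f where f: "orthonormal d f" and 
    exp: "\<And>g x. g \<in> range_p \<Longrightarrow> x \<in> carrier G \<Longrightarrow> g x = (\<Sum>i<d. ip g (f i) * f i x)"
    using ex_orthonormal_basis by blast
  have fE: "f i \<in> range_p" if "i < d" for i using f that by (auto simp: orthonormal_def)
  have cf: "cont (f i)" if "i < d" for i using range_p_D(1)[OF fE[OF that]] .
  \<comment> \<open>Left translation on the range, written in the basis \<open>f\<close>: a real
    orthogonal matrix, continuous in \<open>g\<close> because means depend continuously on
    parameters.\<close>
  define M where "M g i j = ip (translate g (f j)) (f i)" for g i j
  define X where "X = Rep d (\<lambda>g. mat d d (\<lambda>(i, j). complex_of_real (M g i j)))"
  have ip_exp: "ip g h = (\<Sum>k<d. ip g (f k) * ip (f k) h)" if g: "g \<in> range_p" and h: "cont h" for g h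
  proof -
    have "ip g h = ip (\<lambda>x. \<Sum>k<d. ip g (f k) * f k x) h" using exp[OF g] by (intro ip_cong) auto
    also have "\<dots> = (\<Sum>k<d. ip (\<lambda>x. ip g (f k) * f k x) h)"
      using cf h by (intro ip_sum_left continuous_map_real_mult_left) auto
    also have "\<dots> = (\<Sum>k<d. ip g (f k) * ip (f k) h)" using cf h by (intro sum.cong refl) (simp add: ip_scale_left)
    finally show ?thesis .
  qed
  have mult: "M (g \<otimes> h) i j = (\<Sum>k<d. M g i k * M h k j)"
    if g: "g \<in> carrier G" and h: "h \<in> carrier G" and i: "i < d" and j: "j < d" for g h i j
  proof -
    have "M (g \<otimes> h) i j = ip (translate g (translate h (f j))) (f i)"
      unfolding M_def using g h by (intro ip_cong) (simp_all add: translate_translate)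
    also have "\<dots> = ip (translate h (f j)) (translate (inv g) (f i))"
      using g h cf[OF i] cf[OF j] by (intro ip_translate_left) auto
    also have "\<dots> = (\<Sum>k<d. ip (translate h (f j)) (f k) * ip (f k) (translate (inv g) (f i)))"
      using g h fE[OF j] cf[OF i] by (intro ip_exp translate_range_p) auto
    also have "\<dots> = (\<Sum>k<d. M g i k * M h k j)"
      using g cf cf[OF i] by (intro sum.cong refl) (simp add: M_def ip_translate_left)
    finally show ?thesis .
  qed
  have unit: "(\<Sum>k<d. M g k i * M g k j) = (if i = j then 1 else 0)"
    if g: "g \<in> carrier G" and i: "i < d" and j: "j < d" for g i j
  proof -
    have "ip (f i) (f j) = ip (translate g (f i)) (translate g (f j))"
      using g cf i j by (simp add: ip_translate)
    also have "\<dots> = (\<Sum>k<d. M g k i * M g k j)"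
      unfolding M_def using ip_exp[OF translate_range_p[OF fE[OF i] g], of "translate g (f j)"] g cf[OF j]
      by (simp add: ip_commute[of "f _" "translate g (f j)"])
    finally show ?thesis using f i j by (simp add: orthonormal_def)
  qed
  have cM: "cont (\<lambda>g. M g i j)" if i: "i < d" and j: "j < d" for i j
    unfolding M_def ip_def by (rule cont_mean) (intro cont2_prod cont2_snd cont2_translate cf i j)
  have "unitary_rep G T X"
    unfolding unitary_rep_def
  proof (intro conjI ballI allI impI)
    fix g assume g: "g \<in> carrier G"
    show "rmat X g \<in> carrier_mat (rdim X) (rdim X)" by (simp add: X_def)
    show "mat_adjoint (rmat X g) * rmat X g = 1\<^sub>m (rdim X)"
    proof (rule eq_matI)
      fix i j assume "i < dim_row (1\<^sub>m (rdim X) :: complex mat)" "j < dim_col (1\<^sub>m (rdim X) :: complex mat)"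
      then have ij: "i < d" "j < d" by (simp_all add: X_def)
      have "(mat_adjoint (rmat X g) * rmat X g) $$ (i, j) = complex_of_real (\<Sum>k<d. M g k i * M g k j)"
        using ij by (simp add: X_def index_mat_adjoint scalar_prod_def lessThan_atLeast0)
      then show "(mat_adjoint (rmat X g) * rmat X g) $$ (i, j) = 1\<^sub>m (rdim X) $$ (i, j)"
        using unit[OF g ij] ij by (simp add: X_def)
    qed (simp_all add: X_def index_mat_adjoint)
    fix h assume h: "h \<in> carrier G"
    show "rmat X (g \<otimes> h) = rmat X g * rmat X h"
    proof (rule eq_matI)
      fix i j assume "i < dim_row (rmat X g * rmat X h)" "j < dim_col (rmat X g * rmat X h)"
      then have ij: "i < d" "j < d" by (simp_all add: X_def)
      then show "rmat X (g \<otimes> h) $$ (i, j) = (rmat X g * rmat X h) $$ (i, j)"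
        using mult[OF g h ij] by (simp add: X_def scalar_prod_def lessThan_atLeast0)
    qed (simp_all add: X_def)
  next
    fix i j assume "i < rdim X" "j < rdim X"
    then have ij: "i < d" "j < d" by (simp_all add: X_def)
    have "continuous_map euclideanreal euclidean complex_of_real"
      by (simp add: continuous_on_of_real_id)
    from continuous_map_compose[OF cM[OF ij] this]
    show "continuous_map T euclidean (\<lambda>g. rmat X g $$ (i, j))"
      using ij by (simp add: X_def o_def)
  qed
  \<comment> \<open>If \<open>n\<close> acted trivially, translation by \<open>n\<close> would fix
    the range and with it \<open>p\<close>. Then \<open>p\<close> would be orthogonal to itself,
    although \<open>ip p p\<close> is at least 1.\<close>
  moreover have "rmat X n \<noteq> 1\<^sub>m (rdim X)"
  proof
    assume eq: "rmat X n = 1\<^sub>m (rdim X)"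
    have M1: "M n i j = (if i = j then 1 else 0)" if "i < d" "j < d" for i j
      using arg_cong[OF eq, of "\<lambda>A. A $$ (i, j)"] that by (simp add: X_def split: if_splits)
    have inv: "translate n (f j) x = f j x" if j: "j < d" and x: "x \<in> carrier G" for j x
    proof -
      have "translate n (f j) x = (\<Sum>i<d. M n i j * f i x)"
        using exp[OF translate_range_p[OF fE[OF j] n] x] by (simp add: M_def)
      also have "\<dots> = (\<Sum>i<d. if i = j then f i x else 0)" using M1 j by (intro sum.cong) auto
      finally show ?thesis using j by simp
    qed
    have pE: "p \<in> range_p" by (simp add: range_p_def conv_op_p)
    have "translate n p x = p x" if x: "x \<in> carrier G" for x
    proof -
      have "translate n p x = (\<Sum>i<d. ip p (f i) * f i (inv n \<otimes> x))"
        unfolding translate_def using exp[OF pE] n x by simp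
      also have "\<dots> = (\<Sum>i<d. ip p (f i) * f i x)"
        using inv x by (intro sum.cong refl) (simp add: translate_def)
      also have "\<dots> = p x" using exp[OF pE x] by simp
      finally show ?thesis .
    qed
    then have "left_invariant n p" by (simp add: left_invariant_def)
    from ip_p_eq_0[OF n orth this] show False using ip_p_p by simp
  qed
  ultimately show ?thesis by blast
qed

end

context compact_group
begin

theorem ex_unitary_rep_nontrivial:
  assumes n: "n \<in> carrier G" "n \<noteq> \<one>"
  obtains X where "unitary_rep G T X" "rmat X n \<noteq> 1\<^sub>m (rdim X)"
proof -
  have "completely_regular_space T"
    using compact Hausdorff compact_Hausdorff_or_regular_imp_normal_space normal_imp_completely_regular_space
    by blast
  moreover have "closedin T {inv n}"
    using Hausdorff n topspace_eq by (intro closedin_Hausdorff_singleton) auto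
  moreover have "inv n \<noteq> \<one>" using n inv_inv[OF n(1)] inv_one by metis
  then have "\<one> \<in> topspace T - {inv n}" using topspace_eq by auto
  ultimately obtain h where h: "continuous_map T (top_of_set {0..1::real}) h" "h \<one> = 0" "h ` {inv n} \<subseteq> {1}"
    unfolding completely_regular_space_def by metis
  have ch: "cont h" using h(1) by (simp add: continuous_map_in_subtopology)
  \<comment> \<open>Such a difference is orthogonal to every function fixed by translation by
    \<open>n\<close>. It is nonzero because
    \<open>a \<one> = h (inv n) - h \<one> = 1\<close>.\<close>
  define a where "a x = translate n h x - h x" for x
  have ca: "cont a" unfolding a_def[abs_def] using ch n by (intro continuous_map_diff) auto
  have "a \<one> \<noteq> 0" using h n by (simp add: a_def translate_def)
  then interpret positive_kernel G T a
    by unfold_locales (use ca in auto)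
  have "ip a q = 0" if q: "left_invariant n q" for q
  proof -
    have cq: "cont q" using q by (simp add: left_invariant_def)
    have "ip a q = ip (translate n h) q - ip h q"
      unfolding a_def[abs_def] using ch cq n by (intro ip_diff_left) auto
    also have "ip (translate n h) q = ip (translate n h) (translate n q)"
      using q by (intro ip_cong) (simp_all add: left_invariant_def)
    also have "\<dots> = ip h q" using ch cq n by (intro ip_translate) auto
    finally show ?thesis by simp
  qed
  from ex_rep[OF n(1) this] show ?thesis using that by blast
qed

end

section \<open>The Stone--Weierstrass theorem on a compact space\<close>

text \<open>The Hausdorff property makes compact images in the space of functions
  \<open>A \<Rightarrow> \<complex>\<close> closed, which the Stone--Weierstrass argument
  uses.\<close>

instance "fun" :: (type, t2_space) t2_space
proof
  fix f g :: "'a \<Rightarrow> 'b" assume "f \<noteq> g"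
  then obtain i where i: "f i \<noteq> g i" by auto
  then obtain U V where UV: "open U" "open V" "f i \<in> U" "g i \<in> V" "U \<inter> V = {}"
    using hausdorff by metis
  have *: "open {h :: 'a \<Rightarrow> 'b. h i \<in> W}" if "open W" for W
  proof -
    have "continuous_on UNIV (\<lambda>h :: 'a \<Rightarrow> 'b. h i)" by (rule continuous_on_product_coordinates)
    then show ?thesis
      using continuous_on_open_vimage[OF open_UNIV, of "\<lambda>h :: 'a \<Rightarrow> 'b. h i"] that by (simp add: vimage_def)
  qed
  show "\<exists>U V. open U \<and> open V \<and> f \<in> U \<and> g \<in> V \<and> U \<inter> V = {}"
    by (rule exI[of _ "{h. h i \<in> U}"], rule exI[of _ "{h. h i \<in> V}"]) (use UV * in auto)
qed

lemma continuous_map_complex_mult: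
  "continuous_map X euclidean f \<Longrightarrow> continuous_map X euclidean g \<Longrightarrow>
    continuous_map X euclidean (\<lambda>x. f x * g x :: complex)"
  by (simp add: continuous_map_atin tendsto_mult)

lemma continuous_map_cnj:
  "continuous_map X euclidean f \<Longrightarrow> continuous_map X euclidean (\<lambda>x. cnj (f x))"
  by (simp add: continuous_map_atin tendsto_cnj)

lemma continuous_map_Re:
  "continuous_map X euclidean f \<Longrightarrow> continuous_map X euclidean (\<lambda>x. Re (f x))"
  by (simp add: continuous_map_atin tendsto_Re)

lemma continuous_map_Im:
  "continuous_map X euclidean f \<Longrightarrow> continuous_map X euclidean (\<lambda>x. Im (f x))"
  by (simp add: continuous_map_atin tendsto_Im)

text \<open>The functions in \<open>A\<close> map \<open>X\<close> onto a compact set of functions \<open>A \<Rightarrow> \<complex>\<close>, to which \<open>f\<close>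
  descends; Stone--Weierstrass is applied there.\<close>

theorem Stone_Weierstrass_complex:
  fixes X :: "'a topology" and A :: "('a \<Rightarrow> complex) set"
  assumes X: "compact_space X"
    and contA: "\<And>a. a \<in> A \<Longrightarrow> continuous_map X euclidean a"
    and addA: "\<And>a b. a \<in> A \<Longrightarrow> b \<in> A \<Longrightarrow> (\<lambda>x. a x + b x) \<in> A"
    and multA: "\<And>a b. a \<in> A \<Longrightarrow> b \<in> A \<Longrightarrow> (\<lambda>x. a x * b x) \<in> A"
    and cnjA: "\<And>a. a \<in> A \<Longrightarrow> (\<lambda>x. cnj (a x)) \<in> A"
    and constA: "\<And>c. (\<lambda>_. c) \<in> A"
    and f: "continuous_map X euclidean f"
    and sep: "\<And>x y. x \<in> topspace X \<Longrightarrow> y \<in> topspace X \<Longrightarrow> (\<And>a. a \<in> A \<Longrightarrow> a x = a y) \<Longrightarrow> f x = f y"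
    and e: "e > 0"
  shows "\<exists>a\<in>A. \<forall>x\<in>topspace X. cmod (f x - a x) < e"
proof -
  \<comment> \<open>The default 0 outside \<open>A\<close> makes \<open>\<phi> x = \<phi> y\<close>
    equivalent to agreement of \<open>x\<close> and \<open>y\<close> under all functions in
    \<open>A\<close>.\<close>
  define \<phi> :: "'a \<Rightarrow> ('a \<Rightarrow> complex) \<Rightarrow> complex" where "\<phi> x = (\<lambda>a. if a \<in> A then a x else 0)" for x
  have "continuous_map X (product_topology (\<lambda>_. euclidean) UNIV) \<phi>"
    unfolding continuous_map_componentwise_UNIV using contA by (auto simp: \<phi>_def)
  then have c\<phi>: "continuous_map X euclidean \<phi>" by (simp add: euclidean_product_topology)
  define S where "S = \<phi> ` topspace X"
  have comp: "compact (\<phi> ` C)" if "closedin X C" for C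
    using image_compactin[OF closedin_compact_space[OF X that] c\<phi>] by simp
  then have S: "compact S" unfolding S_def by blast
  \<comment> \<open>The real functions on the image whose pullback belongs to \<open>A\<close>; they
    separate points because \<open>A\<close> contains real and imaginary parts of its
    elements.\<close>
  define R where "R = {r. continuous_on S r \<and> (\<exists>a\<in>A. \<forall>x\<in>topspace X. complex_of_real (r (\<phi> x)) = a x)}"
  have RI: "r \<in> R" if "continuous_on S r" "a \<in> A" "\<And>x. x \<in> topspace X \<Longrightarrow> complex_of_real (r (\<phi> x)) = a x" for r a
    using that unfolding R_def by blast
  interpret function_ring_on R S
  proof
    show "compact S" by (rule S)
    show "continuous_on S r" if "r \<in> R" for r using that by (simp add: R_def)
  next
    fix r q assume "r \<in> R" "q \<in> R"
    then obtain a b where ab: "a \<in> A" "b \<in> A" "continuous_on S r" "continuous_on S q"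
      "\<forall>x\<in>topspace X. complex_of_real (r (\<phi> x)) = a x" "\<forall>x\<in>topspace X. complex_of_real (q (\<phi> x)) = b x"
      unfolding R_def by blast
    show "(\<lambda>x. r x + q x) \<in> R"
      by (rule RI[OF continuous_on_add[OF ab(3,4)] addA[OF ab(1,2)]]) (use ab in simp)
    show "(\<lambda>x. r x * q x) \<in> R"
      by (rule RI[OF continuous_on_mult[OF ab(3,4)] multA[OF ab(1,2)]]) (use ab in simp)
  next
    show "(\<lambda>_. c) \<in> R" for c by (rule RI[OF continuous_on_const constA[of "complex_of_real c"]]) simp
  next
    fix s t assume "s \<in> S" "t \<in> S" "s \<noteq> t"
    then obtain x y where xy: "x \<in> topspace X" "y \<in> topspace X" "s = \<phi> x" "t = \<phi> y" by (auto simp: S_def)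
    then obtain a where a: "a \<in> A" "a x \<noteq> a y" using \<open>s \<noteq> t\<close> by (auto simp: \<phi>_def fun_eq_iff split: if_splits)
    have ca: "continuous_on S (\<lambda>h. h a)"
      by (rule continuous_on_subset[OF continuous_on_product_coordinates]) simp
    have "(\<lambda>x. (1/2) * (a x + cnj (a x))) \<in> A" using a by (intro multA constA addA cnjA)
    then have 1: "(\<lambda>h. Re (h a)) \<in> R"
      by (rule RI[rotated]) (auto simp: \<phi>_def a complex_eq_iff intro!: continuous_on_Re ca)
    have "(\<lambda>x. (-\<i>/2) * (a x + (-1) * cnj (a x))) \<in> A" using a by (intro multA constA addA cnjA)
    then have 2: "(\<lambda>h. Im (h a)) \<in> R"
      by (rule RI[rotated]) (auto simp: \<phi>_def a complex_eq_iff intro!: continuous_on_Im ca)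
    have "Re (s a) \<noteq> Re (t a) \<or> Im (s a) \<noteq> Im (t a)" using a xy by (auto simp: \<phi>_def complex_eq_iff)
    then show "\<exists>r\<in>R. r s \<noteq> r t" by (rule disjE) (rule bexI[OF _ 1], simp, rule bexI[OF _ 2], simp)
  qed
  have approx: "\<exists>a\<in>A. \<forall>x\<in>topspace X. cmod (complex_of_real (g x) - a x) < e/2"
    if g: "continuous_map X euclideanreal g" and gf: "\<And>x y. f x = f y \<Longrightarrow> g x = g y" for g
  proof -
    \<comment> \<open>The choice of the preimage is harmless: points with equal image under
      \<open>\<phi>\<close> have equal values of \<open>f\<close> by \<open>sep\<close>, hence of
      \<open>g\<close>.\<close>
    define F where "F s = g (SOME x. x \<in> topspace X \<and> \<phi> x = s)" for s
    have F: "F (\<phi> x) = g x" if x: "x \<in> topspace X" for x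
    proof -
      define y where "y = (SOME y. y \<in> topspace X \<and> \<phi> y = \<phi> x)"
      have y: "y \<in> topspace X \<and> \<phi> y = \<phi> x" unfolding y_def by (rule someI[of _ x]) (use x in simp)
      have "a y = a x" if "a \<in> A" for a
      proof -
        have "\<phi> y a = \<phi> x a" using y by simp
        with that show ?thesis by (simp add: \<phi>_def)
      qed
      with y x have "f y = f x" by (intro sep) auto
      then have "g y = g x" by (rule gf)
      then show ?thesis by (simp add: F_def y_def)
    qed
    \<comment> \<open>A continuous map from a compact to a Hausdorff space is closed, so the
      preimage of \<open>B\<close> under \<open>F\<close> is the closed image of the preimage under
      \<open>g\<close>.\<close>
    have "continuous_on S F"
    proof (subst continuous_on_closed_vimage[OF compact_imp_closed[OF S]], intro allI impI)
      fix B :: "real set" assume "closed B"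
      then have "closedin X {x \<in> topspace X. g x \<in> B}"
        using g by (intro closedin_continuous_map_preimage[of X euclideanreal]) simp_all
      then have "closed (\<phi> ` {x \<in> topspace X. g x \<in> B})" by (intro compact_imp_closed comp)
      moreover have "\<phi> ` {x \<in> topspace X. g x \<in> B} = F -` B \<inter> S" using F by (auto simp: S_def)
      ultimately show "closed (F -` B \<inter> S)" by simp
    qed
    from Stone_Weierstrass_basic[OF this, of "e/2"] e
    obtain r where r: "r \<in> R" "\<forall>s\<in>S. \<bar>F s - r s\<bar> < e/2" by auto
    then obtain a where a: "a \<in> A" "\<forall>x\<in>topspace X. complex_of_real (r (\<phi> x)) = a x" unfolding R_def by blast
    have "cmod (complex_of_real (g x) - a x) < e/2" if x: "x \<in> topspace X" for x
    proof -
      have "complex_of_real (g x) - a x = complex_of_real (F (\<phi> x) - r (\<phi> x))" using a(2) F x by simp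
      then show ?thesis using r(2) x by (simp only: norm_of_real) (simp add: S_def)
    qed
    with a(1) show ?thesis by blast
  qed
  obtain a where a: "a \<in> A" "\<And>x. x \<in> topspace X \<Longrightarrow> cmod (complex_of_real (Re (f x)) - a x) < e/2"
    using approx[OF continuous_map_Re[OF f]] by auto
  obtain b where b: "b \<in> A" "\<And>x. x \<in> topspace X \<Longrightarrow> cmod (complex_of_real (Im (f x)) - b x) < e/2"
    using approx[OF continuous_map_Im[OF f]] by auto
  have "(\<lambda>x. a x + \<i> * b x) \<in> A" by (intro addA multA constA a(1) b(1))
  moreover have "cmod (f x - (a x + \<i> * b x)) < e" if x: "x \<in> topspace X" for x
  proof -
    have "f x - (a x + \<i> * b x) = (complex_of_real (Re (f x)) - a x) + \<i> * (complex_of_real (Im (f x)) - b x)"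
      by (subst complex_eq[of "f x"]) (simp add: algebra_simps)
    also have "cmod \<dots> \<le> cmod (complex_of_real (Re (f x)) - a x) + cmod (complex_of_real (Im (f x)) - b x)"
      by (rule order_trans[OF norm_triangle_ineq]) (simp add: norm_mult)
    finally show ?thesis using a(2)[OF x] b(2)[OF x] by simp
  qed
  ultimately show ?thesis by (intro bexI[of _ "\<lambda>x. a x + \<i> * b x"] ballI)
qed

section \<open>The mean of a complex-valued function\<close>

context compact_group
begin

abbreviation ccont :: "('a \<Rightarrow> complex) \<Rightarrow> bool" where
  "ccont f \<equiv> continuous_map T euclidean f"

definition cmean :: "('a \<Rightarrow> complex) \<Rightarrow> complex" where
  "cmean f = Complex (mean (\<lambda>x. Re (f x))) (mean (\<lambda>x. Im (f x)))"

lemma cmean_cong: "(\<And>x. x \<in> carrier G \<Longrightarrow> f x = g x) \<Longrightarrow> cmean f = cmean g"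
  unfolding cmean_def by (intro arg_cong2[of _ _ _ _ Complex] mean_cong) auto

lemma ccont_compose: "ccont f \<Longrightarrow> continuous_map X T g \<Longrightarrow> continuous_map X euclidean (\<lambda>x. f (g x))"
  using continuous_map_compose[of X T g euclidean f] by (simp add: o_def)

lemma cmean_left: "ccont f \<Longrightarrow> s \<in> carrier G \<Longrightarrow> cmean (\<lambda>x. f (s \<otimes> x)) = cmean f"
  unfolding cmean_def
  using mean_left[OF continuous_map_Re, of f s] mean_left[OF continuous_map_Im, of f s] by simp

lemma cmean_const [simp]: "cmean (\<lambda>_. c) = c"
  by (simp add: cmean_def)

lemma cmean_add: "ccont f \<Longrightarrow> ccont g \<Longrightarrow> cmean (\<lambda>x. f x + g x) = cmean f + cmean g"
  using mean_add[OF continuous_map_Re continuous_map_Re, of f g] mean_add[OF continuous_map_Im continuous_map_Im, of f g]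
  by (simp add: cmean_def complex_eq_iff)

lemma cmean_scale:
  assumes f: "ccont f" shows "cmean (\<lambda>x. c * f x) = c * cmean f"
proof -
  note re = continuous_map_Re[OF f] and im = continuous_map_Im[OF f]
  note s = continuous_map_real_mult_left[OF re] continuous_map_real_mult_left[OF im]
  have "mean (\<lambda>x. Re c * Re (f x) - Im c * Im (f x)) = Re c * mean (\<lambda>x. Re (f x)) - Im c * mean (\<lambda>x. Im (f x))"
    using mean_diff[OF s] mean_scale[OF re] mean_scale[OF im] by simp
  moreover have "mean (\<lambda>x. Re c * Im (f x) + Im c * Re (f x)) = Re c * mean (\<lambda>x. Im (f x)) + Im c * mean (\<lambda>x. Re (f x))"
    using mean_add[OF s(2,1)] mean_scale[OF re] mean_scale[OF im] by simp
  ultimately show ?thesis by (simp add: cmean_def complex_eq_iff)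
qed

lemma ccont_sum: "(\<And>i. i \<in> I \<Longrightarrow> ccont (f i)) \<Longrightarrow> ccont (\<lambda>x. \<Sum>i\<in>I. f i x)"
  by (induction I rule: infinite_finite_induct) (auto intro: continuous_map_add)

lemma cmean_sum:
  assumes "\<And>i. i \<in> I \<Longrightarrow> ccont (f i)" shows "cmean (\<lambda>x. \<Sum>i\<in>I. f i x) = (\<Sum>i\<in>I. cmean (f i))"
  using assms
proof (induction I rule: infinite_finite_induct)
  case (insert i I)
  then have "cmean (\<lambda>x. f i x + (\<Sum>i\<in>I. f i x)) = cmean (f i) + cmean (\<lambda>x. \<Sum>i\<in>I. f i x)"
    by (intro cmean_add ccont_sum) auto
  with insert show ?case by simp
qed simp_all

text \<open>The factor 2 comes from bounding real and imaginary parts separately; the approximation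
  constants below allow for it.\<close>

lemma norm_cmean_le:
  assumes f: "ccont f" and B: "\<And>x. x \<in> carrier G \<Longrightarrow> cmod (f x) \<le> B" shows "cmod (cmean f) \<le> 2 * B"
proof -
  have "\<bar>mean (\<lambda>x. Re (f x)) - 0\<bar> \<le> B"
    by (rule mean_near[OF continuous_map_Re[OF f]]) (simp add: order_trans[OF abs_Re_le_cmod B])
  moreover have "\<bar>mean (\<lambda>x. Im (f x)) - 0\<bar> \<le> B"
    by (rule mean_near[OF continuous_map_Im[OF f]]) (simp add: order_trans[OF abs_Im_le_cmod B])
  ultimately show ?thesis using cmod_le[of "cmean f"] by (simp add: cmean_def)
qed

end

section \<open>Matrices\<close>

abbreviation adj :: "complex mat \<Rightarrow> complex mat" where "adj \<equiv> mat_adjoint"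

lemma adj_dims [simp]: "dim_row (adj A) = dim_col A" "dim_col (adj A) = dim_row A"
  by (simp_all add: index_mat_adjoint)

lemma adj_index [simp]: "i < dim_col A \<Longrightarrow> j < dim_row A \<Longrightarrow> adj A $$ (i, j) = cnj (A $$ (j, i))"
  by (simp add: index_mat_adjoint)

lemma adj_carrier [simp]: "A \<in> carrier_mat n m \<Longrightarrow> adj A \<in> carrier_mat m n"
  by auto

lemma adj_adj [simp]: "adj (adj A) = A"
  by (rule eq_matI) auto

lemma adj_one [simp]: "adj (1\<^sub>m n) = 1\<^sub>m n"
  by (rule eq_matI) auto

lemma index_mult_mat_sum:
  "i < dim_row A \<Longrightarrow> j < dim_col B \<Longrightarrow> dim_col A = dim_row B \<Longrightarrow>
    (A * B) $$ (i, j) = (\<Sum>k<dim_row B. A $$ (i, k) * B $$ (k, j))"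
  by (simp add: scalar_prod_def lessThan_atLeast0)

lemma index_mult_mat_vec_sum:
  "i < dim_row A \<Longrightarrow> dim_col A = dim_vec v \<Longrightarrow>
    (A *\<^sub>v v) $ i = (\<Sum>k<dim_vec v. A $$ (i, k) * v $ k)"
  by (simp add: scalar_prod_def lessThan_atLeast0)

lemma adj_mult: "dim_col A = dim_row B \<Longrightarrow> adj (A * B) = adj B * adj A"
  by (rule eq_matI) (auto simp: index_mult_mat_sum mult.commute simp del: index_mult_mat(1))

text \<open>Conditions on dimensions, unlike membership in a carrier with hidden parameters, can be
  discharged during rewriting.\<close>

lemma mult_assoc_dim:
  fixes A B C :: "complex mat"
  shows "dim_col A = dim_row B \<Longrightarrow> dim_col B = dim_row C \<Longrightarrow> A * B * C = A * (B * C)"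
  by (rule assoc_mult_mat[of A "dim_row A" "dim_col A" B "dim_col B" C "dim_col C"]) auto

lemma mult_assoc_vec_dim:
  fixes A B :: "complex mat"
  shows "dim_col A = dim_row B \<Longrightarrow> dim_col B = dim_vec v \<Longrightarrow> A * B *\<^sub>v v = A *\<^sub>v (B *\<^sub>v v)"
  by (rule assoc_mult_mat_vec[of A "dim_row A" "dim_col A" B "dim_col B" v]) auto

lemma mult_one_dim [simp]:
  fixes A :: "complex mat"
  shows "dim_col A = n \<Longrightarrow> A * 1\<^sub>m n = A" "dim_row A = n \<Longrightarrow> 1\<^sub>m n * A = A"
  by (auto intro: eq_matI)

lemma mat_eqI_vec:
  fixes A B :: "complex mat"
  assumes "A \<in> carrier_mat n m" "B \<in> carrier_mat n m" "\<And>v. v \<in> carrier_vec m \<Longrightarrow> A *\<^sub>v v = B *\<^sub>v v"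
  shows "A = B"
proof (rule eq_matI)
  fix i j assume ij: "i < dim_row B" "j < dim_col B"
  have "(M *\<^sub>v unit_vec m j) $ i = M $$ (i, j)" if "M \<in> carrier_mat n m" for M :: "complex mat"
    using that ij assms(2) by (auto simp: scalar_prod_right_unit)
  from this[OF assms(1)] this[OF assms(2)] assms(3)[of "unit_vec m j"] show "A $$ (i, j) = B $$ (i, j)" by simp
qed (use assms in auto)

text \<open>Padded with zero rows, \<open>U\<close> would become a square isometry \<open>V\<close>,
  hence unitary; but then \<open>V * adj V\<close> would have a zero on its diagonal.\<close>

lemma isometry_columns_le:
  assumes U: "U \<in> carrier_mat n d" and iso: "adj U * U = 1\<^sub>m d" shows "d \<le> n"
proof (rule ccontr)
  assume "\<not> d \<le> n"
  then have n: "n < d" by simp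
  define V where "V = mat d d (\<lambda>(i, j). if i < n then U $$ (i, j) else 0)"
  have V: "V \<in> carrier_mat d d" by (simp add: V_def)
  have "adj V * V = 1\<^sub>m d"
  proof (rule eq_matI)
    fix i j assume "i < dim_row (1\<^sub>m d :: complex mat)" "j < dim_col (1\<^sub>m d :: complex mat)"
    then have ij: "i < d" "j < d" by auto
    have "(adj V * V) $$ (i, j) = (\<Sum>k<d. cnj (V $$ (k, i)) * V $$ (k, j))"
      using V ij by (subst index_mult_mat_sum) auto
    also have "\<dots> = (\<Sum>k<n. cnj (U $$ (k, i)) * U $$ (k, j))"
      using n ij by (intro sum.mono_neutral_cong_right) (auto simp: V_def)
    also have "\<dots> = (adj U * U) $$ (i, j)" using U ij by (subst index_mult_mat_sum) auto
    finally show "(adj V * V) $$ (i, j) = 1\<^sub>m d $$ (i, j)" using iso by simp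
  qed (simp_all add: V_def)
  then have "V * adj V = 1\<^sub>m d" using V by (intro mat_mult_left_right_inverse[of "adj V" d]) auto
  moreover have "(V * adj V) $$ (n, n) = 0"
    using V n by (subst index_mult_mat_sum) (auto simp: V_def)
  ultimately show False using n by simp
qed

section \<open>Subspaces\<close>

text \<open>A plain set-theoretic form of the notion of subspace, which reduces closure properties
  to membership goals.\<close>

definition lin_subspace :: "nat \<Rightarrow> complex vec set \<Rightarrow> bool" where
  "lin_subspace n S \<longleftrightarrow> S \<subseteq> carrier_vec n \<and> 0\<^sub>v n \<in> S \<and> (\<forall>v\<in>S. \<forall>w\<in>S. v + w \<in> S) \<and> (\<forall>c. \<forall>v\<in>S. c \<cdot>\<^sub>v v \<in> S)"

lemma subspace_iff_lin_subspace:
  "subspace class_ring S (module_vec TYPE(complex) n) \<longleftrightarrow> lin_subspace n S"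
proof
  assume "subspace class_ring S (module_vec TYPE(complex) n)"
  then interpret subspace class_ring S "module_vec TYPE(complex) n" .
  interpret submodule class_ring S "module_vec TYPE(complex) n" by (rule submod)
  show "lin_subspace n S"
    using subset zero_closed m_closed smult_closed
    by (auto simp: lin_subspace_def module_vec_simps class_ring_simps)
next
  assume S: "lin_subspace n S"
  have "submodule class_ring S (module_vec TYPE(complex) n)"
    by (rule submodule.intro) (use S vec_module in \<open>auto simp: lin_subspace_def module_vec_simps\<close>)
  then show "subspace class_ring S (module_vec TYPE(complex) n)"
    by (intro subspace.intro vec_vs)
qed

lemma invariant_subspace_iff:
  "invariant_subspace G X S \<longleftrightarrow> lin_subspace (rdim X) S \<and> (\<forall>g\<in>carrier G. \<forall>v\<in>S. rmat X g *\<^sub>v v \<in> S)"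
  by (simp add: invariant_subspace_def subspace_iff_lin_subspace)

lemma lin_subspace_kernel:
  fixes A :: "complex mat"
  assumes A: "A \<in> carrier_mat n m" shows "lin_subspace m {v \<in> carrier_vec m. A *\<^sub>v v = 0\<^sub>v n}"
  using A mult_add_distrib_mat_vec[OF A] mult_mat_vec[OF A] by (auto simp: lin_subspace_def)

definition append_col :: "complex mat \<Rightarrow> complex vec \<Rightarrow> complex mat" where
  "append_col U u = mat (dim_row U) (Suc (dim_col U)) (\<lambda>(i, j). if j < dim_col U then U $$ (i, j) else u $ i)"

lemma append_col_dims [simp]:
  "dim_row (append_col U u) = dim_row U" "dim_col (append_col U u) = Suc (dim_col U)"
  by (simp_all add: append_col_def)

lemma append_col_isometry:
  assumes U: "U \<in> carrier_mat n d" and iso: "adj U * U = 1\<^sub>m d"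
    and u: "u \<in> carrier_vec n" and orth: "adj U *\<^sub>v u = 0\<^sub>v d" and norm: "(\<Sum>k<n. cnj (u $ k) * u $ k) = 1"
  shows "adj (append_col U u) * append_col U u = 1\<^sub>m (Suc d)"
proof (rule eq_matI)
  have o1: "(\<Sum>k<n. cnj (U $$ (k, i)) * u $ k) = 0" if "i < d" for i
  proof -
    have "(adj U *\<^sub>v u) $ i = (\<Sum>k<n. cnj (U $$ (k, i)) * u $ k)"
      using U u that by (subst index_mult_mat_vec_sum) auto
    then show ?thesis using orth that by simp
  qed
  have o2: "(\<Sum>k<n. cnj (u $ k) * U $$ (k, i)) = 0" if "i < d" for i
    using arg_cong[OF o1[OF that], of cnj] by (simp add: mult.commute)
  have o3: "(\<Sum>k<n. cnj (U $$ (k, i)) * U $$ (k, j)) = (if i = j then 1 else 0)" if "i < d" "j < d" for i j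
  proof -
    have "(adj U * U) $$ (i, j) = (\<Sum>k<n. cnj (U $$ (k, i)) * U $$ (k, j))"
      using U that by (subst index_mult_mat_sum) auto
    then show ?thesis using iso that by simp
  qed
  fix i j assume "i < dim_row (1\<^sub>m (Suc d) :: complex mat)" "j < dim_col (1\<^sub>m (Suc d) :: complex mat)"
  then have ij: "i < Suc d" "j < Suc d" by auto
  have "(adj (append_col U u) * append_col U u) $$ (i, j)
      = (\<Sum>k<n. cnj (append_col U u $$ (k, i)) * append_col U u $$ (k, j))"
    using U ij by (subst index_mult_mat_sum) auto
  also have "\<dots> = (\<Sum>k<n. cnj (if i < d then U $$ (k, i) else u $ k) * (if j < d then U $$ (k, j) else u $ k))"
    using U ij by (intro sum.cong) (auto simp: append_col_def)
  also have "\<dots> = (if i = j then 1 else 0)"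
    using ij o1 o2 o3 norm by (cases "i < d"; cases "j < d") auto
  finally show "(adj (append_col U u) * append_col U u) $$ (i, j) = 1\<^sub>m (Suc d) $$ (i, j)" using ij by simp
qed (use U in auto)

lemma append_col_mult_vec:
  assumes U: "U \<in> carrier_mat n d" and u: "u \<in> carrier_vec n" and w: "w \<in> carrier_vec (Suc d)"
  shows "append_col U u *\<^sub>v w = U *\<^sub>v (vec d (\<lambda>i. w $ i)) + (w $ d) \<cdot>\<^sub>v u"
proof (rule eq_vecI)
  fix i assume "i < dim_vec (U *\<^sub>v (vec d (\<lambda>i. w $ i)) + (w $ d) \<cdot>\<^sub>v u)"
  then have i: "i < n" using u by auto
  have "(append_col U u *\<^sub>v w) $ i = (\<Sum>k<Suc d. append_col U u $$ (i, k) * w $ k)"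
    using U w i by (subst index_mult_mat_vec_sum) auto
  also have "\<dots> = (\<Sum>k<d. U $$ (i, k) * w $ k) + u $ i * w $ d"
    using U i by (simp add: append_col_def)
  also have "(\<Sum>k<d. U $$ (i, k) * w $ k) = (U *\<^sub>v (vec d (\<lambda>i. w $ i))) $ i"
    using U i by (subst index_mult_mat_vec_sum) auto
  finally show "(append_col U u *\<^sub>v w) $ i = (U *\<^sub>v (vec d (\<lambda>i. w $ i)) + (w $ d) \<cdot>\<^sub>v u) $ i"
    using U u i by simp
qed (use U u in auto)

text \<open>The columns of \<open>U\<close> are an orthonormal basis of \<open>S\<close>, taken as a
  longest orthonormal family. A vector of \<open>S\<close> not fixed by \<open>U * adj U\<close>
  would leave a residual that, normalized, gives one more column.\<close>

lemma ex_isometry_onto_subspace: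
  assumes S: "lin_subspace n S"
  shows "\<exists>d U. U \<in> carrier_mat n d \<and> adj U * U = 1\<^sub>m d \<and> (\<forall>w\<in>carrier_vec d. U *\<^sub>v w \<in> S)
    \<and> (\<forall>v\<in>S. U *\<^sub>v (adj U *\<^sub>v v) = v)"
proof -
  define P where "P d \<longleftrightarrow> (\<exists>U. U \<in> carrier_mat n d \<and> adj U * U = 1\<^sub>m d \<and> (\<forall>w\<in>carrier_vec d. U *\<^sub>v w \<in> S))" for d
  have SD: "\<And>v. v \<in> S \<Longrightarrow> v \<in> carrier_vec n" "0\<^sub>v n \<in> S" "\<And>v w. v \<in> S \<Longrightarrow> w \<in> S \<Longrightarrow> v + w \<in> S"
    "\<And>c v. v \<in> S \<Longrightarrow> c \<cdot>\<^sub>v v \<in> S" using S by (auto simp: lin_subspace_def)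
  have "P 0"
  proof -
    have "mat n 0 f *\<^sub>v w = 0\<^sub>v n" if "w \<in> carrier_vec 0" for f :: "nat \<times> nat \<Rightarrow> complex" and w
      using that by (intro eq_vecI) (auto simp: scalar_prod_def)
    then show ?thesis unfolding P_def using SD(2)
      by (intro exI[of _ "mat n 0 (\<lambda>_. 0)"]) (auto intro!: eq_matI)
  qed
  moreover have bound: "\<forall>d. P d \<longrightarrow> d < Suc n" using isometry_columns_le unfolding P_def by (meson le_imp_less_Suc)
  ultimately have "\<exists>d. P d \<and> (\<forall>d'. P d' \<longrightarrow> d' \<le> d)" by (rule ex_has_greatest_nat[where f = "\<lambda>d. d"])
  then obtain d where d: "P d" and max: "\<And>d'. P d' \<Longrightarrow> d' \<le> d" by blast
  from d obtain U where U: "U \<in> carrier_mat n d" and iso: "adj U * U = 1\<^sub>m d" and US: "\<forall>w\<in>carrier_vec d. U *\<^sub>v w \<in> S"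
    unfolding P_def by blast
  have "U *\<^sub>v (adj U *\<^sub>v v) = v" if v: "v \<in> S" for v
  proof (rule ccontr)
    assume neq: "U *\<^sub>v (adj U *\<^sub>v v) \<noteq> v"
    have vc: "v \<in> carrier_vec n" using SD(1)[OF v] .
    define r where "r = v + (-1) \<cdot>\<^sub>v (U *\<^sub>v (adj U *\<^sub>v v))"
    have pr: "adj U *\<^sub>v v \<in> carrier_vec d" by (rule mult_mat_vec_carrier[OF adj_carrier[OF U] vc])
    have Upr: "U *\<^sub>v (adj U *\<^sub>v v) \<in> carrier_vec n" by (rule mult_mat_vec_carrier[OF U pr])
    have rS: "r \<in> S" unfolding r_def using US pr v by (intro SD(3,4)) auto
    have rc: "r \<in> carrier_vec n" using SD(1)[OF rS] .
    have "adj U *\<^sub>v (U *\<^sub>v (adj U *\<^sub>v v)) = adj U *\<^sub>v v"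
      using U vc iso pr by (subst mult_assoc_vec_dim[symmetric]) auto
    then have r0: "adj U *\<^sub>v r = 0\<^sub>v d"
      unfolding r_def using U vc pr Upr
      by (subst mult_add_distrib_mat_vec[of _ d n]) (auto simp: mult_mat_vec[of _ d n])
    have "r \<noteq> 0\<^sub>v n"
    proof
      assume "r = 0\<^sub>v n"
      then have r0: "r $ i = 0" if "i < n" for i using that by simp
      have "U *\<^sub>v (adj U *\<^sub>v v) = v"
      proof (rule eq_vecI)
        fix i assume "i < dim_vec v"
        then have "i < n" using vc by simp
        then show "(U *\<^sub>v (adj U *\<^sub>v v)) $ i = v $ i"
          using r0[of i] vc U by (simp add: r_def)
      qed (use vc U in auto)
      then show False using neq by simp
    qed
    then obtain k where k: "k < n" "r $ k \<noteq> 0" using rc by (metis carrier_vecD eq_vecI index_zero_vec)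
    define N where "N = (\<Sum>k<n. (cmod (r $ k))\<^sup>2)"
    have N: "N > 0" unfolding N_def using k by (intro sum_pos2[of _ k]) auto
    define c where "c = complex_of_real (1 / sqrt N)"
    have cc: "cnj c * c = complex_of_real (1 / N)" using N by (simp add: c_def flip: of_real_mult)
    define u where "u = c \<cdot>\<^sub>v r"
    have uc: "u \<in> carrier_vec n" using rc by (simp add: u_def)
    have u0: "adj U *\<^sub>v u = 0\<^sub>v d" unfolding u_def using U rc r0 by (subst mult_mat_vec[of _ d n]) auto
    have "(\<Sum>k<n. cnj (u $ k) * u $ k) = (\<Sum>k<n. complex_of_real (1 / N) * complex_of_real ((cmod (r $ k))\<^sup>2))"
    proof (intro sum.cong refl)
      fix k assume "k \<in> {..<n}"
      then have "cnj (u $ k) * u $ k = (cnj c * c) * (r $ k * cnj (r $ k))" using rc by (simp add: u_def)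
      then show "cnj (u $ k) * u $ k = complex_of_real (1 / N) * complex_of_real ((cmod (r $ k))\<^sup>2)"
        unfolding cc complex_norm_square .
    qed
    also have "\<dots> = complex_of_real (1 / N * N)" unfolding N_def by (simp add: sum_distrib_left)
    also have "\<dots> = 1" using N by simp
    finally have "adj (append_col U u) * append_col U u = 1\<^sub>m (Suc d)"
      by (intro append_col_isometry[OF U iso uc u0])
    moreover have "append_col U u \<in> carrier_mat n (Suc d)" using U by auto
    moreover have "\<forall>w\<in>carrier_vec (Suc d). append_col U u *\<^sub>v w \<in> S"
      using US rS append_col_mult_vec[OF U uc] by (auto simp: u_def intro!: SD(3,4))
    ultimately have "P (Suc d)" unfolding P_def by blast
    then show False using max[of "Suc d"] by simp
  qed
  then show ?thesis using U iso US by blast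
qed

lemma isometry_inj:
  assumes "U \<in> carrier_mat n d" "adj U * U = 1\<^sub>m d" "w \<in> carrier_vec d" "U *\<^sub>v w = 0\<^sub>v n"
  shows "w = 0\<^sub>v d"
proof -
  have "w = adj U *\<^sub>v (U *\<^sub>v w)" using assms by (subst mult_assoc_vec_dim[symmetric]) auto
  then show ?thesis using assms by auto
qed

section \<open>Unitary representations\<close>

context compact_group
begin

lemma unitary_repD:
  assumes "unitary_rep G T X"
  shows "g \<in> carrier G \<Longrightarrow> rmat X g \<in> carrier_mat (rdim X) (rdim X)"
    and "g \<in> carrier G \<Longrightarrow> adj (rmat X g) * rmat X g = 1\<^sub>m (rdim X)"
    and "g \<in> carrier G \<Longrightarrow> h \<in> carrier G \<Longrightarrow> rmat X (g \<otimes> h) = rmat X g * rmat X h"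
    and "i < rdim X \<Longrightarrow> j < rdim X \<Longrightarrow> continuous_map T euclidean (\<lambda>g. rmat X g $$ (i, j))"
  using assms by (auto simp: unitary_rep_def)

lemma unitary_rep_adj:
  assumes X: "unitary_rep G T X" and g: "g \<in> carrier G"
  shows "rmat X g * adj (rmat X g) = 1\<^sub>m (rdim X)"
  using unitary_repD(1,2)[OF X g] by (intro mat_mult_left_right_inverse[of "adj (rmat X g)" "rdim X"]) auto

text \<open>The matrix at the identity is both idempotent and unitary, and cancelling its adjoint
  leaves the unit matrix.\<close>

lemma rmat_one:
  assumes X: "unitary_rep G T X" shows "rmat X \<one> = 1\<^sub>m (rdim X)"
proof -
  let ?E = "rmat X \<one>"
  have E: "?E \<in> carrier_mat (rdim X) (rdim X)" using unitary_repD(1)[OF X] by simp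
  have "?E = adj ?E * ?E * ?E" using E unitary_repD(2)[OF X one_closed] by simp
  also have "\<dots> = adj ?E * (?E * ?E)" using E by (intro mult_assoc_dim) auto
  also have "?E * ?E = ?E" using unitary_repD(3)[OF X one_closed one_closed] by simp
  finally show ?thesis using unitary_repD(2)[OF X one_closed] by simp
qed

lemma rmat_inv:
  assumes X: "unitary_rep G T X" and g: "g \<in> carrier G" shows "rmat X (inv g) = adj (rmat X g)"
proof -
  let ?A = "rmat X g" and ?B = "rmat X (inv g)"
  have AB: "?A \<in> carrier_mat (rdim X) (rdim X)" "?B \<in> carrier_mat (rdim X) (rdim X)"
    using unitary_repD(1)[OF X] g by auto
  have "?B = adj ?A * ?A * ?B" using AB unitary_repD(2)[OF X g] by simp
  also have "\<dots> = adj ?A * (?A * ?B)" using AB by (intro mult_assoc_dim) auto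
  also have "?A * ?B = 1\<^sub>m (rdim X)" using unitary_repD(3)[OF X g, of "inv g"] g rmat_one[OF X] by simp
  finally show ?thesis using AB by simp
qed

text \<open>An intertwiner with trivial kernel suffices, because its image is the required invariant
  subspace.\<close>

lemma containedI:
  assumes A: "A \<in> carrier_mat (rdim W) (rdim Z)"
    and tw: "\<And>g. g \<in> carrier G \<Longrightarrow> A * rmat Z g = rmat W g * A"
    and inj: "\<And>v. v \<in> carrier_vec (rdim Z) \<Longrightarrow> A *\<^sub>v v = 0\<^sub>v (rdim W) \<Longrightarrow> v = 0\<^sub>v (rdim Z)"
    and Z: "unitary_rep G T Z" and W: "unitary_rep G T W"
  shows "contained G Z W"
  unfolding contained_def
proof (intro exI conjI bexI[of _ A])
  let ?S = "(\<lambda>v. A *\<^sub>v v) ` carrier_vec (rdim Z)"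
  have "inj_on (\<lambda>v. A *\<^sub>v v) (carrier_vec (rdim Z))"
  proof (rule inj_onI)
    fix v w assume vw: "v \<in> carrier_vec (rdim Z)" "w \<in> carrier_vec (rdim Z)" "A *\<^sub>v v = A *\<^sub>v w"
    have "A *\<^sub>v (v - w) = 0\<^sub>v (rdim W)"
      using vw A by (subst mult_minus_distrib_mat_vec[OF A]) auto
    then have d0: "v - w = 0\<^sub>v (rdim Z)" using vw by (intro inj) auto
    show "v = w"
    proof (rule eq_vecI)
      fix i assume "i < dim_vec w"
      then show "v $ i = w $ i" using arg_cong[OF d0, of "\<lambda>u. u $ i"] vw by simp
    qed (use vw in auto)
  qed
  then show "bij_betw (\<lambda>v. A *\<^sub>v v) (carrier_vec (rdim Z)) ?S" by (rule bij_betw_imageI) simp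
  show "invariant_subspace G W ?S"
    unfolding invariant_subspace_iff lin_subspace_def
  proof (intro conjI ballI allI)
    show "?S \<subseteq> carrier_vec (rdim W)" using A by auto
    show "0\<^sub>v (rdim W) \<in> ?S" using A by (intro image_eqI[of _ _ "0\<^sub>v (rdim Z)"]) auto
  next
    fix v w assume "v \<in> ?S" "w \<in> ?S"
    then obtain v' w' where "v' \<in> carrier_vec (rdim Z)" "w' \<in> carrier_vec (rdim Z)" "v = A *\<^sub>v v'" "w = A *\<^sub>v w'" by blast
    then show "v + w \<in> ?S"
      using mult_add_distrib_mat_vec[OF A] by (intro image_eqI[of _ _ "v' + w'"]) auto
  next
    fix c v assume "v \<in> ?S"
    then obtain v' where "v' \<in> carrier_vec (rdim Z)" "v = A *\<^sub>v v'" by blast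
    then show "c \<cdot>\<^sub>v v \<in> ?S"
      using mult_mat_vec[OF A] by (intro image_eqI[of _ _ "c \<cdot>\<^sub>v v'"]) auto
  next
    fix g v assume g: "g \<in> carrier G" and "v \<in> ?S"
    then obtain v' where v': "v' \<in> carrier_vec (rdim Z)" "v = A *\<^sub>v v'" by blast
    note c = unitary_repD(1)[OF Z g] unitary_repD(1)[OF W g]
    have "rmat W g *\<^sub>v v = (rmat W g * A) *\<^sub>v v'" using v' c A by (simp add: mult_assoc_vec_dim)
    also have "\<dots> = A *\<^sub>v (rmat Z g *\<^sub>v v')" using tw[OF g] v' c A by (simp add: mult_assoc_vec_dim flip: tw[OF g])
    finally show "rmat W g *\<^sub>v v \<in> ?S" using c v' by (intro image_eqI[of _ _ "rmat Z g *\<^sub>v v'"]) auto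
  qed
qed (use A tw in auto)

lemma containedE:
  assumes "contained G Z W"
  obtains A where "A \<in> carrier_mat (rdim W) (rdim Z)"
    "\<And>g. g \<in> carrier G \<Longrightarrow> A * rmat Z g = rmat W g * A"
    "\<And>v. v \<in> carrier_vec (rdim Z) \<Longrightarrow> A *\<^sub>v v = 0\<^sub>v (rdim W) \<Longrightarrow> v = 0\<^sub>v (rdim Z)"
proof -
  from assms obtain S A where A: "A \<in> carrier_mat (rdim W) (rdim Z)"
    "bij_betw (\<lambda>v. A *\<^sub>v v) (carrier_vec (rdim Z)) S" "\<forall>g\<in>carrier G. A * rmat Z g = rmat W g * A"
    unfolding contained_def by blast
  have "v = 0\<^sub>v (rdim Z)" if "v \<in> carrier_vec (rdim Z)" "A *\<^sub>v v = 0\<^sub>v (rdim W)" for v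
  proof -
    have "A *\<^sub>v 0\<^sub>v (rdim Z) = 0\<^sub>v (rdim W)" using A(1) by auto
    then show ?thesis using inj_onD[OF bij_betw_imp_inj_on[OF A(2)], of v "0\<^sub>v (rdim Z)"] that by simp
  qed
  with A show ?thesis by (intro that[of A]) auto
qed

lemma contained_refl: "unitary_rep G T X \<Longrightarrow> contained G X X"
  by (rule containedI[of "1\<^sub>m (rdim X)"]) (auto dest: unitary_repD(1))

lemma contained_trans_isometry:
  assumes ZX: "contained G Z X" and Z: "unitary_rep G T Z" and X: "unitary_rep G T X" and W: "unitary_rep G T W"
    and U: "U \<in> carrier_mat (rdim W) (rdim X)" "adj U * U = 1\<^sub>m (rdim X)"
    and tw: "\<And>g. g \<in> carrier G \<Longrightarrow> U * rmat X g = rmat W g * U"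
  shows "contained G Z W"
proof -
  obtain A where A: "A \<in> carrier_mat (rdim X) (rdim Z)"
    "\<And>g. g \<in> carrier G \<Longrightarrow> A * rmat Z g = rmat X g * A"
    "\<And>v. v \<in> carrier_vec (rdim Z) \<Longrightarrow> A *\<^sub>v v = 0\<^sub>v (rdim X) \<Longrightarrow> v = 0\<^sub>v (rdim Z)"
    using containedE[OF ZX] by metis
  show ?thesis
  proof (rule containedI[OF _ _ _ Z W])
    show "U * A \<in> carrier_mat (rdim W) (rdim Z)" using U A by auto
    fix g assume g: "g \<in> carrier G"
    note c = unitary_repD(1)[OF Z g] unitary_repD(1)[OF W g] unitary_repD(1)[OF X g]
    have "U * A * rmat Z g = U * (rmat X g * A)" using U(1) A(1) c by (simp add: mult_assoc_dim A(2)[OF g])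
    also have "\<dots> = rmat W g * U * A" using U(1) A(1) c by (simp add: mult_assoc_dim flip: tw[OF g])
    finally show "U * A * rmat Z g = rmat W g * (U * A)" using U(1) A(1) c by (simp add: mult_assoc_dim)
  next
    fix v assume v: "v \<in> carrier_vec (rdim Z)" "U * A *\<^sub>v v = 0\<^sub>v (rdim W)"
    then have "U *\<^sub>v (A *\<^sub>v v) = 0\<^sub>v (rdim W)" using U(1) A(1) by (simp add: mult_assoc_vec_dim)
    then have "A *\<^sub>v v = 0\<^sub>v (rdim X)" using U A(1) v(1) by (intro isometry_inj[OF U]) auto
    then show "v = 0\<^sub>v (rdim Z)" using A(3) v(1) by simp
  qed
qed

text \<open>The compression of \<open>W\<close> to the range of \<open>U\<close>, in the basis of
  the columns of \<open>U\<close>. It is multiplicative when that range is invariant, which the next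
  lemma expresses by saying that \<open>U * adj U\<close> fixes \<open>rmat W g * U\<close>.\<close>

definition restrict_rep :: "'a rep \<Rightarrow> complex mat \<Rightarrow> 'a rep" where
  "restrict_rep W U = Rep (dim_col U) (\<lambda>g. adj U * rmat W g * U)"

lemma restrict_rep:
  assumes W: "unitary_rep G T W" and U: "U \<in> carrier_mat (rdim W) d" "adj U * U = 1\<^sub>m d"
    and inv: "\<And>g. g \<in> carrier G \<Longrightarrow> U * (adj U * (rmat W g * U)) = rmat W g * U"
  shows "unitary_rep G T (restrict_rep W U)"
    and "g \<in> carrier G \<Longrightarrow> U * rmat (restrict_rep W U) g = rmat W g * U"
proof -
  have dims: "dim_row U = rdim W" "dim_col U = d" using U by auto
  have c: "dim_row (rmat W g) = rdim W" "dim_col (rmat W g) = rdim W" if "g \<in> carrier G" for g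
    using unitary_repD(1)[OF W that] by auto
  show tw: "U * rmat (restrict_rep W U) g = rmat W g * U" if g: "g \<in> carrier G" for g
    using inv[OF g] c[OF g] by (simp add: restrict_rep_def mult_assoc_dim dims)
  show "unitary_rep G T (restrict_rep W U)"
    unfolding unitary_rep_def
  proof (intro conjI ballI allI impI)
    fix g assume g: "g \<in> carrier G"
    show "rmat (restrict_rep W U) g \<in> carrier_mat (rdim (restrict_rep W U)) (rdim (restrict_rep W U))"
      using c[OF g] by (auto simp: restrict_rep_def dims)
    have "adj (adj U * rmat W g * U) * (adj U * rmat W g * U)
        = adj U * (adj (rmat W g) * (U * (adj U * (rmat W g * U))))"
      using c[OF g] by (simp add: adj_mult mult_assoc_dim dims)
    also have "\<dots> = adj U * (adj (rmat W g) * rmat W g * U)"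
      unfolding inv[OF g] using c[OF g] by (simp add: mult_assoc_dim dims)
    also have "\<dots> = 1\<^sub>m d" using U unitary_repD(2)[OF W g] by (simp add: dims)
    finally show "adj (rmat (restrict_rep W U) g) * rmat (restrict_rep W U) g = 1\<^sub>m (rdim (restrict_rep W U))"
      by (simp add: restrict_rep_def dims)
    fix h assume h: "h \<in> carrier G"
    have "adj U * rmat W g * U * (adj U * rmat W h * U) = adj U * (rmat W g * (U * (adj U * (rmat W h * U))))"
      using c[OF g] c[OF h] by (simp add: mult_assoc_dim dims)
    also have "\<dots> = adj U * (rmat W g * rmat W h) * U"
      unfolding inv[OF h] using c[OF g] c[OF h] by (simp add: mult_assoc_dim dims)
    finally show "rmat (restrict_rep W U) (g \<otimes> h) = rmat (restrict_rep W U) g * rmat (restrict_rep W U) h"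
      using unitary_repD(3)[OF W g h] by (simp add: restrict_rep_def)
  next
    fix i j assume "i < rdim (restrict_rep W U)" "j < rdim (restrict_rep W U)"
    then have ij: "i < d" "j < d" by (auto simp: restrict_rep_def dims)
    have "continuous_map T euclidean (\<lambda>g. \<Sum>l<rdim W. (\<Sum>k<rdim W. cnj (U $$ (k, i)) * rmat W g $$ (k, l)) * U $$ (l, j))"
      using unitary_repD(4)[OF W] by (intro ccont_sum continuous_map_complex_mult) auto
    then show "continuous_map T euclidean (\<lambda>g. rmat (restrict_rep W U) g $$ (i, j))"
    proof (rule continuous_map_eq)
      fix g assume "g \<in> topspace T"
      then have g: "g \<in> carrier G" by (simp add: topspace_eq)
      show "(\<Sum>l<rdim W. (\<Sum>k<rdim W. cnj (U $$ (k, i)) * rmat W g $$ (k, l)) * U $$ (l, j))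
          = rmat (restrict_rep W U) g $$ (i, j)"
        using ij c[OF g] by (simp add: restrict_rep_def index_mult_mat_sum dims del: index_mult_mat(1))
    qed
  qed
qed

end

lemma zero_mat_mult_vec [simp]: "v \<in> carrier_vec m \<Longrightarrow> 0\<^sub>m n m *\<^sub>v v = (0\<^sub>v n :: complex vec)"
  by (rule eq_vecI) (auto simp: scalar_prod_def)

lemma scalar_mat_mult_vec: "v \<in> carrier_vec n \<Longrightarrow> (c \<cdot>\<^sub>m 1\<^sub>m n) *\<^sub>v v = (c :: complex) \<cdot>\<^sub>v v"
  by (rule eq_vecI) auto

lemma scalar_mat_commute:
  fixes M :: "complex mat"
  assumes "M \<in> carrier_mat n n" shows "(c \<cdot>\<^sub>m 1\<^sub>m n) * M = M * (c \<cdot>\<^sub>m 1\<^sub>m n)"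
  using assms mult_smult_distrib[of M n n "1\<^sub>m n" n c] mult_smult_assoc_mat[of "1\<^sub>m n" n n M n c] by simp

section \<open>Decomposition into irreducible representations\<close>

context compact_group
begin

lemma irrepsD:
  assumes "X \<in> irreps G T"
  shows "unitary_rep G T X" "rdim X > 0"
    "invariant_subspace G X S \<Longrightarrow> S = {0\<^sub>v (rdim X)} \<or> S = carrier_vec (rdim X)"
  using assms by (auto simp: irreps_def)

text \<open>The linear span of the coefficients of irreducible representations satisfying
  \<open>P\<close>, built by adding one multiple at a time. Both clauses constrain \<open>h\<close>
  on the carrier only, since representing matrices are arbitrary outside it.\<close>

inductive_set coef_span :: "('a rep \<Rightarrow> bool) \<Rightarrow> ('a \<Rightarrow> complex) set" for P where
  zero: "\<forall>g\<in>carrier G. h g = 0 \<Longrightarrow> h \<in> coef_span P"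
| step: "f \<in> coef_span P \<Longrightarrow> X \<in> irreps G T \<Longrightarrow> P X \<Longrightarrow> i < rdim X \<Longrightarrow> j < rdim X \<Longrightarrow>
    \<forall>g\<in>carrier G. h g = f g + c * rmat X g $$ (i, j) \<Longrightarrow> h \<in> coef_span P"

lemma coef_span_cong:
  assumes "f \<in> coef_span P" "\<forall>g\<in>carrier G. h g = f g" shows "h \<in> coef_span P"
  using assms
proof (cases rule: coef_span.cases)
  case zero
  with assms(2) show ?thesis by (intro coef_span.zero) auto
next
  case (step f' X i j c)
  with assms(2) show ?thesis by (intro coef_span.step[OF step(1-5), of _ c]) auto
qed

lemma coef_span_coef:
  assumes "X \<in> irreps G T" "P X" "i < rdim X" "j < rdim X"
  shows "(\<lambda>g. rmat X g $$ (i, j)) \<in> coef_span P"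
proof (rule coef_span.step)
  show "(\<lambda>_. 0) \<in> coef_span P" by (rule coef_span.zero) simp
  show "\<forall>g\<in>carrier G. rmat X g $$ (i, j) = 0 + 1 * rmat X g $$ (i, j)" by simp
qed (use assms in auto)

lemma coef_span_add:
  assumes f: "f \<in> coef_span P" and h: "h \<in> coef_span P" shows "(\<lambda>g. f g + h g) \<in> coef_span P"
  using h
proof (induction h rule: coef_span.induct)
  case (zero h)
  then show ?case by (intro coef_span_cong[OF f]) simp
next
  case (step f' X i j h c)
  show ?case by (rule coef_span.step[where c = c, OF step(7) step(2-5)]) (use step(6) in simp)
qed

lemma coef_span_scale:
  assumes f: "f \<in> coef_span P" shows "(\<lambda>g. c * f g) \<in> coef_span P"
  using f
proof (induction f rule: coef_span.induct)
  case (zero h)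
  then show ?case by (intro coef_span.zero) simp
next
  case (step f X i j h d)
  show ?case by (rule coef_span.step[OF step(7) step(2-5), of _ "c * d"]) (use step(6) in \<open>simp add: ring_distribs\<close>)
qed

lemma coef_span_sum:
  "(\<And>i. i \<in> I \<Longrightarrow> f i \<in> coef_span P) \<Longrightarrow> (\<lambda>g. \<Sum>i\<in>I. f i g) \<in> coef_span P"
  by (induction I rule: infinite_finite_induct) (auto intro: coef_span.zero coef_span_add)

lemma ccont_coef_span:
  assumes "f \<in> coef_span P" shows "ccont f"
  using assms
proof (induction f rule: coef_span.induct)
  case (zero h)
  have "ccont (\<lambda>_. 0)" by simp
  then show ?case by (rule continuous_map_eq) (use zero in \<open>simp add: topspace_eq\<close>)
next
  case (step f X i j h c)
  have "ccont (\<lambda>g. f g + c * rmat X g $$ (i, j))"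
    by (intro continuous_map_add continuous_map_complex_mult step(7) unitary_repD(4)[OF irrepsD(1)[OF step(2)]] step(4,5)) simp
  then show ?case by (rule continuous_map_eq) (use step(6) in \<open>simp add: topspace_eq\<close>)
qed

section \<open>Complete reducibility\<close>

lemma invariant_splitting:
  assumes W: "unitary_rep G T W" and S: "invariant_subspace G W S"
    and S0: "S \<noteq> {0\<^sub>v (rdim W)}" and S1: "S \<noteq> carrier_vec (rdim W)"
  obtains d U e V where "U \<in> carrier_mat (rdim W) d" "adj U * U = 1\<^sub>m d" "d < rdim W"
    "\<And>g. g \<in> carrier G \<Longrightarrow> U * (adj U * (rmat W g * U)) = rmat W g * U"
    "V \<in> carrier_mat (rdim W) e" "adj V * V = 1\<^sub>m e" "e < rdim W"
    "\<And>g. g \<in> carrier G \<Longrightarrow> V * (adj V * (rmat W g * V)) = rmat W g * V"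
    "U * adj U + V * adj V = 1\<^sub>m (rdim W)"
proof -
  define n where "n = rdim W"
  have Wc: "rmat W g \<in> carrier_mat n n" if "g \<in> carrier G" for g
    using unitary_repD(1)[OF W that] by (simp add: n_def)
  note Wd = carrier_matD[OF Wc]
  have S: "lin_subspace n S" and Sinv: "\<And>g v. g \<in> carrier G \<Longrightarrow> v \<in> S \<Longrightarrow> rmat W g *\<^sub>v v \<in> S"
    using S by (auto simp: invariant_subspace_iff n_def)
  have Sc: "v \<in> carrier_vec n" if "v \<in> S" for v using S that by (auto simp: lin_subspace_def)
  obtain d U where U: "U \<in> carrier_mat n d" "adj U * U = 1\<^sub>m d" and US: "\<forall>w\<in>carrier_vec d. U *\<^sub>v w \<in> S"
    and SU: "\<forall>v\<in>S. U *\<^sub>v (adj U *\<^sub>v v) = v" using ex_isometry_onto_subspace[OF S] by blast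
  note Ud = carrier_matD[OF U(1)]
  \<comment> \<open>The kernel of \<open>adj U\<close> is the orthogonal complement of
    \<open>S\<close>.\<close>
  define R where "R = {v \<in> carrier_vec n. adj U *\<^sub>v v = 0\<^sub>v d}"
  have R: "lin_subspace n R"
    unfolding R_def by (rule lin_subspace_kernel[OF adj_carrier[OF U(1)]])
  obtain e V where V: "V \<in> carrier_mat n e" "adj V * V = 1\<^sub>m e" and VR: "\<forall>w\<in>carrier_vec e. V *\<^sub>v w \<in> R"
    and RV: "\<forall>v\<in>R. V *\<^sub>v (adj V *\<^sub>v v) = v" using ex_isometry_onto_subspace[OF R] by blast
  note Vd = carrier_matD[OF V(1)]
  have invU: "U * (adj U * (rmat W g * U)) = rmat W g * U" if g: "g \<in> carrier G" for g
  proof (rule mat_eqI_vec)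
    fix w :: "complex vec" assume w: "w \<in> carrier_vec d"
    have "rmat W g *\<^sub>v (U *\<^sub>v w) \<in> S" using US w by (intro Sinv g) auto
    then show "U * (adj U * (rmat W g * U)) *\<^sub>v w = rmat W g * U *\<^sub>v w"
      using SU w Wd[OF g] by (simp add: mult_assoc_vec_dim Ud)
  qed (use U Wc[OF g] in auto)
  have R_inv: "rmat W g *\<^sub>v v \<in> R" if g: "g \<in> carrier G" and v: "v \<in> R" for g v
  proof -
    have v': "v \<in> carrier_vec n" "adj U *\<^sub>v v = 0\<^sub>v d" using v by (auto simp: R_def)
    \<comment> \<open>The block of \<open>inv g\<close> on \<open>S\<close>. Taking adjoints in the
      invariance equation at \<open>inv g\<close> gives
      \<open>adj U * rmat W g = adj M * adj U\<close>, so \<open>g\<close> preserves the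
      complement.\<close>
    define M where "M = adj U * (rmat W (inv g) * U)"
    have Md: "dim_row M = d" "dim_col M = d" by (simp_all add: M_def Ud)
    have "adj (rmat W (inv g) * U) = adj (U * M)" using invU[of "inv g"] g by (simp add: M_def)
    then have eq: "adj U * rmat W g = adj M * adj U"
      using rmat_inv[OF W g] Wd[OF g] by (simp add: adj_mult Ud Md)
    have "adj U *\<^sub>v (rmat W g *\<^sub>v v) = (adj U * rmat W g) *\<^sub>v v"
      using v'(1) Wd[OF g] by (simp add: mult_assoc_vec_dim Ud)
    also have "\<dots> = adj M *\<^sub>v (adj U *\<^sub>v v)" unfolding eq using v'(1) by (simp add: mult_assoc_vec_dim Ud Md)
    also have "\<dots> = 0\<^sub>v d" unfolding v'(2) using Md by (intro eq_vecI) (auto simp: scalar_prod_def)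
    finally show ?thesis using Wc[OF g] v'(1) by (auto simp: R_def)
  qed
  have invV: "V * (adj V * (rmat W g * V)) = rmat W g * V" if g: "g \<in> carrier G" for g
  proof (rule mat_eqI_vec)
    fix w :: "complex vec" assume w: "w \<in> carrier_vec e"
    have "rmat W g *\<^sub>v (V *\<^sub>v w) \<in> R" using VR w by (intro R_inv g) auto
    then show "V * (adj V * (rmat W g * V)) *\<^sub>v w = rmat W g * V *\<^sub>v w"
      using RV w Wd[OF g] by (simp add: mult_assoc_vec_dim Vd)
  qed (use V Wc[OF g] in auto)
  have UV: "adj U * V = 0\<^sub>m d e"
  proof (rule mat_eqI_vec)
    fix w :: "complex vec" assume w: "w \<in> carrier_vec e"
    then have "V *\<^sub>v w \<in> R" using VR by auto
    then show "adj U * V *\<^sub>v w = 0\<^sub>m d e *\<^sub>v w" using w by (simp add: mult_assoc_vec_dim Ud Vd R_def)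
  qed (use U V in auto)
  have VU: "adj V * U = 0\<^sub>m e d"
  proof -
    have "adj V * U = adj (adj U * V)" by (simp add: adj_mult Ud Vd)
    also have "\<dots> = 0\<^sub>m e d" unfolding UV by (rule eq_matI) auto
    finally show ?thesis .
  qed
  have complete: "U * adj U + V * adj V = 1\<^sub>m n"
  proof (rule mat_eqI_vec)
    fix v :: "complex vec" assume v: "v \<in> carrier_vec n"
    have c1: "adj U *\<^sub>v v \<in> carrier_vec d" by (rule mult_mat_vec_carrier[OF adj_carrier[OF U(1)] v])
    have c2: "U *\<^sub>v (adj U *\<^sub>v v) \<in> carrier_vec n" by (rule mult_mat_vec_carrier[OF U(1) c1])
    define r where "r = v - U *\<^sub>v (adj U *\<^sub>v v)"
    have r: "r \<in> carrier_vec n" using v c2 by (simp add: r_def)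
    have "adj U *\<^sub>v (U *\<^sub>v (adj U *\<^sub>v v)) = adj U *\<^sub>v v"
      using U(2) v c1 by (subst mult_assoc_vec_dim[symmetric]) (auto simp: Ud)
    then have "adj U *\<^sub>v r = 0\<^sub>v d"
      unfolding r_def using mult_minus_distrib_mat_vec[OF adj_carrier[OF U(1)] v c2] c1 by auto
    then have "V *\<^sub>v (adj V *\<^sub>v r) = r" using RV r by (auto simp: R_def)
    moreover have "adj V *\<^sub>v r = adj V *\<^sub>v v"
    proof -
      have "adj V *\<^sub>v (U *\<^sub>v (adj U *\<^sub>v v)) = (adj V * U) *\<^sub>v (adj U *\<^sub>v v)"
        using c1 by (subst mult_assoc_vec_dim) (auto simp: Ud Vd)
      also have "\<dots> = 0\<^sub>v e" unfolding VU using c1 by simp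
      finally show ?thesis
        unfolding r_def using mult_minus_distrib_mat_vec[OF adj_carrier[OF V(1)] v c2]
          mult_mat_vec_carrier[OF adj_carrier[OF V(1)] v] by auto
    qed
    ultimately have Vv: "V *\<^sub>v (adj V *\<^sub>v v) = v - U *\<^sub>v (adj U *\<^sub>v v)" by (simp add: r_def)
    have "(U * adj U + V * adj V) *\<^sub>v v = U * adj U *\<^sub>v v + V * adj V *\<^sub>v v"
      using v U V by (intro add_mult_distrib_mat_vec[of _ n n]) auto
    also have "\<dots> = U *\<^sub>v (adj U *\<^sub>v v) + (v - U *\<^sub>v (adj U *\<^sub>v v))"
      using v Vv by (simp add: mult_assoc_vec_dim Ud Vd)
    also have "\<dots> = v"
    proof (rule eq_vecI)
      fix i assume "i < dim_vec v"
      then show "(U *\<^sub>v (adj U *\<^sub>v v) + (v - U *\<^sub>v (adj U *\<^sub>v v))) $ i = v $ i"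
        using v Ud(1) by simp
    qed (use v Ud(1) in simp)
    finally show "(U * adj U + V * adj V) *\<^sub>v v = 1\<^sub>m n *\<^sub>v v" using v by simp
  qed (use U V in auto)
  \<comment> \<open>An isometry with \<open>n\<close> columns is unitary: \<open>d = n\<close> would
    make \<open>S\<close> the whole space, and \<open>e = n\<close> below would make its complement
    the whole space. Both dimensions thus drop, as the induction on dimension requires.\<close>
  have d: "d < n"
  proof (rule ccontr)
    assume "\<not> d < n"
    then have "d = n" using isometry_columns_le[OF U] by simp
    then have one: "U * adj U = 1\<^sub>m n" using U by (intro mat_mult_left_right_inverse[of "adj U"]) auto
    have "v \<in> S" if v: "v \<in> carrier_vec n" for v
    proof -
      have "v = U *\<^sub>v (adj U *\<^sub>v v)" using v by (simp add: one Ud flip: mult_assoc_vec_dim)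
      then show ?thesis using US mult_mat_vec_carrier[OF adj_carrier[OF U(1)] v] by metis
    qed
    then show False using S1 Sc by (auto simp: n_def)
  qed
  have e: "e < n"
  proof (rule ccontr)
    assume "\<not> e < n"
    then have "e = n" using isometry_columns_le[OF V] by simp
    then have one: "V * adj V = 1\<^sub>m n" using V by (intro mat_mult_left_right_inverse[of "adj V"]) auto
    have "v = 0\<^sub>v n" if v: "v \<in> S" for v
    proof -
      have vc: "v \<in> carrier_vec n" using Sc[OF v] .
      have "v = V *\<^sub>v (adj V *\<^sub>v v)" using vc by (simp add: one Vd flip: mult_assoc_vec_dim)
      then have "v \<in> R" using VR mult_mat_vec_carrier[OF adj_carrier[OF V(1)] vc] by metis
      then have "U *\<^sub>v (adj U *\<^sub>v v) = 0\<^sub>v n" using U by (auto simp: R_def)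
      then show ?thesis using SU v by simp
    qed
    then show False using S0 S by (auto simp: n_def lin_subspace_def)
  qed
  show ?thesis by (rule that[OF U[unfolded n_def] d[unfolded n_def] invU V[unfolded n_def] e[unfolded n_def] invV complete[unfolded n_def]])
qed

text \<open>Complete reducibility in terms of coefficients: by the splitting,
  \<open>rmat W g\<close> is a sum of two compressions to smaller spaces, conjugated back by
  constant matrices. Irreducible constituents of the parts are contained in \<open>W\<close>, so
  \<open>P\<close> remains available in the induction.\<close>

theorem coef_in_coef_span:
  assumes "unitary_rep G T W" "\<And>Z. Z \<in> irreps G T \<Longrightarrow> contained G Z W \<Longrightarrow> P Z"
    and "i < rdim W" "j < rdim W"
  shows "(\<lambda>g. rmat W g $$ (i, j)) \<in> coef_span P"
  using assms
proof (induction "rdim W" arbitrary: W i j rule: less_induct)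
  case less
  note W = less.prems(1)
  show ?case
  proof (cases "W \<in> irreps G T")
    case True
    then show ?thesis using less.prems contained_refl[OF W] by (intro coef_span_coef) auto
  next
    case False
    then obtain S where "invariant_subspace G W S" "S \<noteq> {0\<^sub>v (rdim W)}" "S \<noteq> carrier_vec (rdim W)"
      using W less.prems(3) by (auto simp: irreps_def)
    from invariant_splitting[OF W this] obtain d U e V where
      U: "U \<in> carrier_mat (rdim W) d" "adj U * U = 1\<^sub>m d" "d < rdim W"
      and invU: "\<And>g. g \<in> carrier G \<Longrightarrow> U * (adj U * (rmat W g * U)) = rmat W g * U"
      and V: "V \<in> carrier_mat (rdim W) e" "adj V * V = 1\<^sub>m e" "e < rdim W"
      and invV: "\<And>g. g \<in> carrier G \<Longrightarrow> V * (adj V * (rmat W g * V)) = rmat W g * V"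
      and complete: "U * adj U + V * adj V = 1\<^sub>m (rdim W)" by metis
    have part: "(\<lambda>g. (U * rmat (restrict_rep W U) g * adj U) $$ (i, j)) \<in> coef_span P"
      if U: "U \<in> carrier_mat (rdim W) d" "adj U * U = 1\<^sub>m d" "d < rdim W"
        and invU: "\<And>g. g \<in> carrier G \<Longrightarrow> U * (adj U * (rmat W g * U)) = rmat W g * U" for U d
    proof -
      note Ud = carrier_matD[OF U(1)]
      note R = restrict_rep[OF W U(1,2) invU]
      have dim: "rdim (restrict_rep W U) = d" by (simp add: restrict_rep_def Ud)
      have "contained G Z W" if "Z \<in> irreps G T" "contained G Z (restrict_rep W U)" for Z
        by (rule contained_trans_isometry[OF that(2) irrepsD(1)[OF that(1)] R(1) W])
          (use U R(2) dim in auto)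
      then have coef: "(\<lambda>g. rmat (restrict_rep W U) g $$ (a, b)) \<in> coef_span P" if "a < d" "b < d" for a b
        using less.hyps[of "restrict_rep W U" a b] less.prems(2) R(1) U(3) that dim by auto
      have "(\<lambda>g. \<Sum>b<d. cnj (U $$ (j, b)) * (\<Sum>a<d. U $$ (i, a) * rmat (restrict_rep W U) g $$ (a, b))) \<in> coef_span P"
        by (intro coef_span_sum coef_span_scale coef) auto
      then show ?thesis
      proof (rule coef_span_cong, intro ballI)
        fix g assume g: "g \<in> carrier G"
        have "rmat (restrict_rep W U) g \<in> carrier_mat d d" using unitary_repD(1)[OF R(1) g] dim by simp
        then show "(U * rmat (restrict_rep W U) g * adj U) $$ (i, j)
            = (\<Sum>b<d. cnj (U $$ (j, b)) * (\<Sum>a<d. U $$ (i, a) * rmat (restrict_rep W U) g $$ (a, b)))"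
          using less.prems(3,4) by (simp add: index_mult_mat_sum Ud mult.commute del: index_mult_mat(1))
      qed
    qed
    have "(\<lambda>g. (U * rmat (restrict_rep W U) g * adj U) $$ (i, j)) \<in> coef_span P"
      by (rule part[OF U]) (rule invU)
    moreover have "(\<lambda>g. (V * rmat (restrict_rep W V) g * adj V) $$ (i, j)) \<in> coef_span P"
      by (rule part[OF V]) (rule invV)
    ultimately have "(\<lambda>g. (U * rmat (restrict_rep W U) g * adj U) $$ (i, j)
        + (V * rmat (restrict_rep W V) g * adj V) $$ (i, j)) \<in> coef_span P"
      by (rule coef_span_add)
    then show ?thesis
    proof (rule coef_span_cong, intro ballI)
      fix g assume g: "g \<in> carrier G"
      note Ud = carrier_matD[OF U(1)] and Vd = carrier_matD[OF V(1)]
      have Wc: "rmat W g \<in> carrier_mat (rdim W) (rdim W)" using unitary_repD(1)[OF W g] .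
      have "rmat W g = rmat W g * (U * adj U + V * adj V)" unfolding complete using Wc by simp
      also have "\<dots> = rmat W g * (U * adj U) + rmat W g * (V * adj V)"
        using Wc U V by (intro mult_add_distrib_mat[of _ _ "rdim W"]) auto
      also have "\<dots> = rmat W g * U * adj U + rmat W g * V * adj V"
        using Wc by (simp add: mult_assoc_dim Ud Vd)
      also have "\<dots> = U * rmat (restrict_rep W U) g * adj U + V * rmat (restrict_rep W V) g * adj V"
        using restrict_rep(2)[OF W U(1,2) invU g] restrict_rep(2)[OF W V(1,2) invV g] by simp
      finally have "rmat W g $$ (i, j) = (U * rmat (restrict_rep W U) g * adj U + V * rmat (restrict_rep W V) g * adj V) $$ (i, j)"
        by simp
      then show "rmat W g $$ (i, j) = (U * rmat (restrict_rep W U) g * adj U) $$ (i, j)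
           + (V * rmat (restrict_rep W V) g * adj V) $$ (i, j)"
        using less.prems(3,4) Ud Vd by simp
    qed
  qed
qed

text \<open>With the empty predicate the span contains only functions vanishing on the group, while
  the upper left coefficient is 1 at the identity.\<close>

lemma ex_irrep_contained:
  assumes W: "unitary_rep G T W" and pos: "rdim W > 0"
  obtains Z where "Z \<in> irreps G T" "contained G Z W"
proof (rule ccontr)
  assume none: "\<not> thesis"
  have "(\<lambda>g. rmat W g $$ (0, 0)) \<in> coef_span (\<lambda>_. False)"
    by (rule coef_in_coef_span[OF W _ pos pos]) (use none that in blast)
  then have "\<forall>g\<in>carrier G. rmat W g $$ (0, 0) = 0" by (cases rule: coef_span.cases) auto
  from bspec[OF this one_closed] show False using rmat_one[OF W] pos by simp
qed

section \<open>Schur's lemma\<close>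

text \<open>The kernel of an intertwiner is an invariant subspace, and it is not everything when
  \<open>A\<close> is nonzero.\<close>

lemma irrep_intertwiner_inj:
  assumes X: "X \<in> irreps G T" and W: "unitary_rep G T W"
    and A: "A \<in> carrier_mat (rdim W) (rdim X)" "A \<noteq> 0\<^sub>m (rdim W) (rdim X)"
    and tw: "\<And>g. g \<in> carrier G \<Longrightarrow> A * rmat X g = rmat W g * A"
    and v: "v \<in> carrier_vec (rdim X)" "A *\<^sub>v v = 0\<^sub>v (rdim W)"
  shows "v = 0\<^sub>v (rdim X)"
proof -
  note uX = irrepsD(1)[OF X]
  define S where "S = {v \<in> carrier_vec (rdim X). A *\<^sub>v v = 0\<^sub>v (rdim W)}"
  have "invariant_subspace G X S"
    unfolding invariant_subspace_iff
  proof (intro conjI ballI)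
    show "lin_subspace (rdim X) S" unfolding S_def by (rule lin_subspace_kernel[OF A(1)])
    fix g v assume g: "g \<in> carrier G" and v: "v \<in> S"
    note c = unitary_repD(1)[OF uX g] unitary_repD(1)[OF W g]
    have v': "v \<in> carrier_vec (rdim X)" "A *\<^sub>v v = 0\<^sub>v (rdim W)" using v by (auto simp: S_def)
    have "A *\<^sub>v (rmat X g *\<^sub>v v) = (A * rmat X g) *\<^sub>v v" using A(1) c v' by (simp add: mult_assoc_vec_dim)
    also have "\<dots> = rmat W g *\<^sub>v (A *\<^sub>v v)" unfolding tw[OF g] using A(1) c v'(1) by (simp add: mult_assoc_vec_dim)
    also have "\<dots> = 0\<^sub>v (rdim W)" unfolding v'(2) using c by auto
    finally show "rmat X g *\<^sub>v v \<in> S" using c v' by (auto simp: S_def)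
  qed
  moreover have "S \<noteq> carrier_vec (rdim X)"
  proof
    assume S: "S = carrier_vec (rdim X)"
    have "A = 0\<^sub>m (rdim W) (rdim X)"
    proof (rule mat_eqI_vec[OF A(1)])
      fix v :: "complex vec" assume v: "v \<in> carrier_vec (rdim X)"
      then have "v \<in> S" using S by simp
      then show "A *\<^sub>v v = 0\<^sub>m (rdim W) (rdim X) *\<^sub>v v" using v by (simp add: S_def)
    qed simp
    then show False using A(2) by simp
  qed
  ultimately have "S = {0\<^sub>v (rdim X)}" using irrepsD(3)[OF X] by blast
  moreover have "v \<in> S" using v by (simp add: S_def)
  ultimately show ?thesis by simp
qed

lemma irrep_intertwiner_contained:
  assumes X: "X \<in> irreps G T" and W: "unitary_rep G T W"
    and A: "A \<in> carrier_mat (rdim W) (rdim X)" "A \<noteq> 0\<^sub>m (rdim W) (rdim X)"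
    and tw: "\<And>g. g \<in> carrier G \<Longrightarrow> A * rmat X g = rmat W g * A"
  shows "contained G X W"
  by (rule containedI[OF A(1) tw irrep_intertwiner_inj[OF X W A tw] irrepsD(1)[OF X] W])

text \<open>Over the complex numbers \<open>A\<close> has an eigenvalue \<open>c\<close>.
  Subtracting \<open>c\<close> leaves an intertwiner with an eigenvector in its kernel, which must
  be zero.\<close>

lemma irrep_commutant_scalar:
  assumes X: "X \<in> irreps G T" and A: "A \<in> carrier_mat (rdim X) (rdim X)"
    and comm: "\<And>g. g \<in> carrier G \<Longrightarrow> A * rmat X g = rmat X g * A"
  obtains c where "A = c \<cdot>\<^sub>m 1\<^sub>m (rdim X)"
proof -
  note uX = irrepsD(1)[OF X]
  obtain c v where v: "v \<in> carrier_vec (rdim X)" "v \<noteq> 0\<^sub>v (rdim X)" "A *\<^sub>v v = c \<cdot>\<^sub>v v"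
    using spectrum_non_empty[OF A irrepsD(2)[OF X]] A by (auto simp: spectrum_def eigenvalue_def eigenvector_def)
  define B where "B = A - c \<cdot>\<^sub>m 1\<^sub>m (rdim X)"
  have B: "B \<in> carrier_mat (rdim X) (rdim X)" using A by (auto simp: B_def)
  have "B = 0\<^sub>m (rdim X) (rdim X)"
  proof (rule ccontr)
    assume B0: "B \<noteq> 0\<^sub>m (rdim X) (rdim X)"
    have tw: "B * rmat X g = rmat X g * B" if g: "g \<in> carrier G" for g
    proof -
      note c = unitary_repD(1)[OF uX g]
      have "B * rmat X g = A * rmat X g - c \<cdot>\<^sub>m 1\<^sub>m (rdim X) * rmat X g"
        unfolding B_def using A c by (intro minus_mult_distrib_mat[of _ "rdim X" "rdim X"]) auto
      moreover have "rmat X g * B = rmat X g * A - rmat X g * (c \<cdot>\<^sub>m 1\<^sub>m (rdim X))"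
        unfolding B_def using A c by (intro mult_minus_distrib_mat[of _ "rdim X" "rdim X"]) auto
      moreover have "c \<cdot>\<^sub>m 1\<^sub>m (rdim X) * rmat X g = rmat X g * (c \<cdot>\<^sub>m 1\<^sub>m (rdim X))"
        by (rule scalar_mat_commute[OF c])
      ultimately show ?thesis using comm[OF g] by simp
    qed
    have Bv: "B *\<^sub>v v = 0\<^sub>v (rdim X)"
    proof -
      have "B *\<^sub>v v = A *\<^sub>v v - (c \<cdot>\<^sub>m 1\<^sub>m (rdim X)) *\<^sub>v v"
        unfolding B_def using A v by (intro minus_mult_distrib_mat_vec[of _ "rdim X" "rdim X"]) auto
      also have "(c \<cdot>\<^sub>m 1\<^sub>m (rdim X)) *\<^sub>v v = c \<cdot>\<^sub>v v"
        using v by (intro scalar_mat_mult_vec)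
      finally show ?thesis using v by auto
    qed
    have "v = 0\<^sub>v (rdim X)" by (rule irrep_intertwiner_inj[OF X uX B B0 tw v(1) Bv])
    with v(2) show False by simp
  qed
  then have B0: "B $$ (i, j) = 0" if "i < rdim X" "j < rdim X" for i j using that by simp
  have "A $$ (i, j) = (c \<cdot>\<^sub>m 1\<^sub>m (rdim X)) $$ (i, j)" if "i < rdim X" "j < rdim X" for i j
    using B0[OF that] that A by (simp add: B_def)
  then have "A = c \<cdot>\<^sub>m 1\<^sub>m (rdim X)" using A by (intro eq_matI) auto
  then show ?thesis by (rule that)
qed

end

section \<open>Tensor products, dual and trivial representations\<close>

lemma mult_add_less:
  fixes a b m q :: nat
  assumes "a < m" "b < q" shows "a * q + b < m * q"
proof -
  have "a * q + b < Suc a * q" using assms by simp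
  also have "\<dots> \<le> m * q" using assms by (intro mult_le_mono1) simp
  finally show ?thesis .
qed

lemma sum_div_mod:
  fixes f :: "nat \<Rightarrow> nat \<Rightarrow> complex"
  shows "(\<Sum>k<m * q. f (k div q) (k mod q)) = (\<Sum>a<m. \<Sum>b<q. f a b)"
proof (cases "q = 0")
  case False
  have "(\<Sum>a<m. \<Sum>b<q. f a b) = (\<Sum>(a, b)\<in>{..<m} \<times> {..<q}. f a b)" by (rule sum.cartesian_product)
  also have "\<dots> = (\<Sum>k<m * q. f (k div q) (k mod q))"
  proof (rule sum.reindex_bij_witness[of _ "\<lambda>k. (k div q, k mod q)" "\<lambda>(a, b). a * q + b"])
    fix ab assume "ab \<in> {..<m} \<times> {..<q}"
    then obtain a b where ab: "ab = (a, b)" "a < m" "b < q" by auto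
    then show "(case ab of (a, b) \<Rightarrow> a * q + b) \<in> {..<m * q}" by (simp add: mult_add_less)
  qed (use False in \<open>auto simp: less_mult_imp_div_less\<close>)
  finally show ?thesis by simp
qed simp

lemma kronecker_dims [simp]:
  "dim_row (kronecker A B) = dim_row A * dim_row B" "dim_col (kronecker A B) = dim_col A * dim_col B"
  by (simp_all add: kronecker_def)

lemma div_mod_bounds: "(i::nat) < n * p \<Longrightarrow> i div p < n \<and> i mod p < p"
  by (cases "p = 0") (auto simp: less_mult_imp_div_less)

lemma div_mod_eq_iff: "(i div p = j div p \<and> i mod p = j mod p) \<longleftrightarrow> i = (j::nat)"
  by (metis div_mult_mod_eq)

lemma kronecker_index [simp]:
  "i < dim_row A * dim_row B \<Longrightarrow> j < dim_col A * dim_col B \<Longrightarrow> kronecker A B $$ (i, j)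
    = A $$ (i div dim_row B, j div dim_col B) * B $$ (i mod dim_row B, j mod dim_col B)"
  by (simp add: kronecker_def)

lemma kronecker_mult:
  assumes "dim_col A = dim_row C" "dim_col B = dim_row D"
  shows "kronecker A B * kronecker C D = kronecker (A * C) (B * D)"
proof (rule eq_matI)
  fix i j assume "i < dim_row (kronecker (A * C) (B * D))" "j < dim_col (kronecker (A * C) (B * D))"
  then have ij: "i < dim_row A * dim_row B" "j < dim_col C * dim_col D" by auto
  note b = div_mod_bounds[OF ij(1)] div_mod_bounds[OF ij(2)]
  let ?i = "i div dim_row B" and ?i' = "i mod dim_row B" and ?j = "j div dim_col D" and ?j' = "j mod dim_col D"
  let ?f = "\<lambda>a b. (A $$ (?i, a) * B $$ (?i', b)) * (C $$ (a, ?j) * D $$ (b, ?j'))"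
  have "(kronecker A B * kronecker C D) $$ (i, j)
      = (\<Sum>k<dim_row C * dim_row D. kronecker A B $$ (i, k) * kronecker C D $$ (k, j))"
    using ij assms by (subst index_mult_mat_sum) auto
  also have "\<dots> = (\<Sum>k<dim_row C * dim_row D. ?f (k div dim_row D) (k mod dim_row D))"
    using ij assms by (intro sum.cong refl) simp
  also have "\<dots> = (\<Sum>a<dim_row C. \<Sum>b<dim_row D. ?f a b)" by (rule sum_div_mod)
  also have "\<dots> = (\<Sum>a<dim_row C. A $$ (?i, a) * C $$ (a, ?j)) * (\<Sum>b<dim_row D. B $$ (?i', b) * D $$ (b, ?j'))"
    by (simp add: sum_product mult_ac)
  also have "\<dots> = kronecker (A * C) (B * D) $$ (i, j)"
    using ij b assms by (simp add: index_mult_mat_sum del: index_mult_mat(1))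
  finally show "(kronecker A B * kronecker C D) $$ (i, j) = kronecker (A * C) (B * D) $$ (i, j)" .
qed simp_all

lemma kronecker_adj: "kronecker (adj A) (adj B) = adj (kronecker A B)"
  by (rule eq_matI) (auto simp: div_mod_bounds)

lemma kronecker_scalar: "kronecker (c \<cdot>\<^sub>m 1\<^sub>m n) (d \<cdot>\<^sub>m 1\<^sub>m p) = (c * d) \<cdot>\<^sub>m 1\<^sub>m (n * p)"
proof (rule eq_matI)
  fix i j assume "i < dim_row ((c * d) \<cdot>\<^sub>m 1\<^sub>m (n * p))" "j < dim_col ((c * d) \<cdot>\<^sub>m 1\<^sub>m (n * p))"
  then have ij: "i < n * p" "j < n * p" by auto
  show "kronecker (c \<cdot>\<^sub>m 1\<^sub>m n) (d \<cdot>\<^sub>m 1\<^sub>m p) $$ (i, j) = ((c * d) \<cdot>\<^sub>m 1\<^sub>m (n * p)) $$ (i, j)"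
    using ij div_mod_bounds[OF ij(1)] div_mod_bounds[OF ij(2)] div_mod_eq_iff[of i p j] by auto
qed simp_all

lemma kronecker_one: "kronecker (1\<^sub>m n) (1\<^sub>m p) = 1\<^sub>m (n * p)"
proof -
  have "1 \<cdot>\<^sub>m 1\<^sub>m k = (1\<^sub>m k :: complex mat)" for k by (rule eq_matI) auto
  then show ?thesis using kronecker_scalar[of 1 n 1 p] by simp
qed

lemma kronecker_one_right: "kronecker A (1\<^sub>m 1) = A"
  by (rule eq_matI) auto

text \<open>For unitary matrices the inverse transpose is the entrywise conjugate, so this is the
  contragredient representation.\<close>

definition dual_rep :: "'a rep \<Rightarrow> 'a rep" where
  "dual_rep X = Rep (rdim X) (\<lambda>g. map_mat cnj (rmat X g))"

definition trivial_rep :: "'a rep" where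
  "trivial_rep = Rep 1 (\<lambda>_. 1\<^sub>m 1)"

lemma map_mat_cnj_mult:
  "dim_col A = dim_row B \<Longrightarrow> map_mat cnj (A * B) = map_mat cnj A * map_mat cnj B"
  by (rule eq_matI) (auto simp: index_mult_mat_sum simp del: index_mult_mat(1))

lemma map_mat_cnj_mult_vec:
  "dim_col A = dim_vec v \<Longrightarrow> map_vec cnj (A *\<^sub>v v) = map_mat cnj A *\<^sub>v map_vec cnj v"
  by (rule eq_vecI) (auto simp: index_mult_mat_vec_sum simp del: index_mult_mat_vec)

lemma map_vec_cnj_cnj [simp]: "map_vec cnj (map_vec cnj v) = v"
  by (rule eq_vecI) auto

lemma map_mat_cnj_cnj [simp]: "map_mat cnj (map_mat cnj A) = A"
  by (rule eq_matI) auto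

context compact_group
begin

lemma rdim_tensor_rep [simp]: "rdim (tensor_rep X Y) = rdim X * rdim Y"
  by (simp add: tensor_rep_def)

lemma rmat_tensor_rep: "rmat (tensor_rep X Y) g = kronecker (rmat X g) (rmat Y g)"
  by (simp add: tensor_rep_def)

lemma unitary_tensor_rep:
  assumes X: "unitary_rep G T X" and Y: "unitary_rep G T Y"
  shows "unitary_rep G T (tensor_rep X Y)"
  unfolding unitary_rep_def
proof (intro conjI ballI allI impI)
  fix g assume g: "g \<in> carrier G"
  note c = carrier_matD[OF unitary_repD(1)[OF X g]] carrier_matD[OF unitary_repD(1)[OF Y g]]
  show "rmat (tensor_rep X Y) g \<in> carrier_mat (rdim (tensor_rep X Y)) (rdim (tensor_rep X Y))"
    using c by (auto simp: rmat_tensor_rep)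
  show "adj (rmat (tensor_rep X Y) g) * rmat (tensor_rep X Y) g = 1\<^sub>m (rdim (tensor_rep X Y))"
    using unitary_repD(2)[OF X g] unitary_repD(2)[OF Y g]
    by (simp add: rmat_tensor_rep kronecker_mult kronecker_one flip: kronecker_adj)
  fix h assume h: "h \<in> carrier G"
  show "rmat (tensor_rep X Y) (g \<otimes> h) = rmat (tensor_rep X Y) g * rmat (tensor_rep X Y) h"
    using c carrier_matD[OF unitary_repD(1)[OF X h]] carrier_matD[OF unitary_repD(1)[OF Y h]]
    by (simp add: rmat_tensor_rep kronecker_mult unitary_repD(3)[OF X g h] unitary_repD(3)[OF Y g h])
next
  fix i j assume "i < rdim (tensor_rep X Y)" "j < rdim (tensor_rep X Y)"
  then have ij: "i < rdim X * rdim Y" "j < rdim X * rdim Y" by simp_all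
  note b = div_mod_bounds[OF ij(1)] div_mod_bounds[OF ij(2)]
  have "ccont (\<lambda>g. rmat X g $$ (i div rdim Y, j div rdim Y) * rmat Y g $$ (i mod rdim Y, j mod rdim Y))"
    using b by (intro continuous_map_complex_mult unitary_repD(4)[OF X] unitary_repD(4)[OF Y]) auto
  then show "ccont (\<lambda>g. rmat (tensor_rep X Y) g $$ (i, j))"
  proof (rule continuous_map_eq)
    fix g assume "g \<in> topspace T"
    then have g: "g \<in> carrier G" by (simp add: topspace_eq)
    note c = carrier_matD[OF unitary_repD(1)[OF X g]] carrier_matD[OF unitary_repD(1)[OF Y g]]
    show "rmat X g $$ (i div rdim Y, j div rdim Y) * rmat Y g $$ (i mod rdim Y, j mod rdim Y)
        = rmat (tensor_rep X Y) g $$ (i, j)"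
      using ij c by (simp add: rmat_tensor_rep)
  qed
qed

lemma unitary_dual_rep:
  assumes X: "unitary_rep G T X" shows "unitary_rep G T (dual_rep X)"
  unfolding unitary_rep_def
proof (intro conjI ballI allI impI)
  fix g assume g: "g \<in> carrier G"
  note c = carrier_matD[OF unitary_repD(1)[OF X g]]
  show "rmat (dual_rep X) g \<in> carrier_mat (rdim (dual_rep X)) (rdim (dual_rep X))"
    using c by (auto simp: dual_rep_def)
  have "adj (map_mat cnj (rmat X g)) = map_mat cnj (adj (rmat X g))" by (rule eq_matI) auto
  then have "adj (rmat (dual_rep X) g) * rmat (dual_rep X) g = map_mat cnj (1\<^sub>m (rdim X))"
    using c by (simp add: dual_rep_def unitary_repD(2)[OF X g] flip: map_mat_cnj_mult)
  also have "\<dots> = 1\<^sub>m (rdim X)" by (rule eq_matI) auto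
  finally show "adj (rmat (dual_rep X) g) * rmat (dual_rep X) g = 1\<^sub>m (rdim (dual_rep X))" by (simp add: dual_rep_def)
  fix h assume h: "h \<in> carrier G"
  show "rmat (dual_rep X) (g \<otimes> h) = rmat (dual_rep X) g * rmat (dual_rep X) h"
    using c carrier_matD[OF unitary_repD(1)[OF X h]]
    by (simp add: dual_rep_def unitary_repD(3)[OF X g h] map_mat_cnj_mult)
next
  fix i j assume "i < rdim (dual_rep X)" "j < rdim (dual_rep X)"
  then have ij: "i < rdim X" "j < rdim X" by (simp_all add: dual_rep_def)
  have "ccont (\<lambda>g. cnj (rmat X g $$ (i, j)))" by (intro continuous_map_cnj unitary_repD(4)[OF X ij])
  then show "ccont (\<lambda>g. rmat (dual_rep X) g $$ (i, j))"
  proof (rule continuous_map_eq)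
    fix g assume "g \<in> topspace T"
    then have g: "g \<in> carrier G" by (simp add: topspace_eq)
    show "cnj (rmat X g $$ (i, j)) = rmat (dual_rep X) g $$ (i, j)"
      using ij carrier_matD[OF unitary_repD(1)[OF X g]] by (simp add: dual_rep_def)
  qed
qed

text \<open>Entrywise conjugation of vectors carries invariant subspaces of the dual to invariant
  subspaces of \<open>X\<close>. It is conjugate linear, so a scalar \<open>a\<close> on one side
  answers to \<open>cnj a\<close> on the other.\<close>

lemma dual_rep_irrep:
  assumes X: "X \<in> irreps G T" shows "dual_rep X \<in> irreps G T"
proof -
  note uX = irrepsD(1)[OF X]
  have dim: "rdim (dual_rep X) = rdim X" by (simp add: dual_rep_def)
  have "S = {0\<^sub>v (rdim X)} \<or> S = carrier_vec (rdim X)" if S: "invariant_subspace G (dual_rep X) S" for S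
  proof -
    let ?c = "map_vec cnj"
    have Sl: "lin_subspace (rdim X) S" and Si: "\<And>g v. g \<in> carrier G \<Longrightarrow> v \<in> S \<Longrightarrow> map_mat cnj (rmat X g) *\<^sub>v v \<in> S"
      using S by (auto simp: invariant_subspace_iff dual_rep_def)
    have Sc: "v \<in> carrier_vec (rdim X)" if "v \<in> S" for v using Sl that by (auto simp: lin_subspace_def)
    have "invariant_subspace G X (?c ` S)"
      unfolding invariant_subspace_iff lin_subspace_def
    proof (intro conjI ballI allI)
      show "?c ` S \<subseteq> carrier_vec (rdim X)" using Sc by auto
      show "0\<^sub>v (rdim X) \<in> ?c ` S" using Sl
        by (intro image_eqI[of _ _ "0\<^sub>v (rdim X)"] eq_vecI) (auto simp: lin_subspace_def)
    next
      fix v w assume "v \<in> ?c ` S" "w \<in> ?c ` S"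
      then obtain v' w' where *: "v' \<in> S" "w' \<in> S" "v = ?c v'" "w = ?c w'" by blast
      then show "v + w \<in> ?c ` S" using Sl Sc[OF *(1)] Sc[OF *(2)]
        by (intro image_eqI[of _ _ "v' + w'"] eq_vecI) (auto simp: lin_subspace_def)
    next
      fix a v assume "v \<in> ?c ` S"
      then obtain v' where *: "v' \<in> S" "v = ?c v'" by blast
      then show "a \<cdot>\<^sub>v v \<in> ?c ` S" using Sl Sc[OF *(1)]
        by (intro image_eqI[of _ _ "cnj a \<cdot>\<^sub>v v'"] eq_vecI) (auto simp: lin_subspace_def)
    next
      fix g v assume g: "g \<in> carrier G" and "v \<in> ?c ` S"
      then obtain v' where *: "v' \<in> S" "v = ?c v'" by blast
      have "?c (map_mat cnj (rmat X g) *\<^sub>v v') = rmat X g *\<^sub>v v"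
        using Sc[OF *(1)] carrier_matD[OF unitary_repD(1)[OF uX g]] by (simp add: map_mat_cnj_mult_vec *(2))
      then show "rmat X g *\<^sub>v v \<in> ?c ` S" using Si[OF g *(1)] by (metis image_eqI)
    qed
    from irrepsD(3)[OF X this] show ?thesis
    proof
      assume "?c ` S = {0\<^sub>v (rdim X)}"
      then have "v = 0\<^sub>v (rdim X)" if "v \<in> S" for v
      proof -
        have "?c v = 0\<^sub>v (rdim X)" using \<open>?c ` S = _\<close> that by blast
        then have "?c (?c v) = ?c (0\<^sub>v (rdim X))" by simp
        then show ?thesis by (simp add: map_vec_cnj_cnj) (auto intro: eq_vecI)
      qed
      then show ?thesis using Sl by (auto simp: lin_subspace_def)
    next
      assume eq: "?c ` S = carrier_vec (rdim X)"
      have "v \<in> S" if "v \<in> carrier_vec (rdim X)" for v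
      proof -
        have "?c v \<in> ?c ` S" using eq that by simp
        then obtain w where "w \<in> S" "?c v = ?c w" by blast
        then show ?thesis by (metis map_vec_cnj_cnj)
      qed
      then show ?thesis using Sc by blast
    qed
  qed
  then show ?thesis
    unfolding irreps_def using unitary_dual_rep[OF uX] irrepsD(2)[OF X] dim by simp
qed

lemma trivial_rep_irrep: "trivial_rep \<in> irreps G T"
proof -
  have "adj (1\<^sub>m 1) * 1\<^sub>m 1 = (1\<^sub>m 1 :: complex mat)" by simp
  then have u: "unitary_rep G T trivial_rep" by (auto simp: unitary_rep_def trivial_rep_def)
  have "S = {0\<^sub>v 1} \<or> S = carrier_vec 1" if S: "lin_subspace 1 S" for S
  proof (cases "S = {0\<^sub>v 1}")
    case False
    then obtain v where v: "v \<in> S" "v \<noteq> 0\<^sub>v 1" using S by (auto simp: lin_subspace_def)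
    have vc: "v \<in> carrier_vec 1" using S v by (auto simp: lin_subspace_def)
    have v0: "v $ 0 \<noteq> 0"
    proof
      assume "v $ 0 = 0"
      then have "v = 0\<^sub>v 1" using vc by (intro eq_vecI) auto
      then show False using v by simp
    qed
    have "w \<in> S" if w: "w \<in> carrier_vec 1" for w
    proof -
      have "w = (w $ 0 / v $ 0) \<cdot>\<^sub>v v" using w vc v0 by (intro eq_vecI) auto
      then show ?thesis using S v by (metis lin_subspace_def)
    qed
    then show ?thesis using S by (auto simp: lin_subspace_def)
  qed simp
  then show ?thesis using u by (auto simp: irreps_def invariant_subspace_iff trivial_rep_def)
qed

text \<open>Relations in the chain group speak about tensor products only. A factor
  \<open>trivial_rep\<close> brings plain containment into that form.\<close>

lemma contained_tensor_trivial:
  assumes "contained G X W" "unitary_rep G T X" "unitary_rep G T W"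
  shows "contained G X (tensor_rep W trivial_rep)"
proof -
  obtain A where A: "A \<in> carrier_mat (rdim W) (rdim X)"
    "\<And>g. g \<in> carrier G \<Longrightarrow> A * rmat X g = rmat W g * A"
    "\<And>v. v \<in> carrier_vec (rdim X) \<Longrightarrow> A *\<^sub>v v = 0\<^sub>v (rdim W) \<Longrightarrow> v = 0\<^sub>v (rdim X)"
    using containedE[OF assms(1)] by metis
  have r: "rdim trivial_rep = 1" by (simp add: trivial_rep_def)
  have "rmat (tensor_rep W trivial_rep) g = rmat W g" for g
    using kronecker_one_right by (simp add: tensor_rep_def trivial_rep_def)
  then show ?thesis
    using A assms(2,3) irrepsD(1)[OF trivial_rep_irrep]
    by (intro containedI[of A] unitary_tensor_rep) (auto simp: r)
qed

lemma trivial_contained_tensor_dual: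
  assumes X: "X \<in> irreps G T" shows "contained G trivial_rep (tensor_rep X (dual_rep X))"
proof -
  note uX = irrepsD(1)[OF X]
  define n where "n = rdim X"
  have n: "n > 0" using irrepsD(2)[OF X] by (simp add: n_def)
  have dim: "rdim (tensor_rep X (dual_rep X)) = n * n" by (simp add: dual_rep_def n_def)
  \<comment> \<open>The identity matrix flattened to a column, that is, the sum of all
    \<open>e\<^sub>a \<otimes> e\<^sub>a\<close>. It is fixed by the action because
    \<open>M * adj M = 1\<^sub>m n\<close>.\<close>
  define A :: "complex mat" where "A = mat (n * n) 1 (\<lambda>(i, _). if i div n = i mod n then 1 else 0)"
  show ?thesis
  proof (rule containedI[of A])
    show "A \<in> carrier_mat (rdim (tensor_rep X (dual_rep X))) (rdim trivial_rep)"
      unfolding dim by (simp add: A_def trivial_rep_def)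
    fix g assume g: "g \<in> carrier G"
    let ?M = "rmat X g"
    have M: "dim_row ?M = n" "dim_col ?M = n" using unitary_repD(1)[OF uX g] by (auto simp: n_def)
    have "rmat (tensor_rep X (dual_rep X)) g * A = A"
    proof (rule eq_matI)
      fix i j assume "i < dim_row A" "j < dim_col A"
      then have ij: "i < n * n" "j = 0" by (auto simp: A_def)
      note b = div_mod_bounds[OF ij(1)]
      let ?f = "\<lambda>a b. ?M $$ (i div n, a) * cnj (?M $$ (i mod n, b)) * (if a = b then 1 else 0)"
      have "(rmat (tensor_rep X (dual_rep X)) g * A) $$ (i, j)
          = (\<Sum>k<n * n. rmat (tensor_rep X (dual_rep X)) g $$ (i, k) * A $$ (k, 0))"
        using ij M by (subst index_mult_mat_sum) (auto simp: A_def rmat_tensor_rep dual_rep_def)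
      also have "\<dots> = (\<Sum>k<n * n. ?f (k div n) (k mod n))"
        using ij M b by (intro sum.cong refl) (auto simp: A_def rmat_tensor_rep dual_rep_def div_mod_bounds)
      also have "\<dots> = (\<Sum>a<n. \<Sum>b<n. ?f a b)" by (rule sum_div_mod)
      also have "\<dots> = (\<Sum>a<n. ?M $$ (i div n, a) * cnj (?M $$ (i mod n, a)))"
        by (intro sum.cong refl) (simp add: if_distrib[of "\<lambda>x. _ * x"] cong: if_cong)
      also have "\<dots> = (?M * adj ?M) $$ (i div n, i mod n)"
        using b M by (simp add: index_mult_mat_sum del: index_mult_mat(1))
      also have "\<dots> = A $$ (i, j)"
        using b ij unitary_rep_adj[OF uX g] by (simp add: A_def n_def)
      finally show "(rmat (tensor_rep X (dual_rep X)) g * A) $$ (i, j) = A $$ (i, j)" .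
    qed (use M in \<open>auto simp: A_def rmat_tensor_rep dual_rep_def\<close>)
    then show "A * rmat trivial_rep g = rmat (tensor_rep X (dual_rep X)) g * A"
      by (simp add: trivial_rep_def A_def)
  next
    fix v :: "complex vec" assume v: "v \<in> carrier_vec (rdim trivial_rep)" "A *\<^sub>v v = 0\<^sub>v (rdim (tensor_rep X (dual_rep X)))"
    then have vc: "v \<in> carrier_vec 1" by (simp add: trivial_rep_def)
    have "0 < n * n" using n by simp
    then have "(A *\<^sub>v v) $ 0 = v $ 0" using n vc by (subst index_mult_mat_vec_sum) (auto simp: A_def)
    then have "v $ 0 = 0" using v(2) n dim by simp
    then show "v = 0\<^sub>v (rdim trivial_rep)" using vc by (intro eq_vecI) (auto simp: trivial_rep_def)
  next
    show "unitary_rep G T trivial_rep" by (rule irrepsD(1)[OF trivial_rep_irrep])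
    show "unitary_rep G T (tensor_rep X (dual_rep X))" by (intro unitary_tensor_rep unitary_dual_rep uX)
  qed
qed

section \<open>Central characters\<close>

lemma center_group_iff:
  "z \<in> carrier (center_group G) \<longleftrightarrow> z \<in> carrier G \<and> (\<forall>g\<in>carrier G. z \<otimes> g = g \<otimes> z)"
  by (simp add: center_group_def)

lemma rmat_center:
  assumes X: "X \<in> irreps G T" and z: "z \<in> carrier (center_group G)"
  shows "rmat X z = central_char G X z \<cdot>\<^sub>m 1\<^sub>m (rdim X)"
proof -
  note uX = irrepsD(1)[OF X]
  have zG: "z \<in> carrier G" and comm: "\<And>g. g \<in> carrier G \<Longrightarrow> z \<otimes> g = g \<otimes> z"
    using z by (auto simp: center_group_iff)
  have "rmat X z * rmat X g = rmat X g * rmat X z" if g: "g \<in> carrier G" for g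
    using unitary_repD(3)[OF uX zG g] unitary_repD(3)[OF uX g zG] comm[OF g] by simp
  then obtain c where c: "rmat X z = c \<cdot>\<^sub>m 1\<^sub>m (rdim X)"
    using irrep_commutant_scalar[OF X unitary_repD(1)[OF uX zG]] by metis
  \<comment> \<open>Positive dimension makes the scalar unique, so the description in
    \<open>central_char\<close> denotes it.\<close>
  have "d = c" if "rmat X z = d \<cdot>\<^sub>m 1\<^sub>m (rdim X)" for d
    using arg_cong[OF trans[OF that[symmetric] c], of "\<lambda>M. M $$ (0, 0)"] irrepsD(2)[OF X] by simp
  then have "(THE c. rmat X z = c \<cdot>\<^sub>m 1\<^sub>m (rdim X)) = c" using c by blast
  then show ?thesis using c z by (simp add: central_char_def)
qed

lemma central_char_eq_index:
  assumes X: "X \<in> irreps G T" and z: "z \<in> carrier (center_group G)"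
  shows "central_char G X z = rmat X z $$ (0, 0)"
  using rmat_center[OF X z] irrepsD(2)[OF X] by simp

text \<open>An injective intertwiner sends a nonzero vector to some \<open>u\<close> on which
  \<open>z\<close> acts both by the scalar of \<open>Z\<close> and by the product of the scalars of
  \<open>X\<close> and \<open>Y\<close>.\<close>

lemma central_char_tensor:
  assumes X: "X \<in> irreps G T" and Y: "Y \<in> irreps G T" and Z: "Z \<in> irreps G T"
    and cont: "contained G Z (tensor_rep X Y)" and z: "z \<in> carrier (center_group G)"
  shows "central_char G Z z = central_char G X z * central_char G Y z"
proof -
  obtain A where A: "A \<in> carrier_mat (rdim (tensor_rep X Y)) (rdim Z)"
    "\<And>g. g \<in> carrier G \<Longrightarrow> A * rmat Z g = rmat (tensor_rep X Y) g * A"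
    "\<And>v. v \<in> carrier_vec (rdim Z) \<Longrightarrow> A *\<^sub>v v = 0\<^sub>v (rdim (tensor_rep X Y)) \<Longrightarrow> v = 0\<^sub>v (rdim Z)"
    using containedE[OF cont] by metis
  let ?n = "rdim (tensor_rep X Y)"
  define v :: "complex vec" where "v = unit_vec (rdim Z) 0"
  define u where "u = A *\<^sub>v v"
  have v: "v \<in> carrier_vec (rdim Z)" "v \<noteq> 0\<^sub>v (rdim Z)"
    using irrepsD(2)[OF Z] by (auto simp: v_def dest: arg_cong[of _ _ "\<lambda>v. v $ 0"])
  have u: "u \<in> carrier_vec ?n" using A(1) v by (auto simp: u_def)
  have "u \<noteq> 0\<^sub>v ?n" using A(3)[OF v(1)] v(2) by (auto simp: u_def)
  then obtain i where i: "i < ?n" "u $ i \<noteq> 0" using u by (metis carrier_vecD eq_vecI index_zero_vec)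
  have zG: "z \<in> carrier G" using z by (simp add: center_group_iff)
  have "A *\<^sub>v (rmat Z z *\<^sub>v v) = (A * rmat Z z) *\<^sub>v v"
    using A(1) v unitary_repD(1)[OF irrepsD(1)[OF Z] zG] by (simp add: mult_assoc_vec_dim)
  also have "\<dots> = rmat (tensor_rep X Y) z *\<^sub>v u"
    unfolding A(2)[OF zG] u_def using A(1) v
      unitary_repD(1)[OF unitary_tensor_rep[OF irrepsD(1)[OF X] irrepsD(1)[OF Y]] zG] by (simp add: mult_assoc_vec_dim)
  also have "\<dots> = (central_char G X z * central_char G Y z) \<cdot>\<^sub>v u"
    unfolding rmat_tensor_rep rmat_center[OF X z] rmat_center[OF Y z] kronecker_scalar
    using u by (intro scalar_mat_mult_vec) simp
  also have "A *\<^sub>v (rmat Z z *\<^sub>v v) = central_char G Z z \<cdot>\<^sub>v u"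
    unfolding rmat_center[OF Z z] scalar_mat_mult_vec[OF v(1)] u_def by (rule mult_mat_vec[OF A(1) v(1)])
  finally have "(central_char G Z z \<cdot>\<^sub>v u) $ i = ((central_char G X z * central_char G Y z) \<cdot>\<^sub>v u) $ i" by simp
  then show ?thesis using i u by simp
qed

end

section \<open>Matrix coefficients and orthogonality\<close>

context compact_group
begin

section \<open>The algebra of matrix coefficients\<close>

lemma coef_span_mult:
  assumes tensor: "\<And>X Y Z. X \<in> irreps G T \<Longrightarrow> Y \<in> irreps G T \<Longrightarrow> Z \<in> irreps G T \<Longrightarrow>
      P X \<Longrightarrow> P Y \<Longrightarrow> contained G Z (tensor_rep X Y) \<Longrightarrow> P Z"
    and f: "f \<in> coef_span P" and h: "h \<in> coef_span P"
  shows "(\<lambda>g. f g * h g) \<in> coef_span P"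
  using h
proof (induction h rule: coef_span.induct)
  case (zero h)
  then show ?case by (intro coef_span.zero) simp
next
  case (step h Y k l h' c)
  note Y = step(2-5)
  have "(\<lambda>g. f g * rmat Y g $$ (k, l)) \<in> coef_span P"
    using f
  proof (induction f rule: coef_span.induct)
    case (zero h)
    then show ?case by (intro coef_span.zero) simp
  next
    case (step f X i j f' d)
    note X = step(2-5)
    note uX = irrepsD(1)[OF X(1)] and uY = irrepsD(1)[OF Y(1)]
    let ?i = "i * rdim Y + k" and ?j = "j * rdim Y + l"
    note less = mult_add_less[of _ "rdim X" _ "rdim Y"]
    \<comment> \<open>A product of two coefficients is a single coefficient of the tensor product,
      and \<open>tensor\<close> puts all constituents of that product into \<open>P\<close>.\<close>
    have "(\<lambda>g. rmat (tensor_rep X Y) g $$ (?i, ?j)) \<in> coef_span P"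
      by (rule coef_in_coef_span[OF unitary_tensor_rep[OF uX uY]])
        (use tensor[OF X(1) Y(1) _ X(2) Y(2)] less X Y in auto)
    from coef_span_add[OF step(7) coef_span_scale[OF this, of d]] show ?case
    proof (rule coef_span_cong, intro ballI)
      fix g assume g: "g \<in> carrier G"
      have "rmat (tensor_rep X Y) g $$ (?i, ?j) = rmat X g $$ (i, j) * rmat Y g $$ (k, l)"
        using less X Y carrier_matD[OF unitary_repD(1)[OF uX g]] carrier_matD[OF unitary_repD(1)[OF uY g]]
        by (simp add: rmat_tensor_rep)
      then show "f' g * rmat Y g $$ (k, l) = f g * rmat Y g $$ (k, l) + d * rmat (tensor_rep X Y) g $$ (?i, ?j)"
        using step(6) g by (simp add: algebra_simps)
    qed
  qed
  from coef_span_add[OF step(7) coef_span_scale[OF this, of c]] show ?case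
    by (rule coef_span_cong) (use step(6) in \<open>simp add: algebra_simps\<close>)
qed

lemma coef_span_cnj:
  assumes dual: "\<And>X. X \<in> irreps G T \<Longrightarrow> P X \<Longrightarrow> P (dual_rep X)" and f: "f \<in> coef_span P"
  shows "(\<lambda>g. cnj (f g)) \<in> coef_span P"
  using f
proof (induction f rule: coef_span.induct)
  case (zero h)
  then show ?case by (intro coef_span.zero) simp
next
  case (step f X i j f' c)
  show ?case
  proof (rule coef_span.step[where c = "cnj c", OF step(7) dual_rep_irrep[OF step(2)] dual[OF step(2,3)]])
    show "i < rdim (dual_rep X)" "j < rdim (dual_rep X)" using step(4,5) by (simp_all add: dual_rep_def)
    show "\<forall>g\<in>carrier G. cnj (f' g) = cnj (f g) + cnj c * rmat (dual_rep X) g $$ (i, j)"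
      using step(4-6) carrier_matD[OF unitary_repD(1)[OF irrepsD(1)[OF step(2)]]] by (simp add: dual_rep_def)
  qed
qed

lemma coef_span_const: assumes "P trivial_rep" shows "(\<lambda>_. c) \<in> coef_span P"
proof -
  have "(\<lambda>g. rmat (trivial_rep :: 'a rep) g $$ (0, 0)) \<in> coef_span P"
    using assms by (intro coef_span_coef trivial_rep_irrep) (simp_all add: trivial_rep_def)
  from coef_span_scale[OF this, of c] show ?thesis by (simp add: trivial_rep_def)
qed

section \<open>Separation of points by irreducible representations\<close>

lemma coef_span_eqD:
  assumes "f \<in> coef_span P" "u \<in> carrier G" "w \<in> carrier G"
    and "\<And>X. X \<in> irreps G T \<Longrightarrow> P X \<Longrightarrow> rmat X u = rmat X w"
  shows "f u = f w"
  using assms(1)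
proof (induction f rule: coef_span.induct)
  case (step f X i j h c)
  then show ?case using assms(2-4) by simp
qed (use assms in simp)

text \<open>The representation supplied by Peter--Weyl may be reducible; its coefficients lie in the
  span of irreducible ones, so they cannot separate \<open>u\<close> from the identity
  either.\<close>

lemma eq_one_if_irreps_trivial:
  assumes u: "u \<in> carrier G" and triv: "\<And>Y. Y \<in> irreps G T \<Longrightarrow> rmat Y u = 1\<^sub>m (rdim Y)"
  shows "u = \<one>"
proof (rule ccontr)
  assume "u \<noteq> \<one>"
  then obtain W where W: "unitary_rep G T W" "rmat W u \<noteq> 1\<^sub>m (rdim W)"
    using ex_unitary_rep_nontrivial[OF u] by metis
  have "rmat W u $$ (i, j) = rmat W \<one> $$ (i, j)" if "i < rdim W" "j < rdim W" for i j
    by (rule coef_span_eqD[OF coef_in_coef_span[OF W(1) _ that, of "\<lambda>_. True"] u one_closed])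
      (use triv rmat_one[OF irrepsD(1)] in auto)
  then have "rmat W u = rmat W \<one>"
    using unitary_repD(1)[OF W(1) u] unitary_repD(1)[OF W(1) one_closed] by (intro eq_matI) auto
  then show False using W rmat_one[OF W(1)] by simp
qed

lemma eq_if_irreps_eq:
  assumes "u \<in> carrier G" "w \<in> carrier G" "\<And>Y. Y \<in> irreps G T \<Longrightarrow> rmat Y u = rmat Y w"
  shows "u = w"
proof -
  have "inv u \<otimes> w = \<one>"
  proof (rule eq_one_if_irreps_trivial)
    fix Y assume Y: "Y \<in> irreps G T"
    note uY = irrepsD(1)[OF Y]
    have "rmat Y (inv u \<otimes> w) = rmat Y (inv u) * rmat Y u" using assms Y by (simp add: unitary_repD(3)[OF uY])
    also have "\<dots> = 1\<^sub>m (rdim Y)"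
      using unitary_repD(3)[OF uY, of "inv u" u] assms(1) by (simp add: rmat_one[OF uY])
    finally show "rmat Y (inv u \<otimes> w) = 1\<^sub>m (rdim Y)" .
  qed (use assms in simp)
  then show ?thesis using assms by (metis inv_equality inv_inv inv_closed)
qed

text \<open>With \<open>l\<close> and \<open>j\<close> fixed, these means are the entries of the
  average of \<open>rmat Z g * E * adj (rmat X g)\<close> for a matrix unit \<open>E\<close>.
  Invariance of the mean makes this average an intertwiner from \<open>X\<close> to
  \<open>Z\<close>, and Schur's lemma makes it zero.\<close>

lemma coef_orthogonal:
  assumes X: "X \<in> irreps G T" and Z: "Z \<in> irreps G T" and not: "\<not> contained G X Z"
    and ij: "i < rdim X" "j < rdim X" and kl: "k < rdim Z" "l < rdim Z"
  shows "cmean (\<lambda>g. rmat Z g $$ (k, l) * cnj (rmat X g $$ (i, j))) = 0"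
proof -
  note uX = irrepsD(1)[OF X] and uZ = irrepsD(1)[OF Z]
  define F where "F k i g = rmat Z g $$ (k, l) * cnj (rmat X g $$ (i, j))" for k i g
  have cF: "ccont (F k i)" if "k < rdim Z" "i < rdim X" for k i
    unfolding F_def using that ij kl
    by (intro continuous_map_complex_mult continuous_map_cnj unitary_repD(4)[OF uX] unitary_repD(4)[OF uZ])
  define B where "B = mat (rdim Z) (rdim X) (\<lambda>(k, i). cmean (F k i))"
  have tw: "B * rmat X h = rmat Z h * B" if h: "h \<in> carrier G" for h
  proof (rule eq_matI)
    note c = carrier_matD[OF unitary_repD(1)[OF uX h]] carrier_matD[OF unitary_repD(1)[OF uZ h]]
    fix k i assume "k < dim_row (rmat Z h * B)" "i < dim_col (rmat Z h * B)"
    then have ki: "k < rdim Z" "i < rdim X" using c by (auto simp: B_def)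
    define D where "D g = rmat Z g $$ (k, l) * cnj (rmat X (inv h \<otimes> g) $$ (i, j))" for g
    have XD: "cnj (rmat X (inv h \<otimes> g) $$ (i, j)) = (\<Sum>m<rdim X. cnj (rmat X g $$ (m, j)) * rmat X h $$ (m, i))"
      if g: "g \<in> carrier G" for g
    proof -
      have "rmat X (inv h \<otimes> g) = adj (rmat X h) * rmat X g"
        using g h by (simp add: unitary_repD(3)[OF uX] rmat_inv[OF uX h])
      then show ?thesis
        using ij ki c carrier_matD[OF unitary_repD(1)[OF uX g]]
        by (simp add: index_mult_mat_sum mult.commute del: index_mult_mat(1))
    qed
    have cD: "ccont D"
      unfolding D_def using h ki ij kl
      by (intro continuous_map_complex_mult continuous_map_cnj unitary_repD(4)[OF uZ]
            ccont_compose[OF unitary_repD(4)[OF uX]] cont_intros) auto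
    have "(B * rmat X h) $$ (k, i) = (\<Sum>m<rdim X. rmat X h $$ (m, i) * cmean (F k m))"
      using ki c by (subst index_mult_mat_sum) (auto simp: B_def mult.commute)
    also have "\<dots> = cmean (\<lambda>g. \<Sum>m<rdim X. rmat X h $$ (m, i) * F k m g)"
      using cF ki by (subst cmean_sum) (auto simp: cmean_scale intro!: continuous_map_complex_mult)
    also have "\<dots> = cmean D"
      by (rule cmean_cong) (simp add: D_def XD F_def sum_distrib_left mult_ac)
    also have "\<dots> = cmean (\<lambda>g. D (h \<otimes> g))" using cmean_left[OF cD h] by simp
    also have "\<dots> = cmean (\<lambda>g. \<Sum>m<rdim Z. rmat Z h $$ (k, m) * F m i g)"
    proof (rule cmean_cong)
      fix g assume g: "g \<in> carrier G"
      have "rmat Z (h \<otimes> g) $$ (k, l) = (\<Sum>m<rdim Z. rmat Z h $$ (k, m) * rmat Z g $$ (m, l))"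
        using ki kl c carrier_matD[OF unitary_repD(1)[OF uZ g]]
        by (simp add: unitary_repD(3)[OF uZ h g] index_mult_mat_sum del: index_mult_mat(1))
      moreover have "inv h \<otimes> (h \<otimes> g) = g" using g h by (simp flip: m_assoc)
      ultimately show "D (h \<otimes> g) = (\<Sum>m<rdim Z. rmat Z h $$ (k, m) * F m i g)"
        by (simp add: D_def F_def sum_distrib_right sum_distrib_left mult_ac)
    qed
    also have "\<dots> = (\<Sum>m<rdim Z. rmat Z h $$ (k, m) * cmean (F m i))"
      using cF ki by (subst cmean_sum) (auto simp: cmean_scale intro!: continuous_map_complex_mult)
    also have "\<dots> = (rmat Z h * B) $$ (k, i)"
      using ki c by (subst index_mult_mat_sum) (auto simp: B_def)
    finally show "(B * rmat X h) $$ (k, i) = (rmat Z h * B) $$ (k, i)" .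
  qed (use carrier_matD[OF unitary_repD(1)[OF uX h]] carrier_matD[OF unitary_repD(1)[OF uZ h]] in \<open>auto simp: B_def\<close>)
  have "B = 0\<^sub>m (rdim Z) (rdim X)"
    using irrep_intertwiner_contained[OF X uZ _ _ tw] not by (auto simp: B_def)
  then have "B $$ (k, i) = 0" using ij kl by simp
  then show ?thesis using ij kl by (simp add: B_def F_def[abs_def])
qed

text \<open>Each \<open>Y \<otimes> dual Y\<close> is trivial at \<open>g\<inverse>h\<close>, which forces \<open>Y\<close> to be scalar there.\<close>

lemma central_if_tensor_dual_eq:
  assumes g: "g \<in> carrier G" and h: "h \<in> carrier G"
    and eq: "\<And>Y. Y \<in> irreps G T \<Longrightarrow> rmat (tensor_rep Y (dual_rep Y)) g = rmat (tensor_rep Y (dual_rep Y)) h"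
  shows "inv g \<otimes> h \<in> carrier (center_group G)"
proof -
  define n where "n = inv g \<otimes> h"
  have n: "n \<in> carrier G" using g h by (simp add: n_def)
  have scalar: "\<exists>c. rmat Y n = c \<cdot>\<^sub>m 1\<^sub>m (rdim Y)" if Y: "Y \<in> irreps G T" for Y
  proof -
    note uY = irrepsD(1)[OF Y]
    let ?W = "tensor_rep Y (dual_rep Y)"
    let ?d = "rdim Y"
    have uW: "unitary_rep G T ?W" by (intro unitary_tensor_rep unitary_dual_rep uY)
    have "rmat ?W n = rmat ?W (inv g) * rmat ?W g"
      unfolding n_def using g h eq[OF Y] by (simp add: unitary_repD(3)[OF uW])
    also have "\<dots> = 1\<^sub>m (rdim ?W)"
      using unitary_repD(3)[OF uW, of "inv g" g] g by (simp add: rmat_one[OF uW])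
    also have "rdim ?W = ?d * ?d" by (simp add: dual_rep_def)
    finally have one: "kronecker (rmat Y n) (map_mat cnj (rmat Y n)) = 1\<^sub>m (?d * ?d)"
      by (simp add: rmat_tensor_rep dual_rep_def)
    note c = carrier_matD[OF unitary_repD(1)[OF uY n]]
    \<comment> \<open>The Kronecker identity entry by entry. With \<open>i = j\<close> and
      \<open>k = l\<close> it kills the off-diagonal entries; on the diagonal, comparison with the
      entry at \<open>(0, 0)\<close> shows that all are equal.\<close>
    have ent: "rmat Y n $$ (i, k) * cnj (rmat Y n $$ (j, l)) = (if i = k \<and> j = l then 1 else 0)"
      if "i < ?d" "j < ?d" "k < ?d" "l < ?d" for i j k l
    proof -
      note less = mult_add_less[of _ ?d _ ?d]
      have iff: "i * ?d + j = k * ?d + l \<longleftrightarrow> i = k \<and> j = l"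
        using div_mod_eq_iff[of "i * ?d + j" ?d "k * ?d + l"] that by simp
      have "kronecker (rmat Y n) (map_mat cnj (rmat Y n)) $$ (i * ?d + j, k * ?d + l)
          = rmat Y n $$ (i, k) * cnj (rmat Y n $$ (j, l))"
        using less that c by simp
      then show ?thesis unfolding one using less that iff by simp
    qed
    have "rmat Y n = (rmat Y n $$ (0, 0)) \<cdot>\<^sub>m 1\<^sub>m ?d"
    proof (rule eq_matI)
      fix i j assume "i < dim_row ((rmat Y n $$ (0, 0)) \<cdot>\<^sub>m 1\<^sub>m ?d)" "j < dim_col ((rmat Y n $$ (0, 0)) \<cdot>\<^sub>m 1\<^sub>m ?d)"
      then have ij: "i < ?d" "j < ?d" by auto
      have d: "0 < ?d" using irrepsD(2)[OF Y] .
      show "rmat Y n $$ (i, j) = ((rmat Y n $$ (0, 0)) \<cdot>\<^sub>m 1\<^sub>m ?d) $$ (i, j)"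
      proof (cases "i = j")
        case True
        have 1: "rmat Y n $$ (i, i) * cnj (rmat Y n $$ (0, 0)) = 1" using ent[of i 0 i 0] ij d by simp
        have 2: "rmat Y n $$ (0, 0) * cnj (rmat Y n $$ (0, 0)) = 1" using ent[of 0 0 0 0] d by simp
        have "cnj (rmat Y n $$ (0, 0)) \<noteq> 0" using 2 by auto
        then show ?thesis using 1 2 True ij by (metis index_one_mat(1) index_smult_mat(1) index_one_mat(2,3) mult.right_neutral mult_right_cancel)
      next
        case False
        then have "rmat Y n $$ (i, j) * cnj (rmat Y n $$ (i, j)) = 0" using ent[of i i j j] ij by simp
        then show ?thesis using ij False by simp
      qed
    qed (use c in auto)
    then show ?thesis by blast
  qed
  have "n \<otimes> y = y \<otimes> n" if y: "y \<in> carrier G" for y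
  proof (rule eq_if_irreps_eq)
    fix Y assume Y: "Y \<in> irreps G T"
    note uY = irrepsD(1)[OF Y]
    obtain c where c: "rmat Y n = c \<cdot>\<^sub>m 1\<^sub>m (rdim Y)" using scalar[OF Y] by blast
    have "(c \<cdot>\<^sub>m 1\<^sub>m (rdim Y)) * rmat Y y = rmat Y y * (c \<cdot>\<^sub>m 1\<^sub>m (rdim Y))"
      by (rule scalar_mat_commute[OF unitary_repD(1)[OF uY y]])
    then show "rmat Y (n \<otimes> y) = rmat Y (y \<otimes> n)" using n y by (simp add: unitary_repD(3)[OF uY] c)
  qed (use n y in auto)
  then show ?thesis using n by (simp add: center_group_iff n_def)
qed

text \<open>The predicate \<open>P\<close> stands for triviality of the class, of which only the
  closure properties matter. The contradiction is found in the first column of \<open>X\<close>: it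
  has norm 1 everywhere, yet each of its entries is nearly a function orthogonal to it.\<close>

theorem trivial_central_char_closed_family:
  assumes triv: "P trivial_rep"
    and dual: "\<And>X. X \<in> irreps G T \<Longrightarrow> P X \<Longrightarrow> P (dual_rep X)"
    and tensor: "\<And>X Y Z. X \<in> irreps G T \<Longrightarrow> Y \<in> irreps G T \<Longrightarrow> Z \<in> irreps G T \<Longrightarrow>
      P X \<Longrightarrow> P Y \<Longrightarrow> contained G Z (tensor_rep X Y) \<Longrightarrow> P Z"
    and tensor_dual: "\<And>X Z. X \<in> irreps G T \<Longrightarrow> Z \<in> irreps G T \<Longrightarrow> contained G Z (tensor_rep X (dual_rep X)) \<Longrightarrow> P Z"
    and X: "X \<in> irreps G T" and char: "\<And>z. z \<in> carrier (center_group G) \<Longrightarrow> central_char G X z = 1"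
  shows "P X"
proof (rule ccontr)
  assume nP: "\<not> P X"
  note uX = irrepsD(1)[OF X]
  let ?n = "rdim X"
  have n: "?n > 0" by (rule irrepsD(2)[OF X])
  have sep: "rmat X g = rmat X h"
    if gh: "g \<in> carrier G" "h \<in> carrier G" and eq: "\<And>a. a \<in> coef_span P \<Longrightarrow> a g = a h" for g h
  proof -
    have "inv g \<otimes> h \<in> carrier (center_group G)"
    proof (rule central_if_tensor_dual_eq[OF gh])
      fix Y assume Y: "Y \<in> irreps G T"
      let ?W = "tensor_rep Y (dual_rep Y)"
      have uW: "unitary_rep G T ?W" by (intro unitary_tensor_rep unitary_dual_rep irrepsD(1)[OF Y])
      have "rmat ?W g $$ (i, j) = rmat ?W h $$ (i, j)" if "i < rdim ?W" "j < rdim ?W" for i j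
        by (rule eq[OF coef_in_coef_span[OF uW tensor_dual[OF Y] that]])
      then show "rmat ?W g = rmat ?W h"
        using unitary_repD(1)[OF uW gh(1)] unitary_repD(1)[OF uW gh(2)] by (intro eq_matI) auto
    qed
    from rmat_center[OF X this] char[OF this] have one: "rmat X (inv g \<otimes> h) = 1\<^sub>m ?n"
      by (auto intro: eq_matI)
    have "h = g \<otimes> (inv g \<otimes> h)" using gh by (simp flip: m_assoc)
    then have "rmat X h = rmat X g * rmat X (inv g \<otimes> h)" using gh unitary_repD(3)[OF uX gh(1), of "inv g \<otimes> h"] by simp
    then show ?thesis using one unitary_repD(1)[OF uX gh(1)] by simp
  qed
  \<comment> \<open>The constant: \<open>norm_cmean_le\<close> doubles it to
    \<open>1 / (2 * real ?n)\<close> for each entry, and the \<open>?n\<close> entries of the column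
    then add up to at most 1/2.\<close>
  have approx: "\<exists>a\<in>coef_span P. \<forall>g\<in>carrier G. cmod (rmat X g $$ (i, 0) - a g) < 1 / (4 * real ?n)" if i: "i < ?n" for i
    unfolding topspace_eq[symmetric]
  proof (rule Stone_Weierstrass_complex[OF compact])
    show "rmat X x $$ (i, 0) = rmat X y $$ (i, 0)" if "x \<in> topspace T" "y \<in> topspace T"
      "\<And>a. a \<in> coef_span P \<Longrightarrow> a x = a y" for x y
      using sep[of x y] that by (simp add: topspace_eq)
    show "ccont (\<lambda>g. rmat X g $$ (i, 0))" by (rule unitary_repD(4)[OF uX i n])
    show "0 < 1 / (4 * real ?n)" using n by simp
    show "(\<lambda>x. a x * b x) \<in> coef_span P" if "a \<in> coef_span P" "b \<in> coef_span P" for a b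
      using that by (rule coef_span_mult[where P = P, rotated]) (rule tensor)
    show "(\<lambda>x. cnj (a x)) \<in> coef_span P" if "a \<in> coef_span P" for a
      using that by (rule coef_span_cnj[where P = P, rotated]) (rule dual)
  qed (auto intro: ccont_coef_span coef_span_add coef_span_const triv)
  have orth: "cmean (\<lambda>g. a g * cnj (rmat X g $$ (i, 0))) = 0" if a: "a \<in> coef_span P" and i: "i < ?n" for a i
    using a
  proof (induction a rule: coef_span.induct)
    case (zero h)
    then have "cmean (\<lambda>g. h g * cnj (rmat X g $$ (i, 0))) = cmean (\<lambda>_. 0)" by (intro cmean_cong) simp
    then show ?case by simp
  next
    case (step f Z k l h c)
    note uZ = irrepsD(1)[OF step(2)]
    \<comment> \<open>Otherwise \<open>X\<close> would be a constituent of \<open>Z\<close> tensored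
      with the trivial representation, and \<open>P X\<close> would follow from the closure under
      tensor products.\<close>
    have "\<not> contained G X Z"
    proof
      assume "contained G X Z"
      from contained_tensor_trivial[OF this uX uZ] have "P X"
        by (rule tensor[OF step(2) trivial_rep_irrep X step(3) triv])
      with nP show False ..
    qed
    from coef_orthogonal[OF X step(2) this i n step(4,5)]
    have 0: "cmean (\<lambda>g. rmat Z g $$ (k, l) * cnj (rmat X g $$ (i, 0))) = 0" .
    note cX = continuous_map_cnj[OF unitary_repD(4)[OF uX i n]]
    note c1 = continuous_map_complex_mult[OF ccont_coef_span[OF step(1)] cX]
    note c2 = continuous_map_complex_mult[OF unitary_repD(4)[OF uZ step(4,5)] cX]
    have "cmean (\<lambda>g. h g * cnj (rmat X g $$ (i, 0)))
        = cmean (\<lambda>g. f g * cnj (rmat X g $$ (i, 0)) + c * (rmat Z g $$ (k, l) * cnj (rmat X g $$ (i, 0))))"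
      by (rule cmean_cong) (use step(6) in \<open>simp add: algebra_simps\<close>)
    also have "\<dots> = cmean (\<lambda>g. f g * cnj (rmat X g $$ (i, 0)))
        + cmean (\<lambda>g. c * (rmat Z g $$ (k, l) * cnj (rmat X g $$ (i, 0))))"
      by (rule cmean_add[OF c1 continuous_map_complex_mult[OF _ c2]]) simp
    also have "\<dots> = 0" using step(7) 0 cmean_scale[OF c2, of c] by simp
    finally show ?case .
  qed
  have col: "(\<Sum>i<?n. rmat X g $$ (i, 0) * cnj (rmat X g $$ (i, 0))) = 1" if g: "g \<in> carrier G" for g
  proof -
    note c = carrier_matD[OF unitary_repD(1)[OF uX g]]
    have "(adj (rmat X g) * rmat X g) $$ (0, 0) = (\<Sum>i<?n. rmat X g $$ (i, 0) * cnj (rmat X g $$ (i, 0)))"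
      using n c by (subst index_mult_mat_sum) (auto simp: mult.commute)
    then show ?thesis using unitary_repD(2)[OF uX g] n by simp
  qed
  have bound: "cmod (rmat X g $$ (i, 0)) \<le> 1" if g: "g \<in> carrier G" and i: "i < ?n" for g i
  proof -
    have "complex_of_real (\<Sum>i<?n. (cmod (rmat X g $$ (i, 0)))\<^sup>2) = 1"
      using col[OF g] unfolding of_real_sum complex_norm_square .
    then have "(\<Sum>i<?n. (cmod (rmat X g $$ (i, 0)))\<^sup>2) = 1" by (metis of_real_eq_1_iff)
    moreover have "(cmod (rmat X g $$ (i, 0)))\<^sup>2 \<le> (\<Sum>i<?n. (cmod (rmat X g $$ (i, 0)))\<^sup>2)"
      using i by (intro member_le_sum) auto
    ultimately show ?thesis by (simp add: power2_nonneg_ge_1_iff abs_square_le_1)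
  qed
  have cX: "ccont (\<lambda>g. rmat X g $$ (i, 0))" if "i < ?n" for i by (rule unitary_repD(4)[OF uX that n])
  have small: "cmod (cmean (\<lambda>g. rmat X g $$ (i, 0) * cnj (rmat X g $$ (i, 0)))) \<le> 1 / (2 * real ?n)" if i: "i < ?n" for i
  proof -
    obtain a where a: "a \<in> coef_span P" "\<forall>g\<in>carrier G. cmod (rmat X g $$ (i, 0) - a g) < 1 / (4 * real ?n)"
      using approx[OF i] by blast
    have c1: "ccont (\<lambda>g. (rmat X g $$ (i, 0) - a g) * cnj (rmat X g $$ (i, 0)))"
      by (intro continuous_map_complex_mult continuous_map_diff continuous_map_cnj cX i ccont_coef_span[OF a(1)])
    have c2: "ccont (\<lambda>g. a g * cnj (rmat X g $$ (i, 0)))"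
      by (intro continuous_map_complex_mult continuous_map_cnj cX i ccont_coef_span[OF a(1)])
    have "cmean (\<lambda>g. rmat X g $$ (i, 0) * cnj (rmat X g $$ (i, 0)))
       = cmean (\<lambda>g. (rmat X g $$ (i, 0) - a g) * cnj (rmat X g $$ (i, 0)) + a g * cnj (rmat X g $$ (i, 0)))"
      by (rule cmean_cong) (simp add: algebra_simps)
    also have "\<dots> = cmean (\<lambda>g. (rmat X g $$ (i, 0) - a g) * cnj (rmat X g $$ (i, 0)))"
      using cmean_add[OF c1 c2] orth[OF a(1) i] by simp
    also have "cmod \<dots> \<le> 2 * (1 / (4 * real ?n))"
    proof (rule norm_cmean_le[OF c1])
      fix g assume g: "g \<in> carrier G"
      have "cmod (rmat X g $$ (i, 0) - a g) * cmod (cnj (rmat X g $$ (i, 0))) \<le> 1 / (4 * real ?n) * 1"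
        using a(2) g bound[OF g i] by (intro mult_mono) (auto intro: less_imp_le)
      then show "cmod ((rmat X g $$ (i, 0) - a g) * cnj (rmat X g $$ (i, 0))) \<le> 1 / (4 * real ?n)"
        by (simp add: norm_mult)
    qed
    finally show ?thesis by simp
  qed
  have "1 = cmean (\<lambda>g. \<Sum>i<?n. rmat X g $$ (i, 0) * cnj (rmat X g $$ (i, 0)))"
    using cmean_cong[OF col] by simp
  also have "\<dots> = (\<Sum>i<?n. cmean (\<lambda>g. rmat X g $$ (i, 0) * cnj (rmat X g $$ (i, 0))))"
    by (rule cmean_sum) (intro continuous_map_complex_mult continuous_map_cnj cX; simp)
  finally have "1 = cmod (\<Sum>i<?n. cmean (\<lambda>g. rmat X g $$ (i, 0) * cnj (rmat X g $$ (i, 0))))" by (metis norm_one)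
  also have "\<dots> \<le> (\<Sum>i<?n. 1 / (2 * real ?n))"
    by (intro sum_norm_le small) simp
  also have "\<dots> = 1/2" using n by simp
  finally show False by simp
qed

section \<open>The center and its dual group\<close>

lemma subgroup_center: "subgroup (carrier (center_group G)) G"
proof (rule subgroupI)
  show "carrier (center_group G) \<subseteq> carrier G" by (auto simp: center_group_iff)
  have "\<one> \<in> carrier (center_group G)" by (simp add: center_group_iff)
  then show "carrier (center_group G) \<noteq> {}" by blast
next
  fix a assume a: "a \<in> carrier (center_group G)"
  have "inv a \<otimes> g = g \<otimes> inv a" if g: "g \<in> carrier G" for g
  proof -
    have aG: "a \<in> carrier G" and ag: "a \<otimes> g = g \<otimes> a" using a g by (auto simp: center_group_iff)
    have "inv a \<otimes> g = inv a \<otimes> (g \<otimes> a) \<otimes> inv a" using aG g by (simp add: m_assoc)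
    also have "\<dots> = g \<otimes> inv a" unfolding ag[symmetric] using aG g by (simp flip: m_assoc)
    finally show ?thesis .
  qed
  then show "inv a \<in> carrier (center_group G)" using a by (simp add: center_group_iff)
next
  fix a b assume "a \<in> carrier (center_group G)" "b \<in> carrier (center_group G)"
  then have a: "a \<in> carrier G" "\<And>g. g \<in> carrier G \<Longrightarrow> a \<otimes> g = g \<otimes> a"
    and b: "b \<in> carrier G" "\<And>g. g \<in> carrier G \<Longrightarrow> b \<otimes> g = g \<otimes> b" by (auto simp: center_group_iff)
  have "a \<otimes> b \<otimes> g = g \<otimes> (a \<otimes> b)" if g: "g \<in> carrier G" for g
  proof -
    have "a \<otimes> b \<otimes> g = a \<otimes> (g \<otimes> b)" using a(1) b g by (simp add: m_assoc)
    also have "\<dots> = g \<otimes> (a \<otimes> b)" using a(1) a(2)[OF g] b(1) g by (simp flip: m_assoc)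
    finally show ?thesis .
  qed
  then show "a \<otimes> b \<in> carrier (center_group G)" using a(1) b(1) unfolding center_group_iff by blast
qed

lemma center_group_eq: "center_group G = G\<lparr>carrier := carrier (center_group G)\<rparr>"
  by (simp add: center_group_def)

lemma center_group_simps [simp]:
  "x \<otimes>\<^bsub>center_group G\<^esub> y = x \<otimes> y" "\<one>\<^bsub>center_group G\<^esub> = \<one>"
  by (simp_all add: center_group_def)

lemma inv_center_group: "z \<in> carrier (center_group G) \<Longrightarrow> inv\<^bsub>center_group G\<^esub> z = inv z"
  by (subst center_group_eq) (rule m_inv_consistent[OF subgroup_center])

text \<open>This provides the invariant mean on the center, used for orthogonality of its
  characters.\<close>

lemma compact_group_center:
  "compact_group (center_group G) (subtopology T (carrier (center_group G)))"
proof -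
  let ?Z = "carrier (center_group G)"
  let ?S = "subtopology T ?Z"
  have sub: "?Z \<subseteq> topspace T" by (auto simp: topspace_eq center_group_iff)
  have gr: "group (center_group G)"
    using subgroup.subgroup_is_group[OF subgroup_center is_group] by (subst center_group_eq)
  have top: "topspace ?S = ?Z" using sub by auto
  \<comment> \<open>Each commutation condition is the equality set of two continuous maps into a
    Hausdorff space, so the center is closed and hence compact.\<close>
  have "?Z = (\<Inter>g\<in>carrier G. {z \<in> topspace T. z \<otimes> g = g \<otimes> z})"
    by (auto simp: topspace_eq center_group_iff; blast intro: one_closed)
  also have "closedin T \<dots>"
    using one_closed by (intro closedin_INT closedin_continuous_maps_eq[OF Hausdorff] cont_intros) auto
  finally have closed: "closedin T ?Z" .
  have incl: "continuous_map X T f \<and> f \<in> topspace X \<rightarrow> ?Z" if "continuous_map X ?S f" for X and f :: "'c \<Rightarrow> 'a"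
    using that by (simp add: continuous_map_in_subtopology)
  interpret Z: group "center_group G" by (rule gr)
  show ?thesis
  proof
    show "topspace ?S = ?Z" by (rule top)
    show "compact_space ?S" using closedin_compact_space[OF compact closed] compactin_subspace by blast
    show "Hausdorff_space ?S" using Hausdorff by (rule Hausdorff_space_subtopology)
    have f: "continuous_map (prod_topology ?S ?S) T fst" using incl[OF continuous_map_fst] by blast
    have s: "continuous_map (prod_topology ?S ?S) T snd" using incl[OF continuous_map_snd] by blast
    show "continuous_map (prod_topology ?S ?S) ?S (\<lambda>(x, y). x \<otimes>\<^bsub>center_group G\<^esub> y)"
      using continuous_map_mult[OF f s] Z.m_closed sub
      by (auto simp: continuous_map_in_subtopology case_prod_unfold)
    have "continuous_map ?S T (\<lambda>x. inv x)"
      using continuous_map_from_subtopology[OF continuous_inv] .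
    then have "continuous_map ?S T (\<lambda>x. inv\<^bsub>center_group G\<^esub> x)"
      by (rule continuous_map_eq) (simp add: inv_center_group)
    then show "continuous_map ?S ?S (\<lambda>x. inv\<^bsub>center_group G\<^esub> x)"
      using Z.inv_closed by (auto simp: continuous_map_in_subtopology)
  qed
qed

lemma center_dual_iff:
  "\<xi> \<in> carrier (center_dual G T) \<longleftrightarrow>
    (\<forall>z\<in>carrier (center_group G). cmod (\<xi> z) = 1) \<and>
    (\<forall>z\<in>carrier (center_group G). \<forall>w\<in>carrier (center_group G). \<xi> (z \<otimes> w) = \<xi> z * \<xi> w) \<and>
    \<xi> \<in> extensional (carrier (center_group G)) \<and>
    continuous_map (subtopology T (carrier (center_group G))) euclidean \<xi>"
  by (auto simp: center_dual_def dual_group_def hom_def U1_def)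

lemma center_dual_simps [simp]:
  "\<xi> \<otimes>\<^bsub>center_dual G T\<^esub> \<psi> = (\<lambda>z\<in>carrier (center_group G). \<xi> z * \<psi> z)"
  "\<one>\<^bsub>center_dual G T\<^esub> = (\<lambda>z\<in>carrier (center_group G). 1)"
  by (simp_all add: center_dual_def dual_group_def)

lemma comm_group_center_dual: "comm_group (center_dual G T)"
proof -
  let ?Z = "carrier (center_group G)"
  let ?S = "subtopology T ?Z"
  interpret Z: compact_group "center_group G" ?S by (rule compact_group_center)
  have closed: "x \<otimes> y \<in> ?Z" if "x \<in> ?Z" "y \<in> ?Z" for x y using Z.m_closed[OF that] by simp
  have cont: "continuous_map ?S euclidean (restrict f ?Z)" if "continuous_map ?S euclidean f" for f :: "'a \<Rightarrow> complex"
    by (rule continuous_map_eq[OF that]) (simp add: Z.topspace_eq del: topspace_subtopology)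
  show ?thesis
  proof (rule comm_groupI)
    fix \<xi> \<psi> assume "\<xi> \<in> carrier (center_dual G T)" "\<psi> \<in> carrier (center_dual G T)"
    then show "\<xi> \<otimes>\<^bsub>center_dual G T\<^esub> \<psi> \<in> carrier (center_dual G T)"
      unfolding center_dual_iff center_dual_simps
      by (auto simp: closed norm_mult intro!: cont continuous_map_complex_mult)
  next
    show "\<one>\<^bsub>center_dual G T\<^esub> \<in> carrier (center_dual G T)"
      unfolding center_dual_iff center_dual_simps by (auto simp: closed intro!: cont)
  next
    fix \<xi> assume \<xi>: "\<xi> \<in> carrier (center_dual G T)"
    let ?\<psi> = "\<lambda>z\<in>?Z. cnj (\<xi> z)"
    have "?\<psi> \<in> carrier (center_dual G T)"
      using \<xi> unfolding center_dual_iff by (auto simp: closed intro!: cont continuous_map_cnj)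
    moreover have "?\<psi> \<otimes>\<^bsub>center_dual G T\<^esub> \<xi> = \<one>\<^bsub>center_dual G T\<^esub>"
    proof -
      have "cnj (\<xi> z) * \<xi> z = 1" if "z \<in> ?Z" for z
        using \<xi> that complex_norm_square[of "\<xi> z"] by (simp add: center_dual_iff mult.commute)
      then show ?thesis by (auto simp: fun_eq_iff restrict_def)
    qed
    ultimately show "\<exists>\<psi>\<in>carrier (center_dual G T). \<psi> \<otimes>\<^bsub>center_dual G T\<^esub> \<xi> = \<one>\<^bsub>center_dual G T\<^esub>" by blast
    show "\<one>\<^bsub>center_dual G T\<^esub> \<otimes>\<^bsub>center_dual G T\<^esub> \<xi> = \<xi>"
      using \<xi> by (auto simp: center_dual_iff fun_eq_iff restrict_def extensional_def)
  qed (auto simp: fun_eq_iff restrict_def)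
qed

lemma central_char_in_dual:
  assumes X: "X \<in> irreps G T" shows "central_char G X \<in> carrier (center_dual G T)"
  unfolding center_dual_iff
proof (intro conjI ballI)
  note uX = irrepsD(1)[OF X] and n = irrepsD(2)[OF X]
  interpret Z: compact_group "center_group G" "subtopology T (carrier (center_group G))"
    by (rule compact_group_center)
  show "central_char G X \<in> extensional (carrier (center_group G))" by (simp add: central_char_def)
  have "continuous_map (subtopology T (carrier (center_group G))) euclidean (\<lambda>g. rmat X g $$ (0, 0))"
    by (rule continuous_map_from_subtopology[OF unitary_repD(4)[OF uX n n]])
  then show "continuous_map (subtopology T (carrier (center_group G))) euclidean (central_char G X)"
    by (rule continuous_map_eq) (use central_char_eq_index[OF X] in simp)
  fix z assume z: "z \<in> carrier (center_group G)"
  have zG: "z \<in> carrier G" using z by (simp add: center_group_iff)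
  have "(adj (rmat X z) * rmat X z) $$ (0, 0) = cnj (central_char G X z) * central_char G X z"
    unfolding rmat_center[OF X z] using n
    by (subst index_mult_mat_sum) (auto simp: if_distrib[of "\<lambda>x. _ * x"] if_distrib[of cnj] cong: if_cong)
  then have "central_char G X z * cnj (central_char G X z) = 1"
    using unitary_repD(2)[OF uX zG] n by (simp add: mult.commute)
  then have "complex_of_real ((cmod (central_char G X z))\<^sup>2) = 1" by (simp only: complex_norm_square)
  then have "(cmod (central_char G X z))\<^sup>2 = 1" by (metis of_real_eq_1_iff)
  then show "cmod (central_char G X z) = 1" by (simp add: power2_eq_1_iff)
      (smt (verit) norm_ge_zero)
  fix w assume w: "w \<in> carrier (center_group G)"
  have wG: "w \<in> carrier G" using w by (simp add: center_group_iff)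
  have zw: "z \<otimes> w \<in> carrier (center_group G)" using Z.m_closed[OF z w] by simp
  have "rmat X (z \<otimes> w) = central_char G X z \<cdot>\<^sub>m 1\<^sub>m (rdim X) * (central_char G X w \<cdot>\<^sub>m 1\<^sub>m (rdim X))"
    using unitary_repD(3)[OF uX zG wG] rmat_center[OF X z] rmat_center[OF X w] by simp
  also have "\<dots> = central_char G X z \<cdot>\<^sub>m (central_char G X w \<cdot>\<^sub>m 1\<^sub>m (rdim X))"
    using mult_smult_assoc_mat[of "1\<^sub>m (rdim X)" "rdim X" "rdim X" "central_char G X w \<cdot>\<^sub>m 1\<^sub>m (rdim X)" "rdim X"] by simp
  finally show "central_char G X (z \<otimes> w) = central_char G X z * central_char G X w"
    using central_char_eq_index[OF X zw] n by simp
qed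

theorem ex_irrep_central_char:
  assumes \<xi>: "\<xi> \<in> carrier (center_dual G T)"
  shows "\<exists>X\<in>irreps G T. central_char G X = \<xi>"
proof (rule ccontr)
  assume "\<not> ?thesis"
  then have none: "central_char G X \<noteq> \<xi>" if "X \<in> irreps G T" for X using that by blast
  let ?Z = "carrier (center_group G)"
  interpret Z: compact_group "center_group G" "subtopology T ?Z" by (rule compact_group_center)
  have ZG: "z \<in> carrier G" if "z \<in> ?Z" for z using that by (simp add: center_group_iff)
  have c\<xi>: "Z.ccont \<xi>" and \<xi>1: "\<And>z. z \<in> ?Z \<Longrightarrow> cmod (\<xi> z) = 1"
    and \<xi>m: "\<And>z w. z \<in> ?Z \<Longrightarrow> w \<in> ?Z \<Longrightarrow> \<xi> (z \<otimes> w) = \<xi> z * \<xi> w"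
    and ext: "\<xi> \<in> extensional ?Z" using \<xi> by (auto simp: center_dual_iff)
  have csub: "Z.ccont f" if "ccont f" for f by (rule continuous_map_from_subtopology[OF that])
  \<comment> \<open>The full coefficient algebra, restricted to the center, separates its points by
    Peter--Weyl. The tolerance 1/4 becomes 1/2 after the factor 2 of
    \<open>norm_cmean_le\<close>.\<close>
  have "\<exists>a\<in>coef_span (\<lambda>_. True). \<forall>z\<in>topspace (subtopology T ?Z). cmod (\<xi> z - a z) < 1/4"
  proof (rule Stone_Weierstrass_complex[OF Z.compact])
    fix z w assume zw: "z \<in> topspace (subtopology T ?Z)" "w \<in> topspace (subtopology T ?Z)"
      and eq: "\<And>a. a \<in> coef_span (\<lambda>_. True) \<Longrightarrow> a z = a w"
    then have zw: "z \<in> carrier G" "w \<in> carrier G" using ZG Z.topspace_eq by auto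
    have "z = w"
    proof (rule eq_if_irreps_eq[OF zw])
      fix Y assume Y: "Y \<in> irreps G T"
      then show "rmat Y z = rmat Y w"
        using eq[OF coef_span_coef[OF Y]] unitary_repD(1)[OF irrepsD(1)[OF Y] zw(1)]
          unitary_repD(1)[OF irrepsD(1)[OF Y] zw(2)] by (intro eq_matI) auto
    qed
    then show "\<xi> z = \<xi> w" by simp
  next
    show "(\<lambda>x. a x * b x) \<in> coef_span (\<lambda>_. True)"
      if "a \<in> coef_span (\<lambda>_. True)" "b \<in> coef_span (\<lambda>_. True)" for a b
      using that by (rule coef_span_mult[where P = "\<lambda>_. True", rotated]) simp
    show "(\<lambda>x. cnj (a x)) \<in> coef_span (\<lambda>_. True)" if "a \<in> coef_span (\<lambda>_. True)" for a
      using that by (rule coef_span_cnj[where P = "\<lambda>_. True", rotated]) simp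
    show "Z.ccont a" if "a \<in> coef_span (\<lambda>_. True)" for a by (rule csub[OF ccont_coef_span[OF that]])
  qed (auto intro: coef_span_add coef_span_const c\<xi>)
  then obtain a where a: "a \<in> coef_span (\<lambda>_. True)" and near: "\<And>z. z \<in> ?Z \<Longrightarrow> cmod (\<xi> z - a z) < 1/4"
    unfolding Z.topspace_eq by blast
  note cc = continuous_map_cnj[OF c\<xi>]
  have orth_char: "Z.cmean (\<lambda>z. central_char G X z * cnj (\<xi> z)) = 0" if X: "X \<in> irreps G T" for X
  proof -
    define \<psi> where "\<psi> z = central_char G X z * cnj (\<xi> z)" for z
    have X': "central_char G X \<in> carrier (center_dual G T)" by (rule central_char_in_dual[OF X])
    have c\<psi>: "Z.ccont \<psi>"
      unfolding \<psi>_def[abs_def] using X' by (intro continuous_map_complex_mult cc) (simp add: center_dual_iff)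
    have "\<exists>s\<in>?Z. central_char G X s \<noteq> \<xi> s"
    proof (rule ccontr)
      assume "\<not> ?thesis"
      then have "central_char G X = \<xi>"
        using X' ext by (intro extensionalityI[of _ ?Z]) (auto simp: center_dual_iff)
      with none[OF X] show False ..
    qed
    then obtain s where s: "s \<in> ?Z" "central_char G X s \<noteq> \<xi> s" by blast
    \<comment> \<open>Two distinct characters differ at some \<open>s\<close>. Translation by
      \<open>s\<close> multiplies \<open>\<psi>\<close> by \<open>\<psi> s\<close>, so its mean must
      be zero.\<close>
    have "\<psi> s \<noteq> 1"
    proof
      assume "\<psi> s = 1"
      then have 1: "central_char G X s * cnj (\<xi> s) = 1" by (simp add: \<psi>_def)
      have 2: "\<xi> s * cnj (\<xi> s) = 1" using complex_norm_square[of "\<xi> s"] \<xi>1[OF s(1)] by simp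
      then have "cnj (\<xi> s) \<noteq> 0" by auto
      moreover have "central_char G X s * cnj (\<xi> s) = \<xi> s * cnj (\<xi> s)" using 1 2 by simp
      ultimately show False using s(2) by simp
    qed
    have "Z.cmean \<psi> = Z.cmean (\<lambda>z. \<psi> (s \<otimes> z))" using Z.cmean_left[OF c\<psi> s(1)] by simp
    also have "\<dots> = Z.cmean (\<lambda>z. \<psi> s * \<psi> z)"
      by (rule Z.cmean_cong) (use X' s(1) \<xi>m in \<open>simp add: \<psi>_def center_dual_iff\<close>)
    also have "\<dots> = \<psi> s * Z.cmean \<psi>" by (rule Z.cmean_scale[OF c\<psi>])
    finally have "(\<psi> s - 1) * Z.cmean \<psi> = 0" by (simp add: algebra_simps)
    then show ?thesis using \<open>\<psi> s \<noteq> 1\<close> by (simp add: \<psi>_def[abs_def])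
  qed
  have orth: "Z.cmean (\<lambda>z. a z * cnj (\<xi> z)) = 0"
    using a
  proof (induction a rule: coef_span.induct)
    case (zero h)
    then have "Z.cmean (\<lambda>g. h g * cnj (\<xi> g)) = Z.cmean (\<lambda>_. 0)" using ZG by (intro Z.cmean_cong) simp
    then show ?case by simp
  next
    case (step f X i j h c)
    have X': "central_char G X \<in> carrier (center_dual G T)" by (rule central_char_in_dual[OF step(2)])
    \<comment> \<open>On the center every irreducible representation is scalar: off-diagonal
      coefficients vanish there, and diagonal ones equal the central character.\<close>
    define d where "d = (if i = j then c else 0)"
    have c1: "Z.ccont (\<lambda>z. f z * cnj (\<xi> z))"
      by (intro continuous_map_complex_mult cc csub ccont_coef_span[OF step(1)])
    have c2: "Z.ccont (\<lambda>z. central_char G X z * cnj (\<xi> z))"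
      using X' by (intro continuous_map_complex_mult cc) (simp add: center_dual_iff)
    have "Z.cmean (\<lambda>z. h z * cnj (\<xi> z))
        = Z.cmean (\<lambda>z. f z * cnj (\<xi> z) + d * (central_char G X z * cnj (\<xi> z)))"
    proof (rule Z.cmean_cong)
      fix z assume z: "z \<in> ?Z"
      have "h z = f z + c * rmat X z $$ (i, j)" using step(6) ZG[OF z] by blast
      also have "rmat X z $$ (i, j) = (if i = j then central_char G X z else 0)"
        using rmat_center[OF step(2) z] step(4,5) by simp
      finally show "h z * cnj (\<xi> z) = f z * cnj (\<xi> z) + d * (central_char G X z * cnj (\<xi> z))"
        by (simp add: d_def algebra_simps)
    qed
    also have "\<dots> = Z.cmean (\<lambda>z. f z * cnj (\<xi> z)) + Z.cmean (\<lambda>z. d * (central_char G X z * cnj (\<xi> z)))"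
      by (rule Z.cmean_add[OF c1 continuous_map_complex_mult[OF _ c2]]) simp
    also have "\<dots> = 0" using step(7) Z.cmean_scale[OF c2, of d] orth_char[OF step(2)] by simp
    finally show ?case .
  qed
  have c1: "Z.ccont (\<lambda>z. (\<xi> z - a z) * cnj (\<xi> z))"
    by (intro continuous_map_complex_mult continuous_map_diff cc csub ccont_coef_span[OF a] c\<xi>)
  have c2: "Z.ccont (\<lambda>z. a z * cnj (\<xi> z))"
    by (intro continuous_map_complex_mult cc csub ccont_coef_span[OF a])
  have "1 = Z.cmean (\<lambda>z. (\<xi> z - a z) * cnj (\<xi> z) + a z * cnj (\<xi> z))"
  proof -
    have "Z.cmean (\<lambda>z. (\<xi> z - a z) * cnj (\<xi> z) + a z * cnj (\<xi> z)) = Z.cmean (\<lambda>_. 1)"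
    proof (rule Z.cmean_cong)
      fix z assume "z \<in> ?Z"
      then have "\<xi> z * cnj (\<xi> z) = 1" using complex_norm_square[of "\<xi> z"] \<xi>1 by simp
      then show "(\<xi> z - a z) * cnj (\<xi> z) + a z * cnj (\<xi> z) = 1" by (simp add: algebra_simps)
    qed
    then show ?thesis by simp
  qed
  also have "\<dots> = Z.cmean (\<lambda>z. (\<xi> z - a z) * cnj (\<xi> z))" using Z.cmean_add[OF c1 c2] orth by simp
  finally have "1 = cmod (Z.cmean (\<lambda>z. (\<xi> z - a z) * cnj (\<xi> z)))" by (metis norm_one)
  also have "\<dots> \<le> 2 * (1/4)"
  proof (rule Z.norm_cmean_le[OF c1])
    fix z assume z: "z \<in> ?Z"
    then show "cmod ((\<xi> z - a z) * cnj (\<xi> z)) \<le> 1/4"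
      using near[OF z] \<xi>1[OF z] by (simp add: norm_mult)
  qed
  finally show False by simp
qed

end

section \<open>The chain group\<close>

context compact_group
begin

lemma irrep_classes_iff: "c \<in> irrep_classes G T \<longleftrightarrow> (\<exists>X\<in>irreps G T. c = irrep_class G T X)"
  by (auto simp: irrep_classes_def irrep_class_def quotient_def)

lemma in_irrep_class_self:
  assumes X: "X \<in> irreps G T" shows "X \<in> irrep_class G T X"
proof -
  have "invertible_mat (1\<^sub>m (rdim X) :: complex mat)"
    by (auto simp: invertible_mat_def inverts_mat_def intro!: exI[of _ "1\<^sub>m (rdim X)"])
  then have "rep_iso G X X"
    unfolding rep_iso_def using carrier_matD[OF unitary_repD(1)[OF irrepsD(1)[OF X]]]
    by (intro bexI[of _ "1\<^sub>m (rdim X)"]) simp_all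
  then show ?thesis using X by (simp add: irrep_class_def irrep_rel_def)
qed

lemma central_char_trivial: "z \<in> carrier (center_group G) \<Longrightarrow> central_char G trivial_rep z = 1"
  using central_char_eq_index[OF trivial_rep_irrep] by (simp add: trivial_rep_def)

text \<open>An isomorphism makes \<open>X\<close> a constituent of \<open>Y\<close> tensored with
  the trivial representation, so the product formula for central characters applies.\<close>

lemma central_char_irrep_class:
  assumes X: "X \<in> irreps G T" and Y: "Y \<in> irreps G T" and eq: "irrep_class G T X = irrep_class G T Y"
  shows "central_char G X = central_char G Y"
proof -
  note uX = irrepsD(1)[OF X] and uY = irrepsD(1)[OF Y]
  have "rep_iso G X Y" using in_irrep_class_self[OF Y] unfolding eq[symmetric]
    by (simp add: irrep_class_def irrep_rel_def)
  then obtain A where A: "A \<in> carrier_mat (rdim Y) (rdim X)" "invertible_mat A"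
    "\<forall>g\<in>carrier G. A * rmat X g = rmat Y g * A" unfolding rep_iso_def by blast
  from A(2) obtain B where AB: "A * B = 1\<^sub>m (dim_row A)" and BA: "B * A = 1\<^sub>m (dim_row B)"
    unfolding invertible_mat_def inverts_mat_def by blast
  have dB: "dim_row B = rdim X" "dim_col B = rdim Y"
    using arg_cong[OF BA, of dim_col] arg_cong[OF AB, of dim_col] A(1) by auto
  have "contained G X Y"
  proof (rule containedI[OF A(1) _ _ uX uY])
    fix v :: "complex vec" assume v: "v \<in> carrier_vec (rdim X)" "A *\<^sub>v v = 0\<^sub>v (rdim Y)"
    have "v = (B * A) *\<^sub>v v" unfolding BA dB using v by simp
    also have "\<dots> = B *\<^sub>v 0\<^sub>v (rdim Y)" using A(1) dB v by (simp add: mult_assoc_vec_dim)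
    also have "\<dots> = 0\<^sub>v (rdim X)" using A(1) dB by (intro eq_vecI) (auto simp: scalar_prod_def)
    finally show "v = 0\<^sub>v (rdim X)" .
  qed (use A(3) in blast)
  note cont = contained_tensor_trivial[OF this uX uY]
  show ?thesis
  proof (rule extensionalityI[of _ "carrier (center_group G)"])
    fix z assume z: "z \<in> carrier (center_group G)"
    from central_char_tensor[OF Y trivial_rep_irrep X cont z] central_char_trivial[OF z]
    show "central_char G X z = central_char G Y z" by simp
  qed (simp_all add: central_char_def)
qed

section \<open>The quotient by the relators\<close>

abbreviation relator_subgroup :: "('a rep set \<Rightarrow>\<^sub>0 int) set" where
  "relator_subgroup \<equiv> generate (chain_free G T) (chain_relators G T)"

lemma frag_irrep_class:
  "X \<in> irreps G T \<Longrightarrow> frag_of (irrep_class G T X) \<in> carrier (chain_free G T)"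
  by (auto simp: irrep_classes_iff)

lemma chain_relators_subset: "chain_relators G T \<subseteq> carrier (chain_free G T)"
proof -
  interpret F: comm_group "chain_free G T" by (rule abelian_free_Abelian_group)
  show ?thesis unfolding chain_relators_def
    using frag_irrep_class by (auto simp del: mult_free_Abelian_group inv_free_Abelian_group carrier_free_Abelian_group_iff)
qed

lemma subgroup_relators: "subgroup relator_subgroup (chain_free G T)"
  by (rule group.generate_is_subgroup[OF group_free_Abelian_group chain_relators_subset])

lemma normal_relators: "relator_subgroup \<lhd> chain_free G T"
  by (rule comm_group.subgroup_imp_normal[OF abelian_free_Abelian_group subgroup_relators])

lemma comm_group_chain_group: "comm_group (chain_group G T)"
  unfolding chain_group_def by (rule comm_group.abelian_FactGroup[OF abelian_free_Abelian_group subgroup_relators])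

lemma carrier_chain_group:
  "carrier (chain_group G T) = (\<lambda>x. relator_subgroup #>\<^bsub>chain_free G T\<^esub> x) ` carrier (chain_free G T)"
  by (simp add: chain_group_def carrier_FactGroup del: carrier_free_Abelian_group_iff)

lemma one_chain_group: "\<one>\<^bsub>chain_group G T\<^esub> = relator_subgroup"
  by (simp add: chain_group_def)

lemma coset_mult:
  assumes "x \<in> carrier (chain_free G T)" "y \<in> carrier (chain_free G T)"
  shows "(relator_subgroup #>\<^bsub>chain_free G T\<^esub> x) \<otimes>\<^bsub>chain_group G T\<^esub> (relator_subgroup #>\<^bsub>chain_free G T\<^esub> y)
    = relator_subgroup #>\<^bsub>chain_free G T\<^esub> (x \<otimes>\<^bsub>chain_free G T\<^esub> y)"
  using normal.rcos_sum[OF normal_relators assms] by (simp add: chain_group_def del: mult_free_Abelian_group)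

lemma chain_class_in_chain_group: "X \<in> irreps G T \<Longrightarrow> chain_class G T X \<in> carrier (chain_group G T)"
  unfolding chain_class_def carrier_chain_group by (rule imageI[OF frag_irrep_class])

lemma chain_class_tensor:
  assumes X: "X \<in> irreps G T" and Y: "Y \<in> irreps G T" and Z: "Z \<in> irreps G T"
    and c: "contained G Z (tensor_rep X Y)"
  shows "chain_class G T Z = chain_class G T X \<otimes>\<^bsub>chain_group G T\<^esub> chain_class G T Y"
proof -
  interpret F: comm_group "chain_free G T" by (rule abelian_free_Abelian_group)
  let ?x = "frag_of (irrep_class G T X)" and ?y = "frag_of (irrep_class G T Y)" and ?z = "frag_of (irrep_class G T Z)"
  let ?xy = "?x \<otimes>\<^bsub>chain_free G T\<^esub> ?y"
  let ?r = "?z \<otimes>\<^bsub>chain_free G T\<^esub> inv\<^bsub>chain_free G T\<^esub> ?xy"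
  note in_F = frag_irrep_class[OF X] frag_irrep_class[OF Y] frag_irrep_class[OF Z]
  have xy: "?xy \<in> carrier (chain_free G T)" by (rule F.m_closed[OF in_F(1,2)])
  have "?r \<in> chain_relators G T" unfolding chain_relators_def using X Y Z c by blast
  then have "?r \<in> relator_subgroup" by (rule generate.incl)
  moreover have "?z = ?r \<otimes>\<^bsub>chain_free G T\<^esub> ?xy"
    using F.m_assoc[OF in_F(3) F.inv_closed[OF xy] xy] F.l_inv[OF xy] F.r_one[OF in_F(3)] by (simp only:)
  ultimately have "?z \<in> relator_subgroup #>\<^bsub>chain_free G T\<^esub> ?xy"
    unfolding r_coset_def by blast
  from F.repr_independence[OF this xy subgroup_relators] coset_mult[OF in_F(1,2)]
  show ?thesis by (simp only: chain_class_def)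
qed

text \<open>The trivial representation is a constituent of its own tensor square, so its class is
  idempotent in a group.\<close>

lemma chain_class_trivial: "chain_class G T trivial_rep = \<one>\<^bsub>chain_group G T\<^esub>"
proof -
  interpret C: comm_group "chain_group G T" by (rule comm_group_chain_group)
  note t = trivial_rep_irrep
  note u = irrepsD(1)[OF t]
  let ?t = "chain_class G T trivial_rep"
  have c: "?t \<in> carrier (chain_group G T)" by (rule chain_class_in_chain_group[OF t])
  have "?t = ?t \<otimes>\<^bsub>chain_group G T\<^esub> ?t"
    by (rule chain_class_tensor[OF t t t contained_tensor_trivial[OF contained_refl[OF u] u u]])
  then show ?thesis using c C.r_cancel_one'[OF c c] by simp
qed

lemma chain_class_dual:
  assumes X: "X \<in> irreps G T"
  shows "chain_class G T X \<otimes>\<^bsub>chain_group G T\<^esub> chain_class G T (dual_rep X) = \<one>\<^bsub>chain_group G T\<^esub>"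
  using chain_class_tensor[OF X dual_rep_irrep[OF X] trivial_rep_irrep trivial_contained_tensor_dual[OF X]]
  by (simp add: chain_class_trivial)

text \<open>Any constituent of \<open>tensor_rep X (dual_rep Y)\<close> will do; the relations give
  all of them the same class.\<close>

lemma chain_class_quotient:
  assumes X: "X \<in> irreps G T" and Y: "Y \<in> irreps G T"
  shows "\<exists>Z\<in>irreps G T. chain_class G T Z
    = chain_class G T X \<otimes>\<^bsub>chain_group G T\<^esub> inv\<^bsub>chain_group G T\<^esub> chain_class G T Y"
proof -
  interpret C: comm_group "chain_group G T" by (rule comm_group_chain_group)
  note dY = dual_rep_irrep[OF Y]
  have "unitary_rep G T (tensor_rep X (dual_rep Y))" 
    by (intro unitary_tensor_rep irrepsD(1) X dY)
  moreover have "rdim (tensor_rep X (dual_rep Y)) > 0" using irrepsD(2)[OF X] irrepsD(2)[OF dY] by simp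
  ultimately obtain Z where Z: "Z \<in> irreps G T" "contained G Z (tensor_rep X (dual_rep Y))"
    using ex_irrep_contained by metis
  have "inv\<^bsub>chain_group G T\<^esub> chain_class G T Y = chain_class G T (dual_rep Y)"
    by (rule C.inv_equality[OF _ chain_class_in_chain_group[OF Y] chain_class_in_chain_group[OF dY]])
      (simp add: C.m_comm chain_class_in_chain_group Y dY chain_class_dual)
  with chain_class_tensor[OF X dY Z] Z(1) show ?thesis by auto
qed

text \<open>Induction on the free abelian group forms differences of elements already treated, and
  \<open>chain_class_quotient\<close> answers each difference with a single representation.\<close>

lemma chain_group_eq_chain_class:
  assumes "c \<in> carrier (chain_group G T)" shows "\<exists>X\<in>irreps G T. c = chain_class G T X"
proof -
  interpret C: comm_group "chain_group G T" by (rule comm_group_chain_group)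
  interpret F: comm_group "chain_free G T" by (rule abelian_free_Abelian_group)
  obtain x where x: "x \<in> carrier (chain_free G T)" "c = relator_subgroup #>\<^bsub>chain_free G T\<^esub> x"
    using assms unfolding carrier_chain_group by blast
  have "Poly_Mapping.keys x \<subseteq> irrep_classes G T" using x(1) by simp
  then have "\<exists>X\<in>irreps G T. relator_subgroup #>\<^bsub>chain_free G T\<^esub> x = chain_class G T X"
  proof (rule free_Abelian_group_induct)
    have "relator_subgroup #>\<^bsub>chain_free G T\<^esub> \<one>\<^bsub>chain_free G T\<^esub> = chain_class G T trivial_rep"
      using F.coset_mult_one[OF subgroup.subset[OF subgroup_relators]] by (simp only: chain_class_trivial one_chain_group)
    then show "\<exists>X\<in>irreps G T. relator_subgroup #>\<^bsub>chain_free G T\<^esub> 0 = chain_class G T X"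
      using trivial_rep_irrep by (intro bexI[of _ trivial_rep]) simp_all
  next
    fix x y assume keys: "Poly_Mapping.keys x \<subseteq> irrep_classes G T" "Poly_Mapping.keys y \<subseteq> irrep_classes G T"
      and "\<exists>X\<in>irreps G T. relator_subgroup #>\<^bsub>chain_free G T\<^esub> x = chain_class G T X"
        "\<exists>X\<in>irreps G T. relator_subgroup #>\<^bsub>chain_free G T\<^esub> y = chain_class G T X"
    then obtain X Y where X: "X \<in> irreps G T" "relator_subgroup #>\<^bsub>chain_free G T\<^esub> x = chain_class G T X"
      and Y: "Y \<in> irreps G T" "relator_subgroup #>\<^bsub>chain_free G T\<^esub> y = chain_class G T Y" by blast
    have xF: "x \<in> carrier (chain_free G T)" and yF: "y \<in> carrier (chain_free G T)" using keys by simp_all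
    have dF: "x - y \<in> carrier (chain_free G T)"
      using F.m_closed[OF xF F.inv_closed[OF yF]] keys by simp
    let ?d = "relator_subgroup #>\<^bsub>chain_free G T\<^esub> (x - y)"
    have dC: "?d \<in> carrier (chain_group G T)" unfolding carrier_chain_group by (rule imageI[OF dF])
    have "?d \<otimes>\<^bsub>chain_group G T\<^esub> chain_class G T Y = chain_class G T X"
      using coset_mult[OF dF yF] X(2) Y(2) by simp
    then have "?d = chain_class G T X \<otimes>\<^bsub>chain_group G T\<^esub> inv\<^bsub>chain_group G T\<^esub> chain_class G T Y"
      using C.inv_solve_right[OF dC chain_class_in_chain_group[OF X(1)] chain_class_in_chain_group[OF Y(1)]] by simp
    with chain_class_quotient[OF X(1) Y(1)] show "\<exists>X\<in>irreps G T. ?d = chain_class G T X" by metis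
  next
    fix a assume "a \<in> irrep_classes G T"
    then show "\<exists>X\<in>irreps G T. relator_subgroup #>\<^bsub>chain_free G T\<^esub> frag_of a = chain_class G T X"
      by (auto simp: irrep_classes_iff chain_class_def)
  qed
  then show ?thesis using x(2) by simp
qed

section \<open>The comparison homomorphism\<close>

lemma ex_chain_hom:
  "\<exists>f \<in> hom (chain_group G T) (center_dual G T). \<forall>X\<in>irreps G T. f (chain_class G T X) = central_char G X"
proof -
  interpret D: comm_group "center_dual G T" by (rule comm_group_center_dual)
  interpret F: comm_group "chain_free G T" by (rule abelian_free_Abelian_group)
  \<comment> \<open>A representative of the class is chosen; isomorphic representations have equal
    central characters, so the value does not depend on it.\<close>
  define v where "v c = central_char G (SOME X. X \<in> irreps G T \<and> c = irrep_class G T X)" for c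
  have v: "v (irrep_class G T X) = central_char G X" if X: "X \<in> irreps G T" for X
  proof -
    define Y where "Y = (SOME Y. Y \<in> irreps G T \<and> irrep_class G T X = irrep_class G T Y)"
    have "Y \<in> irreps G T \<and> irrep_class G T X = irrep_class G T Y"
      unfolding Y_def by (rule someI[of _ X]) (use X in simp)
    then have "central_char G X = central_char G Y" using central_char_irrep_class[OF X] by blast
    moreover have "v (irrep_class G T X) = central_char G Y" unfolding v_def Y_def ..
    ultimately show ?thesis by simp
  qed
  have "v ` irrep_classes G T \<subseteq> carrier (center_dual G T)"
    using v central_char_in_dual by (auto simp: irrep_classes_iff)
  from D.free_Abelian_group_universal[OF this] obtain h where
    h: "h \<in> hom (chain_free G T) (center_dual G T)" "\<And>c. c \<in> irrep_classes G T \<Longrightarrow> h (frag_of c) = v c"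
    by metis
  have hX: "h (frag_of (irrep_class G T X)) = central_char G X" if "X \<in> irreps G T" for X
    using h(2)[of "irrep_class G T X"] v[OF that] that by (auto simp: irrep_classes_iff)
  interpret h: group_hom "chain_free G T" "center_dual G T" h
    by unfold_locales (rule h(1))
  \<comment> \<open>Multiplicativity of central characters sends every relator to 1, so the
    homomorphism on the free group descends to the quotient.\<close>
  have "chain_relators G T \<subseteq> kernel (chain_free G T) (center_dual G T) h"
  proof
    fix r assume "r \<in> chain_relators G T"
    then obtain X Y Z where X: "X \<in> irreps G T" and Y: "Y \<in> irreps G T" and Z: "Z \<in> irreps G T"
      and c: "contained G Z (tensor_rep X Y)"
      and r: "r = frag_of (irrep_class G T Z) \<otimes>\<^bsub>chain_free G T\<^esub>
        inv\<^bsub>chain_free G T\<^esub> (frag_of (irrep_class G T X) \<otimes>\<^bsub>chain_free G T\<^esub> frag_of (irrep_class G T Y))"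
      unfolding chain_relators_def by blast
    note in_F = frag_irrep_class[OF X] frag_irrep_class[OF Y] frag_irrep_class[OF Z]
    have eq: "central_char G Z = central_char G X \<otimes>\<^bsub>center_dual G T\<^esub> central_char G Y"
    proof (rule extensionalityI[of _ "carrier (center_group G)"])
      fix z assume z: "z \<in> carrier (center_group G)"
      show "central_char G Z z = (central_char G X \<otimes>\<^bsub>center_dual G T\<^esub> central_char G Y) z"
        unfolding central_char_tensor[OF X Y Z c z] using z by simp
    qed (simp_all add: central_char_def)
    have xy: "frag_of (irrep_class G T X) \<otimes>\<^bsub>chain_free G T\<^esub> frag_of (irrep_class G T Y) \<in> carrier (chain_free G T)"
      by (rule F.m_closed[OF in_F(1,2)])
    have "h r = h (frag_of (irrep_class G T Z)) \<otimes>\<^bsub>center_dual G T\<^esub> inv\<^bsub>center_dual G T\<^esub>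
        (h (frag_of (irrep_class G T X)) \<otimes>\<^bsub>center_dual G T\<^esub> h (frag_of (irrep_class G T Y)))"
      unfolding r h.hom_mult[OF in_F(3) F.inv_closed[OF xy]] h.hom_inv[OF xy] h.hom_mult[OF in_F(1,2)] ..
    also have "\<dots> = \<one>\<^bsub>center_dual G T\<^esub>"
      unfolding hX[OF X] hX[OF Y] hX[OF Z] eq[symmetric] by (rule D.r_inv[OF central_char_in_dual[OF Z]])
    finally have "h r = \<one>\<^bsub>center_dual G T\<^esub>" .
    moreover have "r \<in> carrier (chain_free G T)" unfolding r by (rule F.m_closed[OF in_F(3) F.inv_closed[OF xy]])
    ultimately show "r \<in> kernel (chain_free G T) (center_dual G T) h" unfolding kernel_def by blast
  qed
  then have "relator_subgroup \<subseteq> kernel (chain_free G T) (center_dual G T) h"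
    by (rule F.generate_subgroup_incl[OF _ h.subgroup_kernel])
  from h.FactGroup_universal_kernel[OF normal_relators this] obtain f where
    f: "f \<in> hom (chain_group G T) (center_dual G T)"
    "\<And>x. x \<in> carrier (chain_free G T) \<Longrightarrow> f (relator_subgroup #>\<^bsub>chain_free G T\<^esub> x) = h x"
    unfolding chain_group_def by metis
  have "f (chain_class G T X) = central_char G X" if X: "X \<in> irreps G T" for X
    unfolding chain_class_def f(2)[OF frag_irrep_class[OF X]] by (rule hX[OF X])
  with f(1) show ?thesis by blast
qed

text \<open>This justifies the description in \<open>alpha\<close>. Restricting a homomorphism to
  the carrier makes it extensional; uniqueness holds because every element is the class of an
  irreducible representation, where the value is prescribed.\<close>

lemma alpha_hom:
  "alpha G T \<in> hom (chain_group G T) (center_dual G T) \<and>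
    (\<forall>X\<in>irreps G T. alpha G T (chain_class G T X) = central_char G X)"
proof -
  interpret C: comm_group "chain_group G T" by (rule comm_group_chain_group)
  let ?P = "\<lambda>f. f \<in> hom (chain_group G T) (center_dual G T) \<inter> extensional (carrier (chain_group G T)) \<and>
     (\<forall>X\<in>irreps G T. f (chain_class G T X) = central_char G X)"
  obtain f where f: "f \<in> hom (chain_group G T) (center_dual G T)" 
    "\<And>X. X \<in> irreps G T \<Longrightarrow> f (chain_class G T X) = central_char G X" using ex_chain_hom by blast
  have ex: "?P (restrict f (carrier (chain_group G T)))"
    using f chain_class_in_chain_group C.m_closed by (auto simp: hom_def)
  have uniq: "f1 = f2" if "?P f1" "?P f2" for f1 f2
  proof (rule extensionalityI[of _ "carrier (chain_group G T)"])
    fix c assume "c \<in> carrier (chain_group G T)"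
    from chain_group_eq_chain_class[OF this] show "f1 c = f2 c" using that by auto
  qed (use that in auto)
  have "\<exists>!f. ?P f"
  proof (rule ex_ex1I)
    show "\<exists>f. ?P f" by (rule exI[of ?P, OF ex])
  qed (rule uniq)
  then have "?P (THE f. ?P f)" by (rule theI')
  then show ?thesis unfolding alpha_def by blast
qed

text \<open>Triviality of the class has the required closure properties: it is multiplicative on
  constituents, and constituents of \<open>tensor_rep Y (dual_rep Y)\<close> have the class of
  \<open>Y\<close> times its inverse.\<close>

lemma chain_class_eq_one:
  assumes X: "X \<in> irreps G T" and char: "central_char G X = \<one>\<^bsub>center_dual G T\<^esub>"
  shows "chain_class G T X = \<one>\<^bsub>chain_group G T\<^esub>"
proof (rule trivial_central_char_closed_family[where P = "\<lambda>X. chain_class G T X = \<one>\<^bsub>chain_group G T\<^esub>"])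
  interpret C: comm_group "chain_group G T" by (rule comm_group_chain_group)
  show "chain_class G T trivial_rep = \<one>\<^bsub>chain_group G T\<^esub>" by (rule chain_class_trivial)
  show "chain_class G T (dual_rep Y) = \<one>\<^bsub>chain_group G T\<^esub>"
    if Y: "Y \<in> irreps G T" and one: "chain_class G T Y = \<one>\<^bsub>chain_group G T\<^esub>" for Y
    using chain_class_dual[OF Y] C.l_one[OF chain_class_in_chain_group[OF dual_rep_irrep[OF Y]]]
    unfolding one by simp
  show "chain_class G T W = \<one>\<^bsub>chain_group G T\<^esub>"
    if "Y \<in> irreps G T" "Z \<in> irreps G T" "W \<in> irreps G T" "chain_class G T Y = \<one>\<^bsub>chain_group G T\<^esub>"
      "chain_class G T Z = \<one>\<^bsub>chain_group G T\<^esub>" "contained G W (tensor_rep Y Z)" for W Y Z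
    using chain_class_tensor[OF that(1-3,6)] that(4,5) by simp
  show "chain_class G T Z = \<one>\<^bsub>chain_group G T\<^esub>"
    if "Y \<in> irreps G T" "Z \<in> irreps G T" "contained G Z (tensor_rep Y (dual_rep Y))" for Y Z
    using chain_class_tensor[OF that(1) dual_rep_irrep[OF that(1)] that(2,3)] chain_class_dual[OF that(1)] by simp
  show "X \<in> irreps G T" by (rule X)
  show "central_char G X z = 1" if "z \<in> carrier (center_group G)" for z using char that by simp
qed

end

theorem theorem3p1:
  fixes G :: "('a, 'm) monoid_scheme" and T :: "'a topology"
  assumes "compact_group G T"
  shows "alpha G T \<in> iso (chain_group G T) (center_dual G T) \<and>
    (\<forall>X\<in>irreps G T. alpha G T (chain_class G T X) = central_char G X)"
proof -
  interpret compact_group G T by (rule assms)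
  interpret C: comm_group "chain_group G T" by (rule comm_group_chain_group)
  interpret D: comm_group "center_dual G T" by (rule comm_group_center_dual)
  interpret A: group_hom "chain_group G T" "center_dual G T" "alpha G T"
    by unfold_locales (use alpha_hom in blast)
  have val: "alpha G T (chain_class G T X) = central_char G X" if "X \<in> irreps G T" for X
    using alpha_hom that by blast
  \<comment> \<open>An element of the kernel is the class of one irreducible representation, whose
    central character is then trivial.\<close>
  have "inj_on (alpha G T) (carrier (chain_group G T))"
    unfolding A.inj_on_one_iff
  proof (intro allI impI)
    fix c assume c: "c \<in> carrier (chain_group G T)" "alpha G T c = \<one>\<^bsub>center_dual G T\<^esub>"
    then obtain X where X: "X \<in> irreps G T" "c = chain_class G T X" using chain_group_eq_chain_class by blast
    with c(2) val[OF X(1)] show "c = \<one>\<^bsub>chain_group G T\<^esub>" using chain_class_eq_one[OF X(1)] by simp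
  qed
  moreover have "alpha G T ` carrier (chain_group G T) = carrier (center_dual G T)"
  proof
    show "alpha G T ` carrier (chain_group G T) \<subseteq> carrier (center_dual G T)" using A.hom_closed by blast
    show "carrier (center_dual G T) \<subseteq> alpha G T ` carrier (chain_group G T)"
    proof
      fix \<xi> assume "\<xi> \<in> carrier (center_dual G T)"
      then obtain X where "X \<in> irreps G T" "central_char G X = \<xi>" using ex_irrep_central_char by blast
      then show "\<xi> \<in> alpha G T ` carrier (chain_group G T)"
        using val chain_class_in_chain_group by (metis image_eqI)
    qed
  qed
  ultimately have "alpha G T \<in> iso (chain_group G T) (center_dual G T)"
    using A.homh by (simp add: iso_def bij_betw_def)
  then show ?thesis using val by blast
qed

end
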